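(* Let $\mathfrak{g}$ be a $3$-dimensional real Lie algebra with $\dim[\mathfrak{g},\mathfrak{g}]=1$ and $[\mathfrak{g},\mathfrak{g}]\not\subset Z(\mathfrak{g})$ (the center), and let $w\ge 0$ be an integer. For the weight-$w$ chain complex $C_\bullet^{[w]}$ of the Lie superalgebra $\overline{\mathfrak{g}}$ associated with $\mathfrak{g}$, one has \[ \begin{array}{c|c|c|c} m & \dim C_m^{[w]} & \dim\ker(\partial:C_m^{[w]}\to C_{m-1}^{[w]}) & m\text{-th Betti number}\\\hline w-1 & \binom{w}{2} & \binom{w}{2} & 0\\ w & 3\binom{w}{2}+\binom{w+2}{2} & 2\binom{w}{2}+\binom{w+2}{2} & 1\\ w+1 & 3\binom{w}{2}+3\binom{w+2}{2} & 1+\binom{w}{2}+2\binom{w+2}{2} & 2\\ w+2 & \binom{w}{2}+3\binom{w+2}{2} & 1+\binom{w+2}{2} & 1\\ w+3 & \binom{w+2}{2} & 0 & 0 \end{array} \]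
   Context: For a finite dimensional real Lie algebra $\mathfrak{g}$ of dimension $n$, let $\overline{\mathfrak{g}}=\bigoplus_{i=0}^{n-1}\mathfrak{g}_i$ with $\mathfrak{g}_i=\Lambda^{i+1}\mathfrak{g}$ (elements of $\mathfrak{g}_i$ have grade $i$). It is a $\mathbb{Z}$-graded Lie superalgebra with the Schouten-like bracket: for $a=a_1\wedge\cdots\wedge a_k$ and $b=b_1\wedge\cdots\wedge b_l$ with $a_i,b_j\in\mathfrak{g}$, \[ [a,b]_S=\sum_{i,j}(-1)^{i+j}[a_i,b_j]\wedge a[i]\wedge b[j], \] where $a[i]$ (resp. $b[j]$) is $a$ (resp. $b$) with the factor $a_i$ (resp. $b_j$) omitted. Chains: take the quotient of the tensor algebra of the vector space $\overline{\mathfrak{g}}$ by the two-sided ideal generated by $X\otimes Y+(-1)^{xy}Y\otimes X$ for $X\in\mathfrak{g}_x$, $Y\in\mathfrak{g}_y$; denote the induced product by $\bigtriangleup$. (So factors of odd grade commute with each other, and factors of even grade anticommute with all homogeneous factors.) The space $C_m$ of $m$-chains is the image of the $m$-fold tensors. The weight of $Y_1\bigtriangleup\cdots\bigtriangleup Y_m$ with $Y_i\in\mathfrak{g}_{y_i}$ is $y_1+\cdots+y_m$, and $C_m^{[w]}\subset C_m$ is the subspace of chains of weight $w$ (zero if $m<0$). The boundary operator $\partial:C_m\to C_{m-1}$ is \[ \partial(Y_1\bigtriangleup\cdots\bigtriangleup Y_m)=\sum_{i<j}(-1)^{\,i-1+y_i\sum_{i<s<j}y_s}\;Y_1\bigtriangleup\cdots\widehat{Y_i}\cdots\bigtriangleup[Y_i,Y_j]_S\bigtriangleup\cdots\bigtriangleup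 Y_m, \] where $Y_i$ is omitted and $[Y_i,Y_j]_S$ is placed in the position of $Y_j$. It preserves weight and satisfies $\partial\circ\partial=0$. The $m$-th Betti number in weight $w$ is $\dim\bigl(\ker(\partial:C_m^{[w]}\to C_{m-1}^{[w]})/\partial(C_{m+1}^{[w]})\bigr)$. By convention $\binom{0}{2}=\binom{1}{2}=0$. *)

theory Defs
  imports "HOL-Analysis.Analysis" "HOL-Analysis.Finite_Function_Topology"
begin

section \<open>Free algebras and two-sided ideals\<close>

text \<open>Words with concatenation form the free monoid, so that \<open>'a list \<Rightarrow>\<^sub>0 real\<close> is the free
  associative unital real algebra on the set of all elements of \<open>'a\<close>.\<close>

instantiation list :: (type) monoid_add
begin
definition zero_list :: "'a list" where "zero_list = []"
definition plus_list :: "'a list \<Rightarrow> 'a list \<Rightarrow> 'a list" where "plus_list xs ys = xs @ ys"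
instance by standard (simp_all add: zero_list_def plus_list_def)
end

lemma lookup_scaleR: "Poly_Mapping.lookup (r *\<^sub>R p) k = r *\<^sub>R Poly_Mapping.lookup p k"
proof -
  have "finite {i. r *\<^sub>R Poly_Mapping.lookup p i \<noteq> 0}"
    by (rule finite_subset[OF _ finite_lookup[of p]]) auto
  then show ?thesis
    by (simp add: scaleR_poly_mapping_def)
qed

lemma poly_mapping_expand:
  "p = (\<Sum>k\<in>Poly_Mapping.keys p. Poly_Mapping.single k (Poly_Mapping.lookup p k))"
  by (rule poly_mapping_eqI)
    (simp add: lookup_sum lookup_single when_def in_keys_iff)

lemma scaleR_single: "r *\<^sub>R Poly_Mapping.single k v = Poly_Mapping.single k (r *\<^sub>R v)"
  by (rule poly_mapping_eqI) (simp add: lookup_scaleR lookup_single when_def)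

instance poly_mapping :: (monoid_add, real_algebra) real_algebra
proof
  fix r :: real and p q :: "'a \<Rightarrow>\<^sub>0 'b"
  show "r *\<^sub>R p * q = r *\<^sub>R (p * q)"
    by (subst (1 2) poly_mapping_expand[of p], subst (1 2) poly_mapping_expand[of q])
      (simp add: scaleR_sum_right sum_distrib_left sum_distrib_right mult_single scaleR_single)
  show "p * r *\<^sub>R q = r *\<^sub>R (p * q)"
    by (subst (1 2) poly_mapping_expand[of p], subst (1 2) poly_mapping_expand[of q])
      (simp add: scaleR_sum_right sum_distrib_left sum_distrib_right mult_single scaleR_single)
qed

definition two_sided_ideal :: "'a::{real_algebra, monoid_mult} set \<Rightarrow> 'a set" where
  "two_sided_ideal S = span {a * s * b | a s b. s \<in> S}"

lemma two_sided_ideal_times_left: "x \<in> two_sided_ideal S \<Longrightarrow> a * x \<in> two_sided_ideal S"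
  unfolding two_sided_ideal_def
proof (induction rule: span_induct_alt)
  case (step c x y)
  then obtain b s d where "x = b * s * d" "s \<in> S" by auto
  then have "a * x = (a * b) * s * d" by (simp add: mult.assoc)
  with \<open>s \<in> S\<close> have "a * x \<in> {a * s * b | a s b. s \<in> S}" by blast
  with step show ?case by (simp add: distrib_left span_add span_scale span_base)
qed (simp add: span_zero)

lemma two_sided_ideal_times_right: "x \<in> two_sided_ideal S \<Longrightarrow> x * a \<in> two_sided_ideal S"
  unfolding two_sided_ideal_def
proof (induction rule: span_induct_alt)
  case (step c x y)
  then obtain b s d where "x = b * s * d" "s \<in> S" by auto
  then have "x * a = b * s * (d * a)" by (simp add: mult.assoc)
  with \<open>s \<in> S\<close> have "x * a \<in> {a * s * b | a s b. s \<in> S}" by blast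
  with step show ?case by (simp add: distrib_right span_add span_scale span_base)
qed (simp add: span_zero)

definition cong_ideal :: "'a::{real_algebra, monoid_mult} set \<Rightarrow> 'a \<Rightarrow> 'a \<Rightarrow> bool" where
  "cong_ideal S x y \<longleftrightarrow> x - y \<in> two_sided_ideal S"

lemma subspace_two_sided_ideal: "subspace (two_sided_ideal S)"
  unfolding two_sided_ideal_def by (rule subspace_span)

lemma equivp_cong_ideal: "equivp (cong_ideal S)"
proof (rule equivpI)
  show "reflp (cong_ideal S)"
    by (simp add: reflp_def cong_ideal_def subspace_0[OF subspace_two_sided_ideal])
  show "symp (cong_ideal S)"
    using subspace_neg[OF subspace_two_sided_ideal] by (force simp: symp_def cong_ideal_def)
  show "transp (cong_ideal S)"
    using subspace_add[OF subspace_two_sided_ideal] by (force simp: transp_def cong_ideal_def)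
qed

lemma cong_ideal_add:
  assumes "cong_ideal S x y" "cong_ideal S u v"
  shows "cong_ideal S (x + u) (y + v)"
  using subspace_add[OF subspace_two_sided_ideal assms[unfolded cong_ideal_def]]
  by (simp add: cong_ideal_def add_diff_add)

lemma cong_ideal_scaleR: "cong_ideal S x y \<Longrightarrow> cong_ideal S (r *\<^sub>R x) (r *\<^sub>R y)"
  using subspace_scale[OF subspace_two_sided_ideal, of "x - y" S r]
  by (simp add: cong_ideal_def scaleR_diff_right)

lemma cong_ideal_uminus: "cong_ideal S x y \<Longrightarrow> cong_ideal S (- x) (- y)"
  using cong_ideal_scaleR[of S x y "-1"] by simp

lemma cong_ideal_diff:
  "cong_ideal S x y \<Longrightarrow> cong_ideal S u v \<Longrightarrow> cong_ideal S (x - u) (y - v)"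
  using cong_ideal_add[OF _ cong_ideal_uminus, of S x y u v] by simp

lemma cong_ideal_times:
  assumes "cong_ideal S x y" "cong_ideal S u v"
  shows "cong_ideal S (x * u) (y * v)"
proof -
  have "x * u - y * v = (x - y) * u + y * (u - v)" by (simp add: algebra_simps)
  moreover have "(x - y) * u \<in> two_sided_ideal S" "y * (u - v) \<in> two_sided_ideal S"
    using assms unfolding cong_ideal_def
    by (auto intro: two_sided_ideal_times_left two_sided_ideal_times_right)
  ultimately show ?thesis
    unfolding cong_ideal_def by (simp add: subspace_add[OF subspace_two_sided_ideal])
qed

section \<open>The tensor algebra of a real vector space\<close>

definition tensor_relations :: "('a::real_vector list \<Rightarrow>\<^sub>0 real) set" where
  "tensor_relations =
     {Poly_Mapping.single [x + y] 1 - Poly_Mapping.single [x] 1 - Poly_Mapping.single [y] 1 | x y. True}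
   \<union> {Poly_Mapping.single [c *\<^sub>R x] 1 - c *\<^sub>R Poly_Mapping.single [x] 1 | c x. True}"

quotient_type (overloaded) 'a tensor_algebra = "'a::real_vector list \<Rightarrow>\<^sub>0 real"
  / "cong_ideal tensor_relations"
  by (rule equivp_cong_ideal)

instantiation tensor_algebra :: (real_vector) "{real_algebra, monoid_mult}"
begin
lift_definition zero_tensor_algebra :: "'a tensor_algebra" is 0 .
lift_definition one_tensor_algebra :: "'a tensor_algebra" is 1 .
lift_definition plus_tensor_algebra :: "'a tensor_algebra \<Rightarrow> 'a tensor_algebra \<Rightarrow> 'a tensor_algebra"
  is "(+)" by (rule cong_ideal_add)
lift_definition minus_tensor_algebra :: "'a tensor_algebra \<Rightarrow> 'a tensor_algebra \<Rightarrow> 'a tensor_algebra"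
  is "(-)" by (rule cong_ideal_diff)
lift_definition uminus_tensor_algebra :: "'a tensor_algebra \<Rightarrow> 'a tensor_algebra"
  is uminus by (rule cong_ideal_uminus)
lift_definition times_tensor_algebra :: "'a tensor_algebra \<Rightarrow> 'a tensor_algebra \<Rightarrow> 'a tensor_algebra"
  is "(*)" by (rule cong_ideal_times)
lift_definition scaleR_tensor_algebra :: "real \<Rightarrow> 'a tensor_algebra \<Rightarrow> 'a tensor_algebra"
  is scaleR by (rule cong_ideal_scaleR)
instance
  by standard
    (transfer; simp add: algebra_simps equivp_reflp[OF equivp_cong_ideal])+
end

lift_definition tensor_inc :: "'a::real_vector \<Rightarrow> 'a tensor_algebra"
  is "\<lambda>x. Poly_Mapping.single [x] 1" .

section \<open>The exterior algebra\<close>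

definition exterior_relations :: "'a::real_vector tensor_algebra set" where
  "exterior_relations = {tensor_inc x * tensor_inc x | x. True}"

quotient_type (overloaded) 'a exterior_algebra = "'a::real_vector tensor_algebra"
  / "cong_ideal exterior_relations"
  by (rule equivp_cong_ideal)

instantiation exterior_algebra :: (real_vector) "{real_algebra, monoid_mult}"
begin
lift_definition zero_exterior_algebra :: "'a exterior_algebra" is 0 .
lift_definition one_exterior_algebra :: "'a exterior_algebra" is 1 .
lift_definition plus_exterior_algebra ::
  "'a exterior_algebra \<Rightarrow> 'a exterior_algebra \<Rightarrow> 'a exterior_algebra"
  is "(+)" by (rule cong_ideal_add)
lift_definition minus_exterior_algebra ::
  "'a exterior_algebra \<Rightarrow> 'a exterior_algebra \<Rightarrow> 'a exterior_algebra"
  is "(-)" by (rule cong_ideal_diff)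
lift_definition uminus_exterior_algebra :: "'a exterior_algebra \<Rightarrow> 'a exterior_algebra"
  is uminus by (rule cong_ideal_uminus)
lift_definition times_exterior_algebra ::
  "'a exterior_algebra \<Rightarrow> 'a exterior_algebra \<Rightarrow> 'a exterior_algebra"
  is "(*)" by (rule cong_ideal_times)
lift_definition scaleR_exterior_algebra :: "real \<Rightarrow> 'a exterior_algebra \<Rightarrow> 'a exterior_algebra"
  is scaleR by (rule cong_ideal_scaleR)
instance
  by standard
    (transfer; simp add: algebra_simps equivp_reflp[OF equivp_cong_ideal])+
end

lift_definition exterior_inc :: "'a::real_vector \<Rightarrow> 'a exterior_algebra" is tensor_inc .

definition exterior_power :: "nat \<Rightarrow> 'a::real_vector exterior_algebra set" where
  "exterior_power k = span {prod_list (map exterior_inc vs) | vs. length vs = k}"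

section \<open>The graded space of positive exterior powers\<close>

text \<open>Since \<open>exterior_power k = {0}\<close> for \<open>k\<close> greater than the dimension of \<open>'a\<close>, it is harmless
  to admit all positive exterior powers.\<close>

typedef (overloaded) 'a multivector =
  "span (\<Union>i. exterior_power (Suc i)) :: 'a::real_vector exterior_algebra set"
  using span_zero by blast

setup_lifting type_definition_multivector

instantiation multivector :: (real_vector) real_vector
begin
lift_definition zero_multivector :: "'a multivector" is 0 by (rule span_zero)
lift_definition plus_multivector :: "'a multivector \<Rightarrow> 'a multivector \<Rightarrow> 'a multivector"
  is "(+)" by (rule span_add)
lift_definition minus_multivector :: "'a multivector \<Rightarrow> 'a multivector \<Rightarrow> 'a multivector"
  is "(-)" by (rule span_diff)
lift_definition uminus_multivector :: "'a multivector \<Rightarrow> 'a multivector"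
  is uminus by (rule span_neg)
lift_definition scaleR_multivector :: "real \<Rightarrow> 'a multivector \<Rightarrow> 'a multivector"
  is scaleR by (rule span_scale)
instance
  by standard (transfer; simp add: algebra_simps)+
end

text \<open>\<open>grade i\<close> is the \<open>(i + 1)\<close>-st exterior power.\<close>

definition grade :: "nat \<Rightarrow> 'a::real_vector multivector set" where
  "grade i = {X. Rep_multivector X \<in> exterior_power (Suc i)}"

text \<open>\<open>wedge vs\<close> is only meaningful for \<open>vs \<noteq> []\<close>.\<close>

definition wedge :: "'a::real_vector list \<Rightarrow> 'a multivector" where
  "wedge vs = Abs_multivector (prod_list (map exterior_inc vs))"

section \<open>Lie brackets and the Schouten bracket\<close>

definition lie_bracket :: "('a::real_vector \<Rightarrow> 'a \<Rightarrow> 'a) \<Rightarrow> bool" where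
  "lie_bracket br \<longleftrightarrow> bilinear br \<and> (\<forall>x. br x x = 0) \<and>
     (\<forall>x y z. br x (br y z) + br y (br z x) + br z (br x y) = 0)"

definition derived_algebra :: "('a::real_vector \<Rightarrow> 'a \<Rightarrow> 'a) \<Rightarrow> 'a set" where
  "derived_algebra br = span {br x y | x y. True}"

definition lie_center :: "('a::real_vector \<Rightarrow> 'a \<Rightarrow> 'a) \<Rightarrow> 'a set" where
  "lie_center br = {z. \<forall>x. br z x = 0}"

definition omit_nth :: "nat \<Rightarrow> 'b list \<Rightarrow> 'b list" where
  "omit_nth i xs = take i xs @ drop (Suc i) xs"

text \<open>Indices start at \<open>0\<close>, which does not change the parity of \<open>i + j\<close>.\<close>

definition schouten_sum ::
  "('a::real_vector \<Rightarrow> 'a \<Rightarrow> 'a) \<Rightarrow> 'a list \<Rightarrow> 'a list \<Rightarrow> 'a multivector" where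
  "schouten_sum br as bs = (\<Sum>i<length as. \<Sum>j<length bs.
     (- 1) ^ (i + j) *\<^sub>R wedge (br (as ! i) (bs ! j) # omit_nth i as @ omit_nth j bs))"

definition is_schouten ::
  "('a::real_vector \<Rightarrow> 'a \<Rightarrow> 'a) \<Rightarrow> ('a multivector \<Rightarrow> 'a multivector \<Rightarrow> 'a multivector) \<Rightarrow> bool" where
  "is_schouten br S \<longleftrightarrow> bilinear S \<and>
     (\<forall>as bs. as \<noteq> [] \<longrightarrow> bs \<noteq> [] \<longrightarrow> S (wedge as) (wedge bs) = schouten_sum br as bs)"

definition schouten ::
  "('a::real_vector \<Rightarrow> 'a \<Rightarrow> 'a) \<Rightarrow> 'a multivector \<Rightarrow> 'a multivector \<Rightarrow> 'a multivector" where
  "schouten br = (THE S. is_schouten br S)"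

section \<open>Chains\<close>


definition chain_relations :: "'a::real_vector multivector tensor_algebra set" where
  "chain_relations = {tensor_inc X * tensor_inc Y + (- 1) ^ (x * y) *\<^sub>R (tensor_inc Y * tensor_inc X)
     | X Y x y. X \<in> grade x \<and> Y \<in> grade y}"

quotient_type (overloaded) 'a chain_algebra = "'a::real_vector multivector tensor_algebra"
  / "cong_ideal chain_relations"
  by (rule equivp_cong_ideal)

instantiation chain_algebra :: (real_vector) "{real_algebra, monoid_mult}"
begin
lift_definition zero_chain_algebra :: "'a chain_algebra" is 0 .
lift_definition one_chain_algebra :: "'a chain_algebra" is 1 .
lift_definition plus_chain_algebra ::
  "'a chain_algebra \<Rightarrow> 'a chain_algebra \<Rightarrow> 'a chain_algebra"
  is "(+)" by (rule cong_ideal_add)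
lift_definition minus_chain_algebra ::
  "'a chain_algebra \<Rightarrow> 'a chain_algebra \<Rightarrow> 'a chain_algebra"
  is "(-)" by (rule cong_ideal_diff)
lift_definition uminus_chain_algebra :: "'a chain_algebra \<Rightarrow> 'a chain_algebra"
  is uminus by (rule cong_ideal_uminus)
lift_definition times_chain_algebra ::
  "'a chain_algebra \<Rightarrow> 'a chain_algebra \<Rightarrow> 'a chain_algebra"
  is "(*)" by (rule cong_ideal_times)
lift_definition scaleR_chain_algebra :: "real \<Rightarrow> 'a chain_algebra \<Rightarrow> 'a chain_algebra"
  is scaleR by (rule cong_ideal_scaleR)
instance
  by standard
    (transfer; simp add: algebra_simps equivp_reflp[OF equivp_cong_ideal])+
end

definition chain_inc :: "'a::real_vector multivector \<Rightarrow> 'a chain_algebra" where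
  "chain_inc Y = abs_chain_algebra (tensor_inc Y)"

definition chain_prod :: "'a::real_vector multivector list \<Rightarrow> 'a chain_algebra" where
  "chain_prod Ys = prod_list (map chain_inc Ys)"

text \<open>For \<open>m < 0\<close> this is the span of the empty set, that is, \<open>{0}\<close>.\<close>

definition chain_space :: "int \<Rightarrow> nat \<Rightarrow> 'a::real_vector chain_algebra set" where
  "chain_space m w = span {chain_prod Ys | Ys ys.
     list_all2 (\<lambda>Y y. Y \<in> grade y) Ys ys \<and> int (length Ys) = m \<and> sum_list ys = w}"

text \<open>Since indices start at \<open>0\<close>, the exponent \<open>i - 1\<close> of the usual formula becomes \<open>i\<close>.\<close>

definition boundary_sum ::
  "('a::real_vector \<Rightarrow> 'a \<Rightarrow> 'a) \<Rightarrow> 'a multivector list \<Rightarrow> nat list \<Rightarrow> 'a chain_algebra" where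
  "boundary_sum br Ys ys = (\<Sum>j<length Ys. \<Sum>i<j.
     (- 1) ^ (i + ys ! i * (\<Sum>s\<in>{i<..<j}. ys ! s)) *\<^sub>R
       chain_prod (omit_nth i (Ys[j := schouten br (Ys ! i) (Ys ! j)])))"

definition is_boundary ::
  "('a::real_vector \<Rightarrow> 'a \<Rightarrow> 'a) \<Rightarrow> ('a chain_algebra \<Rightarrow> 'a chain_algebra) \<Rightarrow> bool" where
  "is_boundary br d \<longleftrightarrow> linear d \<and>
     (\<forall>Ys ys. list_all2 (\<lambda>Y y. Y \<in> grade y) Ys ys \<longrightarrow> d (chain_prod Ys) = boundary_sum br Ys ys)"

definition boundary :: "('a::real_vector \<Rightarrow> 'a \<Rightarrow> 'a) \<Rightarrow> 'a chain_algebra \<Rightarrow> 'a chain_algebra" where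
  "boundary br = (THE d. is_boundary br d)"

section \<open>Betti numbers\<close>

definition cycles :: "('a::real_vector \<Rightarrow> 'a \<Rightarrow> 'a) \<Rightarrow> int \<Rightarrow> nat \<Rightarrow> 'a chain_algebra set" where
  "cycles br m w = {c \<in> chain_space m w. boundary br c = 0}"

text \<open>\<open>quotient_basis V U B\<close>: the cosets \<open>b + U\<close> of the elements \<open>b\<close> of \<open>B\<close> are pairwise distinct
  and form a basis of the quotient space \<open>V / U\<close>.\<close>

definition quotient_basis :: "'b::real_vector set \<Rightarrow> 'b set \<Rightarrow> 'b set \<Rightarrow> bool" where
  "quotient_basis V U B \<longleftrightarrow> B \<subseteq> V \<and>
     (\<forall>F c. finite F \<longrightarrow> F \<subseteq> B \<longrightarrow> (\<Sum>b\<in>F. c b *\<^sub>R b) \<in> U \<longrightarrow> (\<forall>b\<in>F. c b = 0)) \<and>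
     (\<forall>v\<in>V. \<exists>F c. finite F \<and> F \<subseteq> B \<and> v - (\<Sum>b\<in>F. c b *\<^sub>R b) \<in> U)"

definition quotient_dim :: "'b::real_vector set \<Rightarrow> 'b set \<Rightarrow> nat" where
  "quotient_dim V U = card (SOME B. quotient_basis V U B)"

definition betti :: "('a::real_vector \<Rightarrow> 'a \<Rightarrow> 'a) \<Rightarrow> int \<Rightarrow> nat \<Rightarrow> nat" where
  "betti br m w = quotient_dim (cycles br m w) (boundary br ` chain_space (m + 1) w)"

end

theory Submission
  imports Defs
begin

text \<open>The Lie algebra has a basis \<open>h, e, f\<close> with \<open>[h, e] = e\<close> and \<open>f\<close> central
  (\<open>adapted_basis\<close>). It gives the basis \<open>h, e, f\<close> (grade 0), \<open>h\<and>e, e\<and>f, h\<and>f\<close> (grade 1),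
  \<open>h\<and>e\<and>f\<close> (grade 2) of the multivectors, in which bracketing with \<open>h\<close> is diagonal: the eigenvalue
  is 1 on the multivectors that contain \<open>e\<close> and 0 on \<open>h, f, h\<and>f\<close>. Ordered monomials in these seven
  generators, with exponent at most 1 for generators of even grade, form a basis of the chain algebra.
  The derivation \<open>L\<close> of the chain algebra that extends bracketing with \<open>h\<close> is diagonal in this
  basis; its eigenvalue on a monomial is the number of factors that contain \<open>e\<close>.

  The reason for the Betti numbers is the Cartan formula \<open>\<partial>(h c) + h \<partial>c = L c\<close>. Since \<open>\<partial>\<close> commutes
  with \<open>L\<close>, multiplication by \<open>h\<close> after \<open>L\<^sup>-\<^sup>1\<close> is a contraction of the part of the complex on which
  \<open>L\<close> is invertible. The kernel of \<open>L\<close> has in weight \<open>w\<close> the basis \<open>h\<^sup>a f\<^sup>b (h\<and>f)\<^sup>w\<close> with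
  \<open>a, b \<le> 1\<close>, and \<open>\<partial>\<close> vanishes there, because all brackets of \<open>h, f, h\<and>f\<close> vanish. These four chains
  have degrees \<open>w, w + 1, w + 1, w + 2\<close>; hence the Betti numbers 1, 2, 1. The contraction also
  yields bases (\<open>cycles_eq\<close>, \<open>boundaries_eq\<close>, \<open>cycle_gen_independent\<close>): the boundaries of degree \<open>m\<close>
  are spanned by the chains \<open>\<partial>(h n)\<close>, where \<open>n\<close> runs through the monomials of degree \<open>m\<close> without
  factor \<open>h\<close> and with nonzero eigenvalue, and the cycles are spanned by these and the kernel of \<open>L\<close>.
  So every dimension in the table is a number of monomials.

  The Schouten bracket, the boundary and linear independence of monomials all require linear maps on
  algebras that are given by generators and relations. They all come from one principle: operators
  that satisfy the relations define an action of the algebra (\<open>exterior_action_exists\<close>,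
  \<open>chain_action_exists\<close>). Coordinates of multivectors come from an action on \<open>\<real>\<^sup>8\<close>, independence of
  monomials from an action on the free space on exponent vectors, and the operators \<open>L\<close> and \<open>\<partial>\<close> from
  actions by triangular \<open>2 \<times> 2\<close> matrices of operators (\<open>twisted_operator_exists\<close>). The boundary is
  characterised by \<open>\<partial>(X c) = L\<^sub>X c - X \<partial>c\<close>, and graded antisymmetry of the Schouten bracket makes it
  well defined; the graded Jacobi identity gives \<open>[L\<^sub>X, L\<^sub>Y] = L\<close> of the bracket, hence that \<open>\<partial>\<close> commutes
  with all \<open>L\<^sub>X\<close>, hence \<open>\<partial>\<partial> = 0\<close>.\<close>

section \<open>Actions of algebras given by generators and relations\<close>

definition linear_extension :: "('k \<Rightarrow> 'b::real_vector) \<Rightarrow> ('k \<Rightarrow>\<^sub>0 real) \<Rightarrow> 'b" where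
  "linear_extension g p = (\<Sum>k\<in>Poly_Mapping.keys p. Poly_Mapping.lookup p k *\<^sub>R g k)"

lemma linear_extension_superset:
  assumes "finite K" "Poly_Mapping.keys p \<subseteq> K"
  shows "linear_extension g p = (\<Sum>k\<in>K. Poly_Mapping.lookup p k *\<^sub>R g k)"
  unfolding linear_extension_def
  by (rule sum.mono_neutral_left) (use assms in \<open>auto simp: in_keys_iff\<close>)

lemma linear_extension_single: "linear_extension g (Poly_Mapping.single k c) = c *\<^sub>R g k"
  by (subst linear_extension_superset[of "{k}"]) auto

lemma linear_linear_extension: "linear (linear_extension g)"
proof (rule linearI)
  fix p q :: "'a \<Rightarrow>\<^sub>0 real" and r :: real
  let ?K = "Poly_Mapping.keys p \<union> Poly_Mapping.keys q \<union> Poly_Mapping.keys (p + q)"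
  show "linear_extension g (p + q) = linear_extension g p + linear_extension g q"
    by (subst (1 2 3) linear_extension_superset[of ?K])
      (auto simp: lookup_add scaleR_left_distrib sum.distrib)
  let ?K = "Poly_Mapping.keys p \<union> Poly_Mapping.keys (r *\<^sub>R p)"
  show "linear_extension g (r *\<^sub>R p) = r *\<^sub>R linear_extension g p"
    by (subst (1 2) linear_extension_superset[of ?K]) (auto simp: lookup_scaleR scaleR_sum_right)
qed

definition free_action :: "('v \<Rightarrow> 'b \<Rightarrow> 'b) \<Rightarrow> ('v list \<Rightarrow>\<^sub>0 real) \<Rightarrow> 'b \<Rightarrow> 'b::real_vector" where
  "free_action \<phi> p b = linear_extension (\<lambda>xs. foldr \<phi> xs b) p"

lemma linear_foldr:
  assumes "\<And>v. linear (\<phi> v)"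
  shows "linear (foldr \<phi> xs)"
proof (induction xs)
  case Nil
  then show ?case by (simp add: linear_iff)
next
  case (Cons x xs)
  then show ?case using linear_compose[of "foldr \<phi> xs" "\<phi> x"] assms by (simp add: o_def)
qed

lemma free_action_single: "free_action \<phi> (Poly_Mapping.single xs c) b = c *\<^sub>R foldr \<phi> xs b"
  by (simp add: free_action_def linear_extension_single)

lemma bilinear_free_action:
  assumes "\<And>v. linear (\<phi> v)"
  shows "bilinear (free_action \<phi>)"
  unfolding bilinear_def
proof (intro conjI allI)
  show "linear (free_action \<phi> p)" for p
    using linear_add[OF linear_foldr[of \<phi>, OF assms]] linear_scale[OF linear_foldr[of \<phi>, OF assms]]
    by (auto intro!: linearI simp: free_action_def linear_extension_def scaleR_right_distrib
        sum.distrib scaleR_sum_right mult.commute)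
  show "linear (\<lambda>p. free_action \<phi> p b)" for b
    unfolding free_action_def by (rule linear_linear_extension)
qed

lemma linear_mult_left: "linear (\<lambda>y::'a::real_algebra. x * y)"
  and linear_mult_right: "linear (\<lambda>y::'a::real_algebra. y * x)"
  by (simp_all add: linear_iff distrib_left distrib_right)

lemma linear_eq_on_singles:
  assumes "linear f" "linear g" "\<And>k. f (Poly_Mapping.single k 1) = g (Poly_Mapping.single k (1::real))"
  shows "f p = g p"
proof -
  have p: "p = (\<Sum>k\<in>Poly_Mapping.keys p. Poly_Mapping.lookup p k *\<^sub>R Poly_Mapping.single k 1)"
    using poly_mapping_expand[of p] by (simp add: scaleR_single)
  show ?thesis
    by (subst (1 2) p) (simp only: linear_sum[OF assms(1)] linear_sum[OF assms(2)]
        linear_scale[OF assms(1)] linear_scale[OF assms(2)] assms(3))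
qed

lemma free_action_mult:
  assumes "\<And>v. linear (\<phi> v)"
  shows "free_action \<phi> (p * q) b = free_action \<phi> p (free_action \<phi> q b)"
proof -
  note bil = bilinear_free_action[of \<phi>, OF assms, unfolded bilinear_def]
  have l: "linear (\<lambda>p. free_action \<phi> p b)" for b
    using bil by blast
  have r: "linear (free_action \<phi> p)" for p
    using bil by blast
  have *: "free_action \<phi> (Poly_Mapping.single xs 1 * q) b = foldr \<phi> xs (free_action \<phi> q b)" for xs
  proof (rule linear_eq_on_singles[of _ _ q])
    show "linear (\<lambda>q. free_action \<phi> (Poly_Mapping.single xs 1 * q) b)"
      using linear_compose[OF linear_mult_left l] by (simp add: o_def)
    show "linear (\<lambda>q. foldr \<phi> xs (free_action \<phi> q b))"
      using linear_compose[OF l linear_foldr[OF assms]] by (simp add: o_def)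
  qed (simp add: mult_single free_action_single plus_list_def)
  show ?thesis
  proof (rule linear_eq_on_singles[of _ _ p])
    show "linear (\<lambda>p. free_action \<phi> (p * q) b)"
      using linear_compose[OF linear_mult_right l] by (simp add: o_def)
  qed (use l * in \<open>simp_all add: free_action_single\<close>)
qed

definition algebra_action :: "('t::{real_algebra, monoid_mult} \<Rightarrow> 'b \<Rightarrow> 'b::real_vector) \<Rightarrow> bool" where
  "algebra_action A \<longleftrightarrow> bilinear A \<and> (\<forall>b. A 1 b = b) \<and> (\<forall>s t b. A (s * t) b = A s (A t b))"

text \<open>An element \<open>a * s * b\<close> acts as the composition of three operators, the middle one being zero.\<close>

lemma action_vanishes_on_ideal:
  assumes A: "algebra_action A" and S: "\<And>s b. s \<in> S \<Longrightarrow> A s b = 0"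
    and "x \<in> two_sided_ideal S"
  shows "A x b = 0"
  using \<open>x \<in> two_sided_ideal S\<close> unfolding two_sided_ideal_def
proof (induction rule: span_induct_alt)
  case base
  show ?case using A by (simp add: algebra_action_def bilinear_lzero)
next
  case (step c x y)
  then obtain a s d where x: "x = a * s * d" "s \<in> S" by auto
  have "A x b = A a (A s (A d b))" using A x by (simp add: algebra_action_def mult.assoc)
  also have "\<dots> = 0" using A S x by (simp add: algebra_action_def bilinear_rzero)
  finally show ?case
    using A step by (simp add: algebra_action_def bilinear_ladd bilinear_lmul)
qed

lemma action_cong:
  assumes "algebra_action A" "\<And>s b. s \<in> S \<Longrightarrow> A s b = 0" "cong_ideal S x y"
  shows "A x b = A y b"
  using action_vanishes_on_ideal[OF assms(1,2), of S "x - y" b] assms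
  by (simp add: cong_ideal_def algebra_action_def bilinear_lsub)

text \<open>All the algebras of interest are quotient types by a two-sided ideal. In this form the passage
  to the quotient is done once for all of them, with \<open>abs\<close> and \<open>rep\<close> the maps of the quotient type.\<close>

lemma algebra_action_quotient:
  fixes abs :: "'t::{real_algebra, monoid_mult} \<Rightarrow> 'q::{real_algebra, monoid_mult}"
  assumes A: "algebra_action A" and S: "\<And>s b. s \<in> S \<Longrightarrow> A s b = 0"
    and rep: "\<And>x. cong_ideal S (rep (abs x)) x" and surj: "\<And>q. abs (rep q) = q"
    and hom: "abs 1 = 1" "\<And>x y. abs (x + y) = abs x + abs y"
      "\<And>c x. abs (c *\<^sub>R x) = c *\<^sub>R abs x" "\<And>x y. abs (x * y) = abs x * abs y"
  shows "algebra_action (\<lambda>q. A (rep q))" "A (rep (abs x)) b = A x b"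
proof -
  have *: "A (rep (abs x)) b = A x b" for x b
    using action_cong[OF A S rep] .
  then show "A (rep (abs x)) b = A x b" .
  have "A (rep (s + t)) b = A (rep s) b + A (rep t) b" for s t b
    using *[of "rep s + rep t" b] A
    by (simp add: hom surj algebra_action_def bilinear_ladd)
  moreover have "A (rep (c *\<^sub>R s)) b = c *\<^sub>R A (rep s) b" for c s b
    using *[of "c *\<^sub>R rep s" b] A
    by (simp add: hom surj algebra_action_def bilinear_lmul)
  moreover have "A (rep (s * t)) b = A (rep s) (A (rep t) b)" for s t b
    using *[of "rep s * rep t" b] A
    by (simp add: hom surj algebra_action_def)
  moreover have "A (rep 1) b = b" for b
    using *[of 1 b] A by (simp add: hom algebra_action_def)
  ultimately show "algebra_action (\<lambda>q. A (rep q))"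
    using A by (auto simp: algebra_action_def bilinear_def linear_iff)
qed

lemma tensor_abs_hom:
  "abs_tensor_algebra 1 = 1" "abs_tensor_algebra (p + q) = abs_tensor_algebra p + abs_tensor_algebra q"
  "abs_tensor_algebra (c *\<^sub>R p) = c *\<^sub>R abs_tensor_algebra p"
  "abs_tensor_algebra (p * q) = abs_tensor_algebra p * abs_tensor_algebra q"
  by (simp_all add: one_tensor_algebra_def plus_tensor_algebra.abs_eq
      scaleR_tensor_algebra.abs_eq times_tensor_algebra.abs_eq)

lemma exterior_abs_hom:
  "abs_exterior_algebra 1 = 1" "abs_exterior_algebra (p + q) = abs_exterior_algebra p + abs_exterior_algebra q"
  "abs_exterior_algebra (c *\<^sub>R p) = c *\<^sub>R abs_exterior_algebra p"
  "abs_exterior_algebra (p * q) = abs_exterior_algebra p * abs_exterior_algebra q"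
  by (simp_all add: one_exterior_algebra_def plus_exterior_algebra.abs_eq
      scaleR_exterior_algebra.abs_eq times_exterior_algebra.abs_eq)

lemma chain_abs_hom:
  "abs_chain_algebra 1 = 1" "abs_chain_algebra (p + q) = abs_chain_algebra p + abs_chain_algebra q"
  "abs_chain_algebra (c *\<^sub>R p) = c *\<^sub>R abs_chain_algebra p"
  "abs_chain_algebra (p * q) = abs_chain_algebra p * abs_chain_algebra q"
  by (simp_all add: one_chain_algebra_def plus_chain_algebra.abs_eq
      scaleR_chain_algebra.abs_eq times_chain_algebra.abs_eq)

text \<open>Universal property of the tensor algebra, phrased for modules: a bilinear family of operators is an
  action, with no condition to check. Evaluation at a fixed vector \<open>b\<close> is then a linear map
  on the algebra that is defined on products by recursion over the factors.\<close>

lemma tensor_action_exists: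
  fixes \<phi> :: "'v::real_vector \<Rightarrow> 'b::real_vector \<Rightarrow> 'b"
  assumes "bilinear \<phi>"
  obtains A where "algebra_action A" "\<And>v b. A (tensor_inc v) b = \<phi> v b"
proof -
  have lin: "linear (\<phi> v)" for v using assms by (simp add: bilinear_def)
  have act: "algebra_action (free_action \<phi>)"
    unfolding algebra_action_def
    using bilinear_free_action[of \<phi>, OF lin] free_action_mult[of \<phi>, OF lin]
    by (simp add: free_action_single single_one[symmetric] zero_list_def del: single_one)
  have rel: "free_action \<phi> s b = 0" if "s \<in> tensor_relations" for s b
    using that assms bilinear_free_action[of \<phi>, OF lin]
    by (auto simp: tensor_relations_def bilinear_lsub bilinear_lmul free_action_single bilinear_ladd)
  have rep: "cong_ideal tensor_relations (rep_tensor_algebra (abs_tensor_algebra x)) x"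
    and surj: "abs_tensor_algebra (rep_tensor_algebra q) = q" for x :: "'v list \<Rightarrow>\<^sub>0 real" and q
    using Quotient_rep_abs[OF Quotient_tensor_algebra] Quotient_abs_rep[OF Quotient_tensor_algebra]
      equivp_reflp[OF equivp_cong_ideal]
    by blast+
  note q = algebra_action_quotient[where abs = abs_tensor_algebra, OF act rel rep surj tensor_abs_hom]
  show thesis
    by (rule that[OF q(1)]) (simp_all add: tensor_inc_def q(2) free_action_single)
qed

lemma exterior_action_exists:
  fixes \<phi> :: "'v::real_vector \<Rightarrow> 'b::real_vector \<Rightarrow> 'b"
  assumes "bilinear \<phi>" "\<And>v b. \<phi> v (\<phi> v b) = 0"
  obtains A where "algebra_action A" "\<And>v b. A (exterior_inc v) b = \<phi> v b"
proof -
  obtain A where act: "algebra_action A" and A: "\<And>v b. A (tensor_inc v) b = \<phi> v b"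
    using tensor_action_exists[OF assms(1)] by blast
  have rel: "A s b = 0" if "s \<in> exterior_relations" for s b
    using that assms act by (auto simp: exterior_relations_def A algebra_action_def)
  have rep: "cong_ideal exterior_relations (rep_exterior_algebra (abs_exterior_algebra x)) x"
    and surj: "abs_exterior_algebra (rep_exterior_algebra q) = q" for x :: "'v tensor_algebra" and q
    using Quotient_rep_abs[OF Quotient_exterior_algebra] Quotient_abs_rep[OF Quotient_exterior_algebra]
      equivp_reflp[OF equivp_cong_ideal]
    by blast+
  note q = algebra_action_quotient[where abs = abs_exterior_algebra, OF act rel rep surj exterior_abs_hom]
  show thesis
    by (rule that[OF q(1)]) (simp_all add: exterior_inc_def q(2) A)
qed

lemma chain_action_exists:
  fixes \<phi> :: "'v::real_vector multivector \<Rightarrow> 'b::real_vector \<Rightarrow> 'b"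
  assumes "bilinear \<phi>"
    and "\<And>X Y x y b. X \<in> grade x \<Longrightarrow> Y \<in> grade y \<Longrightarrow> \<phi> X (\<phi> Y b) + (- 1) ^ (x * y) *\<^sub>R \<phi> Y (\<phi> X b) = 0"
  obtains A where "algebra_action A" "\<And>v b. A (chain_inc v) b = \<phi> v b"
proof -
  obtain A where act: "algebra_action A" and A: "\<And>v b. A (tensor_inc v) b = \<phi> v b"
    using tensor_action_exists[OF assms(1)] by blast
  have rel: "A s b = 0" if "s \<in> chain_relations" for s b
    using that assms act
    by (auto simp: chain_relations_def A algebra_action_def bilinear_ladd bilinear_lmul)
  have rep: "cong_ideal chain_relations (rep_chain_algebra (abs_chain_algebra x)) x"
    and surj: "abs_chain_algebra (rep_chain_algebra q) = q" for x :: "'v multivector tensor_algebra" and q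
    using Quotient_rep_abs[OF Quotient_chain_algebra] Quotient_abs_rep[OF Quotient_chain_algebra]
      equivp_reflp[OF equivp_cong_ideal]
    by blast+
  note q = algebra_action_quotient[where abs = abs_chain_algebra, OF act rel rep surj chain_abs_hom]
  show thesis
    by (rule that[OF q(1)]) (simp_all add: chain_inc_def q(2) A)
qed

lemma tensor_algebra_span: "span (range (\<lambda>vs. prod_list (map tensor_inc vs))) = UNIV"
proof -
  have w: "abs_tensor_algebra (Poly_Mapping.single vs 1) = prod_list (map tensor_inc vs)" for vs :: "'a list"
  proof (induction vs)
    case Nil
    then show ?case
      by (metis list.map(1) prod_list.Nil single_one tensor_abs_hom(1) zero_list_def)
  next
    case (Cons v vs)
    have "Poly_Mapping.single (v # vs) (1::real) = Poly_Mapping.single [v] 1 * Poly_Mapping.single vs 1"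
      by (simp add: mult_single plus_list_def)
    with Cons show ?case by (simp add: tensor_abs_hom tensor_inc_def)
  qed
  have lin: "linear abs_tensor_algebra" by (simp add: linear_iff tensor_abs_hom)
  have "t \<in> span (range (\<lambda>vs. prod_list (map tensor_inc vs)))" for t :: "'a tensor_algebra"
  proof -
    define p where "p = rep_tensor_algebra t"
    have "t = abs_tensor_algebra p"
      by (simp add: p_def Quotient_abs_rep[OF Quotient_tensor_algebra])
    also have "p = (\<Sum>k\<in>Poly_Mapping.keys p. Poly_Mapping.lookup p k *\<^sub>R Poly_Mapping.single k 1)"
      using poly_mapping_expand[of p] by (simp add: scaleR_single)
    also have "abs_tensor_algebra \<dots> =
        (\<Sum>k\<in>Poly_Mapping.keys p. Poly_Mapping.lookup p k *\<^sub>R prod_list (map tensor_inc k))"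
      by (simp add: linear_sum[OF lin] linear_scale[OF lin] w)
    also have "\<dots> \<in> span (range (\<lambda>vs. prod_list (map tensor_inc vs)))"
      by (intro span_sum span_scale span_base) auto
    finally show ?thesis .
  qed
  then show ?thesis by auto
qed

lemma exterior_inc_linear: "linear (exterior_inc :: 'a::real_vector \<Rightarrow> _)"
  and chain_inc_linear: "linear (chain_inc :: 'a::real_vector multivector \<Rightarrow> _)"
proof -
  have t: "linear (tensor_inc :: 'b::real_vector \<Rightarrow> _)"
  proof (rule linearI)
    fix x y :: 'b and c :: real
    have "abs_tensor_algebra p = abs_tensor_algebra q" if "p - q \<in> tensor_relations"
      for p q :: "'b list \<Rightarrow>\<^sub>0 real"
    proof -
      have "p - q = 1 * (p - q) * 1" by simp
      with that have "p - q \<in> {a * s * b | a s b. s \<in> tensor_relations}" by blast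
      then have "cong_ideal tensor_relations p q"
        unfolding cong_ideal_def two_sided_ideal_def by (rule span_base)
      then show ?thesis
        by (meson tensor_algebra.abs_eq_iff)
    qed
    note rel = this
    show "tensor_inc (x + y) = tensor_inc x + tensor_inc y"
      unfolding tensor_inc_def tensor_abs_hom(2)[symmetric] map_fun_def
      by (simp add: tensor_inc_def, rule trans[OF rel tensor_abs_hom(2)])
        (auto simp: tensor_relations_def diff_diff_eq)
    show "tensor_inc (c *\<^sub>R x) = c *\<^sub>R tensor_inc x"
      unfolding tensor_inc_def map_fun_def
      by (simp add: tensor_inc_def, rule trans[OF rel tensor_abs_hom(3)])
        (auto simp: tensor_relations_def)
  qed
  show "linear (exterior_inc :: 'a::real_vector \<Rightarrow> _)"
    by (simp add: linear_iff exterior_inc_def linear_add[OF t] linear_scale[OF t] exterior_abs_hom)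
  show "linear (chain_inc :: 'a::real_vector multivector \<Rightarrow> _)"
    by (simp add: linear_iff chain_inc_def linear_add[OF t] linear_scale[OF t] chain_abs_hom)
qed

lemma exterior_algebra_span: "span (range (\<lambda>vs. prod_list (map exterior_inc vs))) = UNIV"
proof -
  have w: "abs_exterior_algebra (prod_list (map tensor_inc vs)) = prod_list (map exterior_inc vs)" for vs :: "'a list"
    by (induction vs) (simp_all add: exterior_abs_hom exterior_inc_def)
  have lin: "linear abs_exterior_algebra" by (simp add: linear_iff exterior_abs_hom)
  have "surj (abs_exterior_algebra :: _ \<Rightarrow> 'a exterior_algebra)"
    by (metis Quotient_abs_rep[OF Quotient_exterior_algebra] surjI)
  then have "(UNIV :: 'a exterior_algebra set) = abs_exterior_algebra ` span (range (\<lambda>vs. prod_list (map tensor_inc vs)))"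
    by (simp only: tensor_algebra_span)
  also have "\<dots> = span (range (\<lambda>vs. prod_list (map exterior_inc vs)))"
    by (simp add: linear_span_image[OF lin, symmetric] image_image w)
  finally show ?thesis ..
qed

lemma chain_algebra_span: "span (range chain_prod) = UNIV"
proof -
  have w: "abs_chain_algebra (prod_list (map tensor_inc vs)) = chain_prod vs" for vs :: "'a multivector list"
    unfolding chain_prod_def by (induction vs) (simp_all add: chain_abs_hom chain_inc_def)
  have lin: "linear abs_chain_algebra" by (simp add: linear_iff chain_abs_hom)
  have "surj (abs_chain_algebra :: _ \<Rightarrow> 'a chain_algebra)"
    by (metis Quotient_abs_rep[OF Quotient_chain_algebra] surjI)
  then have "(UNIV :: 'a chain_algebra set) = abs_chain_algebra ` span (range (\<lambda>vs. prod_list (map tensor_inc vs)))"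
    by (simp only: tensor_algebra_span)
  also have "\<dots> = span (range chain_prod)"
    by (simp add: linear_span_image[OF lin, symmetric] image_image w)
  finally show ?thesis ..
qed

lemma exterior_inc_square: "exterior_inc v * exterior_inc v = 0"
proof -
  have "tensor_inc v * tensor_inc v = 1 * (tensor_inc v * tensor_inc v) * 1" by simp
  then have "tensor_inc v * tensor_inc v \<in> {a * s * b | a s b. s \<in> exterior_relations}"
    unfolding exterior_relations_def by blast
  then have "cong_ideal exterior_relations (tensor_inc v * tensor_inc v) 0"
    unfolding cong_ideal_def two_sided_ideal_def by (simp add: span_base)
  then show ?thesis
    by (simp add: exterior_inc_def exterior_abs_hom(4)[symmetric] zero_exterior_algebra_def
        exterior_algebra.abs_eq_iff)
qed

lemma chain_inc_commute:
  assumes "X \<in> grade x" "Y \<in> grade y"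
  shows "chain_inc X * chain_inc Y = - ((- 1) ^ (x * y) *\<^sub>R (chain_inc Y * chain_inc X))"
proof -
  let ?s = "tensor_inc X * tensor_inc Y + (- 1) ^ (x * y) *\<^sub>R (tensor_inc Y * tensor_inc X)"
  have "?s \<in> chain_relations" unfolding chain_relations_def using assms by blast
  moreover have "?s = 1 * ?s * 1" by simp
  ultimately have "?s \<in> {a * s * b | a s b. s \<in> chain_relations}" by blast
  then have "cong_ideal chain_relations ?s 0"
    unfolding cong_ideal_def two_sided_ideal_def by (simp add: span_base)
  then have "abs_chain_algebra ?s = 0"
    by (metis chain_algebra.abs_eq_iff zero_chain_algebra_def)
  then show ?thesis
    by (simp add: chain_inc_def chain_abs_hom eq_neg_iff_add_eq_0)
qed

section \<open>Coordinates on the exterior algebra of a three-dimensional space\<close>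

text \<open>Names for the basis \<open>h, e, f, h\<and>e, e\<and>f, h\<and>f, h\<and>e\<and>f\<close> of the multivectors, in the order
  \<open>H, E, F, P, Q, R, V\<close>.\<close>

datatype gen = H | E | F | P | Q | R | V

lemma UNIV_gen: "(UNIV :: gen set) = {H, E, F, P, Q, R, V}"
  using gen.exhaust by auto

instance gen :: finite
  by standard (simp add: UNIV_gen)

lemma sum_gen: "(\<Sum>g\<in>UNIV. x g) = x H + x E + x F + x P + x Q + x R + (x V :: 'b::comm_monoid_add)"
  by (simp add: UNIV_gen add.assoc)

fun deg :: "gen \<Rightarrow> nat" where
  "deg H = 0" | "deg E = 0" | "deg F = 0" | "deg P = 1" | "deg Q = 1" | "deg R = 1" | "deg V = 2"

text \<open>Coordinates with respect to \<open>1, h, e, f, h\<and>e, e\<and>f, h\<and>f, h\<and>e\<and>f\<close>, in this order.\<close>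

type_synonym wedge_coords = "real \<times> real \<times> real \<times> real \<times> real \<times> real \<times> real \<times> real"

lemma wedge_coords_cases:
  fixes w :: wedge_coords
  obtains s a b c p q r v where "w = (s, a, b, c, p, q, r, v)"
  by (metis surj_pair)

fun gen_coord :: "gen \<Rightarrow> wedge_coords \<Rightarrow> real" where
  "gen_coord H (s, a, b, c, p, q, r, v) = a"
| "gen_coord E (s, a, b, c, p, q, r, v) = b"
| "gen_coord F (s, a, b, c, p, q, r, v) = c"
| "gen_coord P (s, a, b, c, p, q, r, v) = p"
| "gen_coord Q (s, a, b, c, p, q, r, v) = q"
| "gen_coord R (s, a, b, c, p, q, r, v) = r"
| "gen_coord V (s, a, b, c, p, q, r, v) = v"

lemma linear_gen_coord: "linear (gen_coord g)"
  by (rule linearI; cases g) auto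

lemma Rep_wedge: "vs \<noteq> [] \<Longrightarrow> Rep_multivector (wedge vs) = prod_list (map exterior_inc vs)"
  unfolding wedge_def
proof (rule Abs_multivector_inverse)
  assume "vs \<noteq> []"
  then have "prod_list (map exterior_inc vs) \<in> exterior_power (Suc (length vs - 1))"
    unfolding exterior_power_def by (intro span_base) (auto intro: exI[of _ vs])
  then show "prod_list (map exterior_inc vs) \<in> span (\<Union>i. exterior_power (Suc i))"
    by (blast intro: span_base)
qed

lemma linear_Rep_multivector: "linear Rep_multivector"
  by (simp add: linear_iff plus_multivector.rep_eq scaleR_multivector.rep_eq)

lemma subspace_grade: "subspace (grade k)"
  unfolding subspace_def grade_def exterior_power_def
  by (auto simp: zero_multivector.rep_eq plus_multivector.rep_eq scaleR_multivector.rep_eq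
      intro: span_zero span_add span_scale)

lemma wedge_in_grade: "length vs = Suc k \<Longrightarrow> wedge vs \<in> grade k"
  unfolding grade_def exterior_power_def
  by (subst mem_Collect_eq, subst Rep_wedge) (auto intro!: span_base exI[of _ vs])

locale basis3 =
  fixes h e f :: "'a::real_vector" and ch ce cf :: "'a \<Rightarrow> real"
  assumes linear_coords: "linear ch" "linear ce" "linear cf"
    and expand: "x = ch x *\<^sub>R h + ce x *\<^sub>R e + cf x *\<^sub>R f"
    and coords_basis [simp]: "ch h = 1" "ce h = 0" "cf h = 0" "ch e = 0" "ce e = 1" "cf e = 0"
      "ch f = 0" "ce f = 0" "cf f = 1"
begin

lemma coords_linear [simp]:
  "ch (x + y) = ch x + ch y" "ce (x + y) = ce x + ce y" "cf (x + y) = cf x + cf y"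
  "ch (t *\<^sub>R x) = t * ch x" "ce (t *\<^sub>R x) = t * ce x" "cf (t *\<^sub>R x) = t * cf x"
  "ch 0 = 0" "ce 0 = 0" "cf 0 = 0"
  using linear_coords by (simp_all add: linear_iff linear_0)

text \<open>Left exterior multiplication by a vector, in coordinates. It squares to zero, so it defines an
  action of the exterior algebra, and \<open>c \<mapsto> c \<cdot> 1\<close> reads off the coordinates of \<open>c\<close>.\<close>

fun ext_mult :: "'a \<Rightarrow> wedge_coords \<Rightarrow> wedge_coords" where
  "ext_mult x (s, a, b, c, p, q, r, v) = (0, ch x * s, ce x * s, cf x * s,
     ch x * b - ce x * a, ce x * c - cf x * b, ch x * c - cf x * a,
     ch x * q - ce x * r + cf x * p)"

lemma bilinear_ext_mult: "bilinear ext_mult"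
  unfolding bilinear_def by (auto intro!: linearI simp: algebra_simps)

lemma ext_mult_square: "ext_mult x (ext_mult x b) = 0"
  by (cases b rule: wedge_coords_cases) (simp add: zero_prod_def algebra_simps)

definition ext_action :: "'a exterior_algebra \<Rightarrow> wedge_coords \<Rightarrow> wedge_coords" where
  "ext_action = (SOME A. algebra_action A \<and> (\<forall>v b. A (exterior_inc v) b = ext_mult v b))"

lemma ext_action: "algebra_action ext_action" "ext_action (exterior_inc v) b = ext_mult v b"
proof -
  have "\<exists>A. algebra_action A \<and> (\<forall>v b. A (exterior_inc v) b = ext_mult v b)"
    using exterior_action_exists[OF bilinear_ext_mult ext_mult_square] by metis
  from someI_ex[OF this] show "algebra_action ext_action" "ext_action (exterior_inc v) b = ext_mult v b"
    unfolding ext_action_def by blast+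
qed

definition ext_coords :: "'a exterior_algebra \<Rightarrow> wedge_coords" where
  "ext_coords c = ext_action c (1, 0, 0, 0, 0, 0, 0, 0)"

lemma linear_ext_coords: "linear ext_coords"
  using ext_action(1) unfolding ext_coords_def algebra_action_def bilinear_def by blast

lemma ext_coords_prod:
  "ext_coords (prod_list (map exterior_inc vs)) = foldr ext_mult vs (1, 0, 0, 0, 0, 0, 0, 0)"
  using ext_action unfolding ext_coords_def
  by (induction vs) (simp_all add: algebra_action_def)

fun ext_combination :: "wedge_coords \<Rightarrow> 'a exterior_algebra" where
  "ext_combination (s, a, b, c, p, q, r, v) =
     s *\<^sub>R 1 + a *\<^sub>R exterior_inc h + b *\<^sub>R exterior_inc e + c *\<^sub>R exterior_inc f
     + p *\<^sub>R (exterior_inc h * exterior_inc e) + q *\<^sub>R (exterior_inc e * exterior_inc f)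
     + r *\<^sub>R (exterior_inc h * exterior_inc f)
     + v *\<^sub>R (exterior_inc h * exterior_inc e * exterior_inc f)"

lemma linear_ext_combination: "linear ext_combination"
  by (rule linearI) (auto simp: algebra_simps scaleR_add_left)

lemma exterior_inc_anticommute: "exterior_inc x * exterior_inc y = - (exterior_inc y * exterior_inc x)"
  for x y :: "'v::real_vector"
proof -
  have "0 = (exterior_inc x + exterior_inc y) * (exterior_inc x + exterior_inc y)"
    by (simp only: linear_add[OF exterior_inc_linear, symmetric] exterior_inc_square)
  also have "\<dots> = exterior_inc x * exterior_inc y + exterior_inc y * exterior_inc x"
    by (simp only: distrib_left distrib_right exterior_inc_square add_0_left add_0_right)
      (rule add.commute)
  finally show ?thesis by (simp only: eq_neg_iff_add_eq_0)
qed

lemma ext_combination_mult: "ext_combination (ext_mult x w) = exterior_inc x * ext_combination w"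
proof -
  obtain s a b c p q r v where w: "w = (s, a, b, c, p, q, r, v)" by (rule wedge_coords_cases)
  let ?h = "exterior_inc h" and ?e = "exterior_inc e" and ?f = "exterior_inc f"
  have x: "exterior_inc x = ch x *\<^sub>R ?h + ce x *\<^sub>R ?e + cf x *\<^sub>R ?f"
    using arg_cong[OF expand[of x], of exterior_inc]
    by (simp only: linear_add[OF exterior_inc_linear] linear_scale[OF exterior_inc_linear])
  have sq: "?h * ?h = 0" "?e * ?e = 0" "?f * ?f = 0" by (rule exterior_inc_square)+
  then have sq': "?h * (?h * z) = 0" "?e * (?e * z) = 0" "?f * (?f * z) = 0" for z
    by (simp_all only: mult.assoc[symmetric] sq mult_zero_left)
  have com: "?e * ?h = - (?h * ?e)" "?f * ?h = - (?h * ?f)" "?f * ?e = - (?e * ?f)"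
    by (rule exterior_inc_anticommute)+
  then have com': "?e * (?h * z) = - (?h * (?e * z))" "?f * (?h * z) = - (?h * (?f * z))"
    "?f * (?e * z) = - (?e * (?f * z))" for z
    by (simp_all only: mult.assoc[symmetric] com mult_minus_left)
  show ?thesis
    unfolding x w
    by (simp only: ext_mult.simps ext_combination.simps distrib_left distrib_right mult_scaleR_left
        mult_scaleR_right mult.assoc mult_1_right scaleR_add_right scaleR_add_left scaleR_diff_left,
      simp only: sq sq' com com' mult_zero_right mult_minus_right scaleR_minus_right minus_minus
        scaleR_zero_right add_0_left add_0_right scaleR_scaleR minus_zero,
      simp only: scaleR_zero_left add_0_left mult.commute diff_conv_add_uminus add_ac)
qed

text \<open>Both sides are linear in \<open>c\<close> and agree on products of vectors, since \<open>ext_combination\<close> intertwines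
  \<open>ext_mult\<close> with multiplication.\<close>

lemma ext_combination_coords: "ext_combination (ext_coords c) = c"
proof -
  have *: "c \<in> span (range (\<lambda>vs. prod_list (map exterior_inc vs)))"
    using exterior_algebra_span by blast
  have "linear (\<lambda>c. ext_combination (ext_coords c))"
    using linear_compose[OF linear_ext_coords linear_ext_combination] by (simp add: o_def)
  moreover have "linear (\<lambda>c :: 'a exterior_algebra. c)" by (simp add: linear_iff)
  moreover have "ext_combination (ext_coords x) = x"
    if x: "x \<in> range (\<lambda>vs. prod_list (map exterior_inc vs))" for x
  proof -
    obtain vs where "x = prod_list (map exterior_inc vs)" using x by blast
    moreover have "ext_combination (foldr ext_mult vs (1, 0, 0, 0, 0, 0, 0, 0)) = prod_list (map exterior_inc vs)"
      by (induction vs) (simp_all add: ext_combination_mult)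
    ultimately show ?thesis by (simp only: ext_coords_prod)
  qed
  ultimately show ?thesis
    using * by (rule linear_eq_on_span[where f = "\<lambda>c. ext_combination (ext_coords c)" and g = "\<lambda>c. c"])
qed

definition coord :: "'a multivector \<Rightarrow> gen \<Rightarrow> real" where
  "coord Y g = gen_coord g (ext_coords (Rep_multivector Y))"

fun bas :: "gen \<Rightarrow> 'a multivector" where
  "bas H = wedge [h]" | "bas E = wedge [e]" | "bas F = wedge [f]"
| "bas P = wedge [h, e]" | "bas Q = wedge [e, f]" | "bas R = wedge [h, f]"
| "bas V = wedge [h, e, f]"

lemma linear_coord: "linear (\<lambda>Y. coord Y g)"
  using linear_compose[OF linear_compose[OF linear_Rep_multivector linear_ext_coords] linear_gen_coord]
  by (simp add: coord_def o_def)

lemma coord_simps [simp]: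
  "coord (X + Y) g = coord X g + coord Y g" "coord (t *\<^sub>R X) g = t * coord X g" "coord 0 g = 0"
  "coord (- X) g = - coord X g" "coord (X - Y) g = coord X g - coord Y g"
  using linear_add[OF linear_coord] linear_scale[OF linear_coord] linear_0[OF linear_coord]
    linear_neg[OF linear_coord] linear_diff[OF linear_coord] by auto

lemma coord_sum [simp]: "coord (\<Sum>i\<in>I. X i) g = (\<Sum>i\<in>I. coord (X i) g)"
  by (rule linear_sum[OF linear_coord])

lemma coord_wedge:
  "vs \<noteq> [] \<Longrightarrow> coord (wedge vs) g = gen_coord g (foldr ext_mult vs (1, 0, 0, 0, 0, 0, 0, 0))"
  by (simp add: coord_def Rep_wedge ext_coords_prod)

lemma bas_in_grade: "bas g \<in> grade (deg g)"
  by (cases g) (auto intro: wedge_in_grade)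

lemma coord_bas [simp]: "coord (bas u) v = (if u = v then 1 else 0)"
  by (cases u; cases v) (simp_all add: coord_wedge)

lemma coord_wedge_eq_0:
  assumes "vs \<noteq> []" "length vs \<noteq> Suc (deg g)"
  shows "coord (wedge vs) g = 0"
proof -
  consider x where "vs = [x]" | x y where "vs = [x, y]" | x y z where "vs = [x, y, z]"
    | x y z t us where "vs = x # y # z # t # us"
    using assms(1) by (metis neq_Nil_conv)
  then show ?thesis
  proof cases
    \<comment> \<open>Multiplication by four vectors is zero in coordinates.\<close>
    case (4 x y z t us)
    obtain w where "foldr ext_mult us (1, 0, 0, 0, 0, 0, 0, 0) = w" by blast
    with 4 show ?thesis
      by (cases w rule: wedge_coords_cases; cases g) (simp_all add: coord_wedge algebra_simps)
  qed (use assms in \<open>cases g; simp add: coord_wedge\<close>)+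
qed

lemma coord_grade:
  assumes "Y \<in> grade k" "deg g \<noteq> k"
  shows "coord Y g = 0"
proof -
  have "linear (\<lambda>c. gen_coord g (ext_coords c))"
    using linear_compose[OF linear_ext_coords linear_gen_coord] by (simp add: o_def)
  moreover have "gen_coord g (ext_coords c) = 0"
    if c: "c \<in> {prod_list (map exterior_inc vs) | vs. length vs = Suc k}" for c
  proof -
    obtain vs where "c = prod_list (map exterior_inc vs)" "length vs = Suc k" using c by blast
    then show ?thesis
      using coord_wedge_eq_0[of vs g] assms(2) by (cases vs) (auto simp: coord_def Rep_wedge)
  qed
  moreover have "Rep_multivector Y \<in> span {prod_list (map exterior_inc vs) | vs. length vs = Suc k}"
    using assms(1) by (simp add: grade_def exterior_power_def)
  ultimately show ?thesis
    unfolding coord_def by (rule linear_eq_0_on_span)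
qed

text \<open>A multivector has no scalar part, so seven of the eight coordinates suffice.\<close>

lemma multivector_expand: "Y = (\<Sum>g\<in>UNIV. coord Y g *\<^sub>R bas g)"
proof -
  have lin: "linear (\<lambda>c. fst (ext_coords c))"
    using linear_compose[OF linear_ext_coords linear_fst] by (simp add: o_def)
  have "fst (ext_coords c) = 0" if c: "c \<in> (\<Union>i. exterior_power (Suc i))" for c
  proof -
    have fst0: "fst (ext_mult x w) = 0" for x w by (cases w rule: wedge_coords_cases) simp
    obtain i where "c \<in> exterior_power (Suc i)" using c by blast
    then show ?thesis
      unfolding exterior_power_def
      by (rule linear_eq_0_on_span[OF lin, rotated]) (auto simp: ext_coords_prod length_Suc_conv fst0 simp del: list.map(2) prod_list.Cons)
  qed
  then have fst: "fst (ext_coords (Rep_multivector Y)) = 0"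
    by (rule linear_eq_0_on_span[OF lin _ Rep_multivector])
  obtain s a b c p q r v where k: "ext_coords (Rep_multivector Y) = (s, a, b, c, p, q, r, v)"
    by (rule wedge_coords_cases)
  have "Rep_multivector Y = ext_combination (ext_coords (Rep_multivector Y))"
    by (simp add: ext_combination_coords)
  also have "\<dots> = Rep_multivector (\<Sum>g\<in>UNIV. coord Y g *\<^sub>R bas g)"
    using fst
    by (simp add: k sum_gen coord_def Rep_wedge plus_multivector.rep_eq scaleR_multivector.rep_eq
        mult.assoc)
  finally show ?thesis by (simp add: Rep_multivector_inject)
qed

lemma multivector_eqI: "(\<And>g. coord X g = coord Y g) \<Longrightarrow> X = Y"
  by (subst multivector_expand[of X], subst multivector_expand[of Y]) simp

end

section \<open>The Schouten bracket of the Lie algebra with \<open>[h, e] = e\<close> and \<open>f\<close> central\<close>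

lemma deg_le_2: "deg g \<le> 2"
  by (cases g) auto

context basis3
begin

declare bas.simps [simp del]

lemma wedge_eq_0:
  fixes vs :: "'a list"
  assumes "length vs > 3"
  shows "wedge vs = 0"
proof (rule multivector_eqI)
  fix g
  from assms have "vs \<noteq> []" "length vs \<noteq> Suc (deg g)"
    using deg_le_2[of g] by auto
  then show "coord (wedge vs) g = coord 0 g"
    by (simp add: coord_wedge_eq_0)
qed

end

lemma (in basis3) coords_diff:
  "ch (x - y) = ch x - ch y" "ce (x - y) = ce x - ce y" "cf (x - y) = cf x - cf y"
  using linear_coords by (simp_all add: linear_diff)

locale affine_times_line = basis3 h e f ch ce cf
  for h e f :: "'a::real_vector" and ch ce cf +
  fixes br :: "'a \<Rightarrow> 'a \<Rightarrow> 'a"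
  assumes lie: "lie_bracket br"
    and bracket_basis: "br h e = e" "br h f = 0" "br e f = 0"
begin

lemma bracket_eq: "br x y = (ch x * ce y - ce x * ch y) *\<^sub>R e"
proof -
  have bil: "bilinear br" and alt: "br z z = 0" for z
    using lie by (auto simp: lie_bracket_def)
  note exp = bilinear_ladd[OF bil] bilinear_radd[OF bil] bilinear_lmul[OF bil] bilinear_rmul[OF bil]
  have anti: "br x y = - br y x" for x y
  proof -
    have "br (x + y) (x + y) = br x y + br y x"
      unfolding exp by (simp add: alt)
    then have "br x y + br y x = 0" by (simp only: alt)
    then show ?thesis by (simp only: eq_neg_iff_add_eq_0)
  qed
  have "br x y = br (ch x *\<^sub>R h + ce x *\<^sub>R e + cf x *\<^sub>R f) (ch y *\<^sub>R h + ce y *\<^sub>R e + cf y *\<^sub>R f)"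
    by (rule arg_cong2[OF expand expand])
  also have "\<dots> = (ch x * ce y - ce x * ch y) *\<^sub>R e"
    by (simp add: exp alt bracket_basis anti[of e h] anti[of f h] anti[of f e] scaleR_diff_left mult.commute)
  finally show ?thesis .
qed

text \<open>The Schouten bracket in coordinates. Up to symmetry, its nonzero values on basis elements are
  \<open>[h, x] = x\<close> for \<open>x = e, h\<and>e, e\<and>f, h\<and>e\<and>f\<close>, \<open>[e, h\<and>f] = - e\<and>f\<close> and
  \<open>[h\<and>e, h\<and>f] = - h\<and>e\<and>f\<close>.\<close>

definition sch :: "'a multivector \<Rightarrow> 'a multivector \<Rightarrow> 'a multivector" where
  "sch X Y = (coord X H * coord Y E - coord X E * coord Y H) *\<^sub>R bas E
    + (coord X H * coord Y P - coord X P * coord Y H) *\<^sub>R bas P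
    + (coord X H * coord Y Q - coord X Q * coord Y H
        - coord X E * coord Y R + coord X R * coord Y E) *\<^sub>R bas Q
    + (coord X H * coord Y V - coord X V * coord Y H
        - coord X P * coord Y R - coord X R * coord Y P) *\<^sub>R bas V"

lemma bilinear_sch: "bilinear sch"
  unfolding bilinear_def
  by (intro conjI allI linearI multivector_eqI) (simp_all add: sch_def algebra_simps)

lemma coord_wedge_simps:
  "coord (wedge [x]) H = ch x" "coord (wedge [x]) E = ce x" "coord (wedge [x]) F = cf x"
  "coord (wedge [x]) P = 0" "coord (wedge [x]) Q = 0" "coord (wedge [x]) R = 0" "coord (wedge [x]) V = 0"
  "coord (wedge [x, y]) H = 0" "coord (wedge [x, y]) E = 0" "coord (wedge [x, y]) F = 0"
  "coord (wedge [x, y]) P = ch x * ce y - ce x * ch y"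
  "coord (wedge [x, y]) Q = ce x * cf y - cf x * ce y"
  "coord (wedge [x, y]) R = ch x * cf y - cf x * ch y"
  "coord (wedge [x, y]) V = 0"
  "coord (wedge [x, y, z]) H = 0" "coord (wedge [x, y, z]) E = 0" "coord (wedge [x, y, z]) F = 0"
  "coord (wedge [x, y, z]) P = 0" "coord (wedge [x, y, z]) Q = 0" "coord (wedge [x, y, z]) R = 0"
  "coord (wedge [x, y, z]) V = ch x * (ce y * cf z - cf y * ce z)
     - ce x * (ch y * cf z - cf y * ch z) + cf x * (ch y * ce z - ce y * ch z)"
  by (simp_all add: coord_wedge)

text \<open>A bracket of products of \<open>k\<close> and \<open>l\<close> vectors consists of products of \<open>k + l - 1\<close> vectors, so
  both sides vanish for \<open>k + l > 4\<close>. In the six remaining cases every coordinate of the equation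
  is a polynomial identity in the coordinates of the vectors.\<close>

lemma sch_wedge:
  assumes "as \<noteq> []" "bs \<noteq> []"
  shows "sch (wedge as) (wedge bs) = schouten_sum br as bs"
proof (cases "length as + length bs > 4")
  case True
  have 0: "coord (wedge as) u * coord (wedge bs) v = 0" if "deg u + deg v \<le> 2" for u v
    using that True coord_wedge_eq_0[OF assms(1), of u] coord_wedge_eq_0[OF assms(2), of v] by force
  have "sch (wedge as) (wedge bs) = 0"
    by (simp add: sch_def 0 del: mult_eq_0_iff)
  moreover have "schouten_sum br as bs = 0"
    unfolding schouten_sum_def
    by (intro sum.neutral ballI, subst wedge_eq_0) (use True in \<open>auto simp: omit_nth_def\<close>)
  ultimately show ?thesis by simp
next
  case False
  have 1: "length xs = 1 \<longleftrightarrow> (\<exists>x. xs = [x])" "length xs = 2 \<longleftrightarrow> (\<exists>x y. xs = [x, y])"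
    "length xs = 3 \<longleftrightarrow> (\<exists>x y z. xs = [x, y, z])" for xs :: "'a list"
    by (auto simp: length_Suc_conv numeral_eq_Suc)
  have "length as \<noteq> 0" "length bs \<noteq> 0" using assms by auto
  with False consider "length as = 1" "length bs = 1" | "length as = 1" "length bs = 2"
    | "length as = 1" "length bs = 3" | "length as = 2" "length bs = 1"
    | "length as = 2" "length bs = 2" | "length as = 3" "length bs = 1"
    by linarith
  then show ?thesis
    unfolding 1
    by cases (elim exE; simp; rule multivector_eqI; rename_tac g; case_tac g;
        simp add: sch_def schouten_sum_def omit_nth_def coord_wedge_simps bracket_eq lessThan_Suc
          numeral_eq_Suc coords_diff algebra_simps)+
qed

lemma multivector_span_wedge: "span {wedge vs | vs. vs \<noteq> []} = (UNIV :: 'a multivector set)"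
proof -
  have "bas g \<in> {wedge vs | vs. vs \<noteq> []}" for g
    by (cases g) (auto simp: bas.simps)
  then have "Y \<in> span {wedge vs | vs. vs \<noteq> []}" for Y :: "'a multivector"
    by (subst multivector_expand[of Y]) (intro span_sum span_scale span_base)
  then show ?thesis by blast
qed

text \<open>Existence of the Schouten bracket is \<open>sch_wedge\<close>; uniqueness holds because products of vectors span.\<close>

lemma schouten_eq: "schouten br = sch"
  unfolding schouten_def
proof (rule the_equality)
  show "is_schouten br sch"
    using bilinear_sch sch_wedge by (simp add: is_schouten_def)
  fix S assume S: "is_schouten br S"
  then have bil: "bilinear S" by (simp add: is_schouten_def)
  have "S X Y = sch X Y" for X Y
  proof (rule bilinear_eq[OF bil bilinear_sch, of UNIV "{wedge vs | vs. vs \<noteq> []}" UNIV "{wedge vs | vs. vs \<noteq> []}"])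
    fix x y :: "'a multivector" assume "x \<in> {wedge vs | vs. vs \<noteq> []}" "y \<in> {wedge vs | vs. vs \<noteq> []}"
    then show "S x y = sch x y"
      using S sch_wedge by (auto simp: is_schouten_def)
  qed (simp_all add: multivector_span_wedge)
  then show "S = sch" by blast
qed

lemma sch_in_grade: "sch (bas u) (bas v) \<in> grade (deg u + deg v)"
  using bas_in_grade[of E] bas_in_grade[of P] bas_in_grade[of Q] bas_in_grade[of V]
  by (cases u; cases v) (simp_all add: sch_def subspace_0[OF subspace_grade]
      subspace_neg[OF subspace_grade] numeral_2_eq_2)

text \<open>For basis elements, graded antisymmetry and the graded Jacobi identity can be read off the table of
  brackets.\<close>

lemma sch_antisym: "sch (bas u) (bas v) = - ((- 1) ^ (deg u * deg v) *\<^sub>R sch (bas v) (bas u))"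
  by (cases u; cases v) (simp_all add: sch_def)

lemma sch_jacobi: "sch (bas u) (sch (bas v) (bas w)) =
   sch (sch (bas u) (bas v)) (bas w) + (- 1) ^ (deg u * deg v) *\<^sub>R sch (bas v) (sch (bas u) (bas w))"
  by (cases u; cases v; cases w) (simp_all add: sch_def)

end

section \<open>A monomial basis of the chain algebra\<close>

lemma linear_mult_both:
  fixes f :: "'v::real_vector \<Rightarrow> 'b::real_algebra"
  assumes "linear f"
  shows "linear (\<lambda>v. a * f v)" "linear (\<lambda>v. f v * a)"
  using assms by (simp_all add: linear_iff distrib_left distrib_right)

lemma linear_image_span_subset:
  assumes "linear f" "\<And>x. x \<in> S \<Longrightarrow> f x \<in> T" "subspace T" "x \<in> span S"
  shows "f x \<in> T"
proof -
  have "f ` span S = span (f ` S)" using linear_span_image[OF assms(1)] by simp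
  also have "\<dots> \<subseteq> T" using assms(2,3) by (intro span_minimal) auto
  finally show ?thesis using assms(4) by blast
qed

text \<open>The position of a generator in an ordered monomial. The generators of odd grade, which commute with
  each other, come last.\<close>

fun pos :: "gen \<Rightarrow> nat" where
  "pos H = 0" | "pos E = 1" | "pos F = 2" | "pos V = 3" | "pos P = 4" | "pos Q = 5" | "pos R = 6"

lemma pos_less_linear: "u \<noteq> v \<Longrightarrow> pos u < pos v \<longleftrightarrow> \<not> pos v < pos u"
  by (cases u; cases v) simp_all

definition increment :: "gen \<Rightarrow> (gen \<Rightarrow> nat) \<Rightarrow> gen \<Rightarrow> nat" where
  "increment v n = n(v := Suc (n v))"

text \<open>Moving a generator \<open>v\<close> in front of a monomial to its place costs the sign \<open>(- 1) ^ Suc (deg u * deg v)\<close>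
  for every factor \<open>u\<close> that it passes.\<close>

definition swaps :: "gen \<Rightarrow> (gen \<Rightarrow> nat) \<Rightarrow> nat" where
  "swaps v n = (\<Sum>u | pos u < pos v. Suc (deg u * deg v) * n u)"

text \<open>A generator of even grade has square zero.\<close>

definition blocked :: "gen \<Rightarrow> (gen \<Rightarrow> nat) \<Rightarrow> bool" where
  "blocked v n \<longleftrightarrow> even (deg v) \<and> n v \<noteq> 0"

text \<open>Left multiplication by a generator, on formal linear combinations of exponent vectors.\<close>

definition insert_gen :: "gen \<Rightarrow> ((gen \<Rightarrow> nat) \<Rightarrow>\<^sub>0 real) \<Rightarrow> (gen \<Rightarrow> nat) \<Rightarrow>\<^sub>0 real" where
  "insert_gen v = linear_extension (\<lambda>n. if blocked v n then 0
     else (- 1) ^ swaps v n *\<^sub>R Poly_Mapping.single (increment v n) 1)"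

lemma linear_insert_gen: "linear (insert_gen v)"
  unfolding insert_gen_def by (rule linear_linear_extension)

lemma insert_gen_single:
  "insert_gen v (Poly_Mapping.single n 1) = (if blocked v n then 0
     else (- 1) ^ swaps v n *\<^sub>R Poly_Mapping.single (increment v n) 1)"
  unfolding insert_gen_def by (simp add: linear_extension_single)

lemma swaps_increment:
  "swaps v (increment w n) = swaps v n + (if pos w < pos v then Suc (deg w * deg v) else 0)"
proof -
  have "swaps v (increment w n)
      = (\<Sum>u | pos u < pos v. Suc (deg u * deg v) * n u + (if u = w then Suc (deg w * deg v) else 0))"
    unfolding swaps_def increment_def by (rule sum.cong) auto
  also have "\<dots> = swaps v n + (if pos w < pos v then Suc (deg w * deg v) else 0)"
    unfolding swaps_def by (simp add: sum.distrib)
  finally show ?thesis .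
qed

text \<open>If \<open>u \<noteq> v\<close>, then exactly one of the two generators comes before the other one in the ordering; only
  the later one meets an additional factor, which yields the sign of the relation. If \<open>u = v\<close>, both
  terms vanish for even grade and cancel for odd grade.\<close>

lemma insert_gen_commute:
  "insert_gen u (insert_gen v p) + (- 1) ^ (deg u * deg v) *\<^sub>R insert_gen v (insert_gen u p) = 0"
proof (rule linear_eq_on_singles[of "\<lambda>p. insert_gen u (insert_gen v p)
    + (- 1) ^ (deg u * deg v) *\<^sub>R insert_gen v (insert_gen u p)" "\<lambda>_. 0" p])
  have c: "linear (\<lambda>p. insert_gen u (insert_gen v p))" for u v
    using linear_compose[OF linear_insert_gen linear_insert_gen] by (simp add: o_def)
  show "linear (\<lambda>p. insert_gen u (insert_gen v p)
      + (- 1) ^ (deg u * deg v) *\<^sub>R insert_gen v (insert_gen u p))"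
    by (intro linear_compose_add linear_compose_scale_right c)
  show "linear (\<lambda>_ :: (gen \<Rightarrow> nat) \<Rightarrow>\<^sub>0 real. 0 :: (gen \<Rightarrow> nat) \<Rightarrow>\<^sub>0 real)"
    by (simp add: linear_iff)
  fix n :: "gen \<Rightarrow> nat"
  have inc: "insert_gen x (insert_gen y (Poly_Mapping.single n 1)) =
      (if blocked y n \<or> blocked x (increment y n) then 0
       else (- 1) ^ (swaps y n + swaps x (increment y n)) *\<^sub>R
         Poly_Mapping.single (increment x (increment y n)) 1)" for x y
    by (simp add: insert_gen_single linear_0[OF linear_insert_gen] linear_scale[OF linear_insert_gen]
        power_add)
  show "insert_gen u (insert_gen v (Poly_Mapping.single n 1))
      + (- 1) ^ (deg u * deg v) *\<^sub>R insert_gen v (insert_gen u (Poly_Mapping.single n 1)) = 0"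
  proof (cases "u = v")
    case True
    then show ?thesis
      by (auto simp: inc blocked_def increment_def)
  next
    case False
    then have b: "blocked x (increment y n) \<longleftrightarrow> blocked x n" if "{x, y} = {u, v}" for x y
      using that by (auto simp: blocked_def increment_def doubleton_eq_iff)
    have i: "increment u (increment v n) = increment v (increment u n)"
      using False by (auto simp: increment_def)
    show ?thesis
      using pos_less_linear[OF False]
      by (cases "pos u < pos v")
        (auto simp: inc b insert_commute i swaps_increment power_add mult.commute scaleR_left_distrib[symmetric])
  qed
qed

context basis3
begin

definition \<beta> :: "gen \<Rightarrow> 'a chain_algebra" where
  "\<beta> v = chain_inc (bas v)"

lemma chain_inc_expand: "chain_inc Y = (\<Sum>v\<in>UNIV. coord Y v *\<^sub>R \<beta> v)"
  by (subst multivector_expand[of Y])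
    (simp only: linear_sum[OF chain_inc_linear] linear_scale[OF chain_inc_linear] \<beta>_def)

lemma \<beta>_commute: "\<beta> u * \<beta> v = - ((- 1) ^ (deg u * deg v) *\<^sub>R (\<beta> v * \<beta> u))"
  unfolding \<beta>_def by (rule chain_inc_commute) (rule bas_in_grade)+

lemma \<beta>_square: "even (deg v) \<Longrightarrow> \<beta> v * \<beta> v = 0"
proof -
  assume "even (deg v)"
  then have "(- 1 :: real) ^ (deg v * deg v) = 1" by simp
  then have "\<beta> v * \<beta> v = - (\<beta> v * \<beta> v)"
    using \<beta>_commute[of v v] by (simp only: scaleR_one)
  then have "2 *\<^sub>R (\<beta> v * \<beta> v) = 0"
    by (simp only: eq_neg_iff_add_eq_0 scaleR_2)
  then show ?thesis by simp
qed

lemma chain_algebra_generated: "span (range (\<lambda>us. prod_list (map \<beta> us))) = UNIV"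
proof -
  let ?W = "span (range (\<lambda>us. prod_list (map \<beta> us)))"
  have 1: "\<beta> v * c \<in> ?W" if c: "c \<in> ?W" for v c
  proof (rule linear_image_span_subset[OF linear_mult_left _ subspace_span c])
    fix x assume "x \<in> range (\<lambda>us. prod_list (map \<beta> us))"
    then obtain us where "x = prod_list (map \<beta> us)" by blast
    then have "\<beta> v * x = prod_list (map \<beta> (v # us))" by simp
    then show "\<beta> v * x \<in> ?W" by (simp only:) (rule span_base, rule rangeI)
  qed
  have "chain_prod Ys \<in> ?W" for Ys
  proof (induction Ys)
    case Nil
    have "prod_list (map \<beta> []) \<in> ?W" by (rule span_base) (rule rangeI)
    then show ?case by (simp add: chain_prod_def)
  next
    case (Cons Y Ys)
    then have "(\<Sum>v\<in>UNIV. coord Y v *\<^sub>R (\<beta> v * chain_prod Ys)) \<in> ?W"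
      by (intro span_sum span_scale 1)
    moreover have "chain_prod (Y # Ys) = (\<Sum>v\<in>UNIV. coord Y v *\<^sub>R (\<beta> v * chain_prod Ys))"
      by (simp add: chain_prod_def chain_inc_expand[of Y] sum_distrib_right)
    ultimately show ?case by simp
  qed
  then have "span (range chain_prod) \<subseteq> ?W"
    by (intro span_minimal) auto
  then show ?thesis by (simp only: chain_algebra_span) blast
qed

text \<open>Induction over products of generators; the form in which all identities between operators on the
  chain algebra are proved below.\<close>

lemma chain_linear_eqI:
  assumes "linear s" "linear t" "s 1 = t 1" "\<And>v c. s c = t c \<Longrightarrow> s (\<beta> v * c) = t (\<beta> v * c)"
  shows "s c = t c"
proof (rule linear_eq_on_span[OF assms(1,2)])
  fix x assume "x \<in> range (\<lambda>us. prod_list (map \<beta> us))"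
  then obtain us where x: "x = prod_list (map \<beta> us)" by blast
  show "s x = t x" unfolding x by (induction us) (use assms in auto)
qed (simp only: chain_algebra_generated UNIV_I)

text \<open>The universal property of the chain algebra in terms of the seven generators. The relations for
  arbitrary homogeneous \<open>X\<close> and \<open>Y\<close> follow by bilinearity, since only basis elements of the
  same grade as \<open>X\<close> or \<open>Y\<close> occur in them.\<close>

lemma chain_action_on_generators:
  fixes \<phi> :: "gen \<Rightarrow> 'b::real_vector \<Rightarrow> 'b"
  assumes lin: "\<And>v. linear (\<phi> v)"
    and rel: "\<And>u v b. \<phi> u (\<phi> v b) + (- 1) ^ (deg u * deg v) *\<^sub>R \<phi> v (\<phi> u b) = 0"
  obtains A where "algebra_action A" "\<And>v b. A (\<beta> v) b = \<phi> v b"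
proof -
  define \<psi> where "\<psi> Y b = (\<Sum>v\<in>UNIV. coord Y v *\<^sub>R \<phi> v b)" for Y b
  note lins = linear_add[OF lin] linear_scale[OF lin] linear_sum[OF lin]
  have bil: "bilinear \<psi>"
    unfolding bilinear_def \<psi>_def
    by (intro conjI allI linearI)
      (simp_all add: lins algebra_simps sum.distrib scaleR_sum_right)
  have \<psi>2: "\<psi> X (\<psi> Y b) = (\<Sum>u\<in>UNIV. \<Sum>v\<in>UNIV. (coord X u * coord Y v) *\<^sub>R \<phi> u (\<phi> v b))" for X Y b
    unfolding \<psi>_def by (simp add: lins scaleR_sum_right)
  have "\<psi> X (\<psi> Y b) + (- 1) ^ (x * y) *\<^sub>R \<psi> Y (\<psi> X b) = 0"
    if X: "X \<in> grade x" and Y: "Y \<in> grade y" for X Y x y b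
  proof -
    have "\<psi> Y (\<psi> X b) = (\<Sum>u\<in>UNIV. \<Sum>v\<in>UNIV. (coord X u * coord Y v) *\<^sub>R \<phi> v (\<phi> u b))"
      unfolding \<psi>2 by (subst sum.swap) (simp add: mult.commute)
    then have "\<psi> X (\<psi> Y b) + (- 1) ^ (x * y) *\<^sub>R \<psi> Y (\<psi> X b)
      = (\<Sum>u\<in>UNIV. \<Sum>v\<in>UNIV. (coord X u * coord Y v) *\<^sub>R (\<phi> u (\<phi> v b) + (- 1) ^ (x * y) *\<^sub>R \<phi> v (\<phi> u b)))"
      unfolding \<psi>2 by (simp add: scaleR_sum_right sum.distrib scaleR_add_right mult.commute)
    also have "\<dots> = 0"
    proof (intro sum.neutral ballI)
      fix u v
      show "(coord X u * coord Y v) *\<^sub>R (\<phi> u (\<phi> v b) + (- 1) ^ (x * y) *\<^sub>R \<phi> v (\<phi> u b)) = 0"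
        using rel[of u v b] coord_grade[OF X, of u] coord_grade[OF Y, of v]
        by (cases "deg u = x \<and> deg v = y") auto
    qed
    finally show ?thesis .
  qed
  then obtain A where A: "algebra_action A" "\<And>Y b. A (chain_inc Y) b = \<psi> Y b"
    using chain_action_exists[OF bil] by blast
  have "A (\<beta> v) b = \<phi> v b" for v b
  proof -
    have "A (\<beta> v) b = (\<Sum>u\<in>UNIV. if u = v then \<phi> u b else 0)"
      unfolding \<beta>_def A(2) \<psi>_def by (rule sum.cong) auto
    then show ?thesis by simp
  qed
  with A(1) show thesis by (rule that)
qed

definition monomial :: "(gen \<Rightarrow> nat) \<Rightarrow> 'a chain_algebra" where
  "monomial n = prod_list (map (\<lambda>v. \<beta> v ^ n v) [H, E, F, V, P, Q, R])"

lemma monomial_split: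
  obtains us ws where "[H, E, F, V, P, Q, R] = us @ v # ws" "set us = {u. pos u < pos v}"
    "distinct us" "v \<notin> set us" "v \<notin> set ws"
proof -
  define us where "us = takeWhile (\<lambda>u. pos u < pos v) [H, E, F, V, P, Q, R]"
  define ws where "ws = dropWhile (\<lambda>u. pos u \<le> pos v) [H, E, F, V, P, Q, R]"
  show thesis
  proof (rule that[of us ws])
    show "set us = {u. pos u < pos v}"
    proof (intro set_eqI)
      show "u \<in> set us \<longleftrightarrow> u \<in> {u. pos u < pos v}" for u
        by (cases u; cases v) (simp_all add: us_def)
    qed
  qed (cases v; simp add: us_def ws_def)+
qed

lemma \<beta>_past_power: "\<beta> v * \<beta> u ^ k = (- 1) ^ (Suc (deg u * deg v) * k) *\<^sub>R (\<beta> u ^ k * \<beta> v)"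
proof (induction k)
  case (Suc k)
  have "\<beta> v * \<beta> u ^ Suc k = (\<beta> v * \<beta> u) * \<beta> u ^ k" by (simp add: mult.assoc)
  also have "\<dots> = (- 1) ^ Suc (deg u * deg v) *\<^sub>R (\<beta> u * (\<beta> v * \<beta> u ^ k))"
    by (subst \<beta>_commute) (simp add: mult.assoc mult.commute[of "deg v"])
  also have "\<dots> = (- 1) ^ (Suc (deg u * deg v) * Suc k) *\<^sub>R (\<beta> u ^ Suc k * \<beta> v)"
    by (simp add: Suc mult.assoc power_add)
  finally show ?case .
qed simp

lemma \<beta>_past_list:
  "\<beta> v * prod_list (map (\<lambda>u. \<beta> u ^ n u) us)
   = (- 1) ^ (\<Sum>u\<leftarrow>us. Suc (deg u * deg v) * n u) *\<^sub>R (prod_list (map (\<lambda>u. \<beta> u ^ n u) us) * \<beta> v)"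
proof (induction us)
  case (Cons u us)
  let ?p = "prod_list (map (\<lambda>u. \<beta> u ^ n u) us)"
  have "\<beta> v * prod_list (map (\<lambda>u. \<beta> u ^ n u) (u # us)) = (\<beta> v * \<beta> u ^ n u) * ?p"
    by (simp add: mult.assoc)
  also have "\<dots> = (- 1) ^ (Suc (deg u * deg v) * n u) *\<^sub>R (\<beta> u ^ n u * (\<beta> v * ?p))"
    by (simp add: \<beta>_past_power mult.assoc)
  finally show ?case by (simp add: Cons mult.assoc power_add)
qed simp

text \<open>The formula that defines \<open>insert_gen\<close> holds in the chain algebra, so the monomials span.\<close>

lemma \<beta>_times_monomial:
  "\<beta> v * monomial n = (if blocked v n then 0 else (- 1) ^ swaps v n *\<^sub>R monomial (increment v n))"
proof -
  obtain us ws where gens: "[H, E, F, V, P, Q, R] = us @ v # ws" and us: "set us = {u. pos u < pos v}"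
    "distinct us" and v: "v \<notin> set us" "v \<notin> set ws"
    by (rule monomial_split)
  define A where "A = prod_list (map (\<lambda>u. \<beta> u ^ n u) us)"
  define B where "B = prod_list (map (\<lambda>u. \<beta> u ^ n u) ws)"
  have "(\<Sum>u\<leftarrow>us. Suc (deg u * deg v) * n u) = swaps v n"
    using us by (simp only: swaps_def sum_list_distinct_conv_sum_set)
  then have "\<beta> v * monomial n = (- 1) ^ swaps v n *\<^sub>R (A * (\<beta> v * \<beta> v ^ n v) * B)"
    unfolding monomial_def gens using \<beta>_past_list[of v n us] by (simp add: A_def B_def flip: mult.assoc)
  moreover have "monomial (increment v n) = A * (\<beta> v * \<beta> v ^ n v) * B"
  proof -
    have eq: "map (\<lambda>u. \<beta> u ^ increment v n u) xs = map (\<lambda>u. \<beta> u ^ n u) xs" if "v \<notin> set xs" for xs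
      using that by (auto simp: increment_def)
    show ?thesis
      unfolding monomial_def gens
      by (simp add: eq[OF v(1)] eq[OF v(2)] A_def B_def mult.assoc) (simp add: increment_def mult.assoc)
  qed
  moreover have "\<beta> v * \<beta> v ^ n v = 0" if b: "blocked v n"
  proof -
    have "n v \<noteq> 0" "even (deg v)" using b by (auto simp: blocked_def)
    then obtain k where "n v = Suc k" using not0_implies_Suc by blast
    then show ?thesis using \<beta>_square[OF \<open>even (deg v)\<close>] by (simp flip: mult.assoc)
  qed
  ultimately show ?thesis by auto
qed

definition pbw_action :: "'a chain_algebra \<Rightarrow> ((gen \<Rightarrow> nat) \<Rightarrow>\<^sub>0 real) \<Rightarrow> (gen \<Rightarrow> nat) \<Rightarrow>\<^sub>0 real" where
  "pbw_action = (SOME A. algebra_action A \<and> (\<forall>v b. A (\<beta> v) b = insert_gen v b))"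

lemma pbw_action: "algebra_action pbw_action" "pbw_action (\<beta> v) p = insert_gen v p"
proof -
  obtain A where "algebra_action A" "\<And>v b. A (\<beta> v) b = insert_gen v b"
    using chain_action_on_generators[OF linear_insert_gen insert_gen_commute] by blast
  then have "\<exists>A. algebra_action A \<and> (\<forall>v b. A (\<beta> v) b = insert_gen v b)" by blast
  from someI_ex[OF this] show "algebra_action pbw_action" "pbw_action (\<beta> v) p = insert_gen v p"
    unfolding pbw_action_def by blast+
qed

text \<open>The coefficient of \<open>monomial n\<close>, read off from the action on the exponent vector \<open>0\<close>.\<close>

definition coef :: "'a chain_algebra \<Rightarrow> (gen \<Rightarrow> nat) \<Rightarrow> real" where
  "coef c n = Poly_Mapping.lookup (pbw_action c (Poly_Mapping.single (\<lambda>_. 0) 1)) n"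

lemma linear_coef: "linear (\<lambda>c. coef c n)"
  using pbw_action(1)
  by (simp add: linear_iff coef_def algebra_action_def bilinear_ladd bilinear_lmul lookup_add lookup_scaleR)

text \<open>Mapping exponent vectors to monomials intertwines \<open>insert_gen\<close> with multiplication, hence is a left
  inverse of the map \<open>c \<mapsto> c \<cdot> 0\<close> into combinations of exponent vectors.\<close>

lemma monomial_expand:
  "\<exists>K. finite K \<and> c = (\<Sum>n\<in>K. coef c n *\<^sub>R monomial n) \<and> (\<forall>n. n \<notin> K \<longrightarrow> coef c n = 0)"
proof -
  let ?\<Phi> = "\<lambda>c. pbw_action c (Poly_Mapping.single (\<lambda>_. 0) 1)"
  let ?\<Psi> = "linear_extension monomial"
  have lin: "linear (\<lambda>c. ?\<Psi> (?\<Phi> c))"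
    using linear_compose[of ?\<Phi>, OF _ linear_linear_extension] pbw_action(1)
    by (simp add: algebra_action_def bilinear_def o_def)
  have comm: "?\<Psi> (insert_gen v p) = \<beta> v * ?\<Psi> p" for v p
  proof (rule linear_eq_on_singles[of "\<lambda>p. ?\<Psi> (insert_gen v p)" "\<lambda>p. \<beta> v * ?\<Psi> p"])
    show "linear (\<lambda>p. ?\<Psi> (insert_gen v p))"
      using linear_compose[OF linear_insert_gen linear_linear_extension] by (simp add: o_def)
    show "linear (\<lambda>p. \<beta> v * ?\<Psi> p)"
      by (rule linear_mult_both[OF linear_linear_extension])
    show "?\<Psi> (insert_gen v (Poly_Mapping.single n 1)) = \<beta> v * ?\<Psi> (Poly_Mapping.single n 1)" for n
      by (simp add: insert_gen_single linear_extension_single \<beta>_times_monomial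
          linear_0[OF linear_linear_extension] linear_scale[OF linear_linear_extension])
  qed
  have "?\<Psi> (?\<Phi> c) = c"
  proof (rule chain_linear_eqI[OF lin, of "\<lambda>c. c"])
    show "linear (\<lambda>c :: 'a chain_algebra. c)" by (simp add: linear_iff)
    show "?\<Psi> (?\<Phi> 1) = 1"
      using pbw_action(1) by (simp add: algebra_action_def linear_extension_single monomial_def)
    fix v c assume "?\<Psi> (?\<Phi> c) = c"
    moreover have "?\<Phi> (\<beta> v * c) = insert_gen v (?\<Phi> c)"
      using pbw_action by (simp add: algebra_action_def)
    ultimately show "?\<Psi> (?\<Phi> (\<beta> v * c)) = \<beta> v * c" by (simp add: comm)
  qed
  then show ?thesis
    unfolding linear_extension_def coef_def
    by (intro exI[of _ "Poly_Mapping.keys (?\<Phi> c)"]) (simp add: in_keys_iff)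
qed

definition admissible :: "(gen \<Rightarrow> nat) \<Rightarrow> bool" where
  "admissible n \<longleftrightarrow> (\<forall>v. even (deg v) \<longrightarrow> n v \<le> 1)"

text \<open>Inserting a generator that precedes all factors present costs no sign.\<close>

lemma pbw_action_power:
  assumes "\<And>u. pos u < pos v \<Longrightarrow> n u = 0" "n v = 0" "even (deg v) \<longrightarrow> k \<le> 1"
  shows "pbw_action (\<beta> v ^ k) (Poly_Mapping.single n 1) = Poly_Mapping.single (n(v := k)) 1"
  using assms(3)
proof (induction k)
  case 0
  have "n(v := 0) = n" using assms(2) by auto
  then show ?case using pbw_action(1) by (simp add: algebra_action_def)
next
  case (Suc k)
  have "swaps v (n(v := k)) = 0"
    using assms(1) by (auto simp: swaps_def)
  moreover have "\<not> blocked v (n(v := k))" using Suc.prems by (auto simp: blocked_def)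
  moreover have "increment v (n(v := k)) = n(v := Suc k)" by (simp add: increment_def)
  ultimately show ?case
    using Suc pbw_action by (simp add: algebra_action_def insert_gen_single del: fun_upd_apply)
qed

lemma coef_monomial:
  assumes "admissible n"
  shows "coef (monomial n) m = (if m = n then 1 else 0)"
proof -
  have act: "pbw_action (a * b) p = pbw_action a (pbw_action b p)" "pbw_action 1 p = p" for a b p
    using pbw_action(1) by (auto simp: algebra_action_def)
  have k: "even (deg v) \<longrightarrow> n v \<le> 1" for v using assms by (simp add: admissible_def)
  have "pbw_action (monomial n) (Poly_Mapping.single (\<lambda>_. 0) 1) = Poly_Mapping.single
      ((((((((\<lambda>_. 0)(R := n R))(Q := n Q))(P := n P))(V := n V))(F := n F))(E := n E))(H := n H)) 1"
    unfolding monomial_def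
    by (simp only: list.map prod_list.Cons prod_list.Nil act) (subst pbw_action_power; (use k in auto)?)+
  also have "(((((((\<lambda>_. 0)(R := n R))(Q := n Q))(P := n P))(V := n V))(F := n F))(E := n E))(H := n H) = n"
  proof
    fix v show "((((((((\<lambda>_. 0)(R := n R))(Q := n Q))(P := n P))(V := n V))(F := n F))(E := n E))(H := n H)) v = n v"
      by (cases v) simp_all
  qed
  finally show ?thesis by (simp add: coef_def lookup_single when_def)
qed

definition word :: "(gen \<Rightarrow> nat) \<Rightarrow> gen list" where
  "word n = concat (map (\<lambda>v. replicate (n v) v) [H, E, F, V, P, Q, R])"

lemma monomial_word: "monomial n = prod_list (map \<beta> (word n))"
  by (simp add: monomial_def word_def prod_list_replicate mult.assoc)

lemma sum_word: "(\<Sum>v\<leftarrow>word n. g v) = (\<Sum>v\<in>UNIV. n v * g v)" for g :: "gen \<Rightarrow> nat"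
  by (simp add: word_def sum_gen sum_list_replicate)

definition indices :: "nat \<Rightarrow> nat \<Rightarrow> (gen \<Rightarrow> nat) set" where
  "indices m w = {n. admissible n \<and> (\<Sum>v\<in>UNIV. n v) = m \<and> (\<Sum>v\<in>UNIV. n v * deg v) = w}"

lemma increment_indices:
  assumes "n \<in> indices m w" "\<not> blocked v n"
  shows "increment v n \<in> indices (Suc m) (w + deg v)"
proof -
  have "admissible (increment v n)"
    using assms by (auto simp: indices_def admissible_def blocked_def increment_def)
  moreover have "(\<Sum>u\<in>UNIV. increment v n u * g u) = (\<Sum>u\<in>UNIV. n u * g u) + g v" for g :: "gen \<Rightarrow> nat"
  proof -
    have "(\<Sum>u\<in>UNIV. increment v n u * g u) = (\<Sum>u\<in>UNIV. n u * g u + (if u = v then g v else 0))"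
      by (rule sum.cong) (auto simp: increment_def)
    then show ?thesis by (simp add: sum.distrib)
  qed
  from this[of "\<lambda>_. 1"] this[of deg] show ?thesis
    using assms calculation by (simp add: indices_def)
qed

lemma \<beta>_times_span_indices:
  assumes "c \<in> span (monomial ` indices m w)"
  shows "\<beta> v * c \<in> span (monomial ` indices (Suc m) (w + deg v))"
proof (rule linear_image_span_subset[OF linear_mult_left _ subspace_span assms])
  fix x assume "x \<in> monomial ` indices m w"
  then obtain n where n: "n \<in> indices m w" "x = monomial n" by blast
  show "\<beta> v * x \<in> span (monomial ` indices (Suc m) (w + deg v))"
  proof (cases "blocked v n")
    case True
    then show ?thesis by (simp add: n(2) \<beta>_times_monomial span_zero)
  next
    case False
    then show ?thesis
      using increment_indices[OF n(1), of v]
      by (simp add: n(2) \<beta>_times_monomial span_scale span_base)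
  qed
qed

lemma chain_inc_times_span_indices:
  assumes Y: "Y \<in> grade y" and c: "c \<in> span (monomial ` indices m w)"
  shows "chain_inc Y * c \<in> span (monomial ` indices (Suc m) (w + y))"
proof -
  have "chain_inc Y * c = (\<Sum>v\<in>UNIV. coord Y v *\<^sub>R (\<beta> v * c))"
    by (simp add: chain_inc_expand[of Y] sum_distrib_right)
  also have "\<dots> \<in> span (monomial ` indices (Suc m) (w + y))"
  proof (rule span_sum)
    fix v
    show "coord Y v *\<^sub>R (\<beta> v * c) \<in> span (monomial ` indices (Suc m) (w + y))"
    proof (cases "deg v = y")
      case True
      then show ?thesis
        using \<beta>_times_span_indices[OF c, of v] by (auto intro: span_scale)
    next
      case False
      then show ?thesis using coord_grade[OF Y] by (simp add: span_zero)
    qed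
  qed
  finally show ?thesis .
qed

lemma one_in_span_indices: "1 \<in> span (monomial ` indices 0 0)"
proof -
  have "1 = monomial (\<lambda>_. 0)" by (simp add: monomial_def)
  moreover have "(\<lambda>_. 0) \<in> indices 0 0" by (simp add: indices_def admissible_def)
  ultimately show ?thesis by (simp add: span_base)
qed

lemma chain_prod_in_span_indices:
  "list_all2 (\<lambda>Y y. Y \<in> grade y) Ys ys \<Longrightarrow> chain_prod Ys \<in> span (monomial ` indices (length Ys) (sum_list ys))"
proof (induction rule: list_all2_induct)
  case Nil
  show ?case using one_in_span_indices by (simp add: chain_prod_def)
next
  case (Cons Y Ys y ys)
  then show ?case
    using chain_inc_times_span_indices[OF Cons(1,3)] by (simp add: chain_prod_def add.commute)
qed

lemma chain_prod_bas: "chain_prod (map bas us) = prod_list (map \<beta> us)"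
  by (induction us) (simp_all add: chain_prod_def \<beta>_def)

lemma list_all2_bas: "list_all2 (\<lambda>Y y. Y \<in> grade y) (map bas us) (map deg us)"
  by (induction us) (simp_all add: bas_in_grade)

lemma chain_space_eq: "chain_space (int m) w = span (monomial ` indices m w)"
proof (intro equalityI)
  show "chain_space (int m) w \<subseteq> span (monomial ` indices m w)"
    unfolding chain_space_def
    by (intro span_minimal subspace_span) (auto dest: chain_prod_in_span_indices)
  show "span (monomial ` indices m w) \<subseteq> chain_space (int m) w"
    unfolding chain_space_def
  proof (intro span_mono image_subsetI)
    fix n assume n: "n \<in> indices m w"
    have "length (word n) = m" "sum_list (map deg (word n)) = w"
      using n sum_word[of "\<lambda>_. 1" n] sum_word[of deg n] by (simp_all add: indices_def sum_list_triv)
    then show "monomial n \<in> {chain_prod Ys | Ys ys.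
        list_all2 (\<lambda>Y y. Y \<in> grade y) Ys ys \<and> int (length Ys) = int m \<and> sum_list ys = w}"
      using list_all2_bas[of "word n"] by (force simp: monomial_word simp flip: chain_prod_bas)
  qed
qed

lemma chain_space_negative: "m < 0 \<Longrightarrow> chain_space m w = {0}"
  unfolding chain_space_def by (subst span_empty[symmetric]) (rule arg_cong[where f = span], auto)

end

section \<open>Lie derivatives and the boundary operator\<close>

context basis3
begin

text \<open>The operators \<open>L\<close> and \<open>\<partial>\<close> are prescribed by a recursion \<open>D (v c) = \<xi>\<^sub>v c + t\<^sub>v v (D c)\<close>. The pair
  \<open>(c, D c)\<close> then transforms under multiplication of \<open>c\<close> by \<open>v\<close> by a triangular matrix whose diagonal
  entries are \<open>v\<close> and \<open>t\<^sub>v v\<close>. The relations of the chain algebra hold for these matrices if they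
  hold for the off-diagonal entry, which is the assumption \<open>rel\<close>; applying \<open>c\<close> to \<open>(1, 0)\<close> gives \<open>D\<close>.\<close>

lemma twisted_operator_exists:
  fixes \<xi> :: "gen \<Rightarrow> 'a chain_algebra \<Rightarrow> 'a chain_algebra" and t :: "gen \<Rightarrow> real"
  assumes lin: "\<And>v. linear (\<xi> v)"
    and rel: "\<And>u v c. \<xi> u (\<beta> v * c) + t u *\<^sub>R (\<beta> u * \<xi> v c)
      + (- 1) ^ (deg u * deg v) *\<^sub>R (\<xi> v (\<beta> u * c) + t v *\<^sub>R (\<beta> v * \<xi> u c)) = 0"
  shows "\<exists>D. linear D \<and> D 1 = 0 \<and> (\<forall>v c. D (\<beta> v * c) = \<xi> v c + t v *\<^sub>R (\<beta> v * D c))"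
proof -
  define \<phi> where "\<phi> v p = (\<beta> v * fst p, \<xi> v (fst p) + t v *\<^sub>R (\<beta> v * snd p))" for v p
  have "linear (\<phi> v)" for v
    by (rule linearI)
      (simp_all add: \<phi>_def linear_add[OF lin] linear_scale[OF lin] algebra_simps)
  moreover have "\<phi> u (\<phi> v p) + (- 1) ^ (deg u * deg v) *\<^sub>R \<phi> v (\<phi> u p) = 0" for u v p
  proof -
    let ?s = "(- 1) ^ (deg u * deg v) :: real"
    have com: "\<beta> u * (\<beta> v * c) + ?s *\<^sub>R (\<beta> v * (\<beta> u * c)) = 0" for c
      using \<beta>_commute[of u v] by (simp flip: mult.assoc)
    have "\<xi> u (\<beta> v * fst p) + t u *\<^sub>R (\<beta> u * (\<xi> v (fst p) + t v *\<^sub>R (\<beta> v * snd p)))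
        + ?s *\<^sub>R (\<xi> v (\<beta> u * fst p) + t v *\<^sub>R (\<beta> v * (\<xi> u (fst p) + t u *\<^sub>R (\<beta> u * snd p))))
      = (\<xi> u (\<beta> v * fst p) + t u *\<^sub>R (\<beta> u * \<xi> v (fst p))
        + ?s *\<^sub>R (\<xi> v (\<beta> u * fst p) + t v *\<^sub>R (\<beta> v * \<xi> u (fst p))))
      + (t u * t v) *\<^sub>R (\<beta> u * (\<beta> v * snd p) + ?s *\<^sub>R (\<beta> v * (\<beta> u * snd p)))"
      by (simp add: distrib_left scaleR_add_right mult.commute mult.left_commute)
    also have "\<dots> = 0" by (simp only: rel com scaleR_zero_right add_0_left)
    finally show ?thesis using com by (simp add: \<phi>_def zero_prod_def)
  qed
  ultimately obtain A where A: "algebra_action A" "\<And>v p. A (\<beta> v) p = \<phi> v p"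
    using chain_action_on_generators[of \<phi>] by blast
  have act: "A (\<beta> v * c) p = \<phi> v (A c p)" "A 1 p = p" for v c p
    using A(1) unfolding algebra_action_def A(2)[symmetric] by blast+
  have linA: "linear (\<lambda>c. A c (1, 0))"
    using A(1) by (simp add: algebra_action_def bilinear_def)
  have fst: "fst (A c (1, 0)) = c" for c
  proof (rule chain_linear_eqI[of "\<lambda>c. fst (A c (1, 0))" "\<lambda>c. c"])
    show "linear (\<lambda>c. fst (A c (1, 0)))"
      using linear_compose[OF linA linear_fst] by (simp add: o_def)
  qed (simp_all add: linear_iff act \<phi>_def)
  show ?thesis
  proof (intro exI[of _ "\<lambda>c. snd (A c (1, 0))"] conjI allI)
    show "linear (\<lambda>c. snd (A c (1, 0)))"
      using linear_compose[OF linA linear_snd] by (simp add: o_def)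
  qed (simp_all add: act \<phi>_def fst)
qed

end

context affine_times_line
begin

abbreviation bracket :: "gen \<Rightarrow> gen \<Rightarrow> 'a chain_algebra" where
  "bracket u v \<equiv> chain_inc (sch (bas u) (bas v))"

lemma bracket_times_\<beta>: "bracket u v * \<beta> w = - ((- 1) ^ ((deg u + deg v) * deg w) *\<^sub>R (\<beta> w * bracket u v))"
  unfolding \<beta>_def by (rule chain_inc_commute[OF sch_in_grade bas_in_grade])

text \<open>Bracketing with a generator respects the relations of the chain algebra because brackets add
  grades.\<close>

lemma derivation_exists:
  "\<exists>L. linear L \<and> L 1 = 0 \<and>
     (\<forall>v c. L (\<beta> v * c) = bracket u v * c + (- 1) ^ (deg u * deg v) *\<^sub>R (\<beta> v * L c))"
proof (rule twisted_operator_exists)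
  show "linear ((*) (bracket u v))" for v by (rule linear_mult_left)
  fix v w c
  have "bracket u v * (\<beta> w * c) = - ((- 1) ^ ((deg u + deg v) * deg w) *\<^sub>R (\<beta> w * (bracket u v * c)))"
    for v w
    using bracket_times_\<beta>[of u v w] by (simp flip: mult.assoc)
  then show "bracket u v * (\<beta> w * c) + (- 1) ^ (deg u * deg v) *\<^sub>R (\<beta> v * (bracket u w * c))
      + (- 1) ^ (deg v * deg w) *\<^sub>R
        (bracket u w * (\<beta> v * c) + (- 1) ^ (deg u * deg w) *\<^sub>R (\<beta> w * (bracket u v * c))) = 0"
    by (simp add: algebra_simps power_add mult.commute flip: power_mult_distrib)
qed

definition derivation :: "gen \<Rightarrow> 'a chain_algebra \<Rightarrow> 'a chain_algebra" where
  "derivation u = (SOME L. linear L \<and> L 1 = 0 \<and>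
     (\<forall>v c. L (\<beta> v * c) = bracket u v * c + (- 1) ^ (deg u * deg v) *\<^sub>R (\<beta> v * L c)))"

lemma linear_derivation: "linear (derivation u)"
  and derivation_1: "derivation u 1 = 0"
  and derivation_\<beta>: "derivation u (\<beta> v * c)
    = bracket u v * c + (- 1) ^ (deg u * deg v) *\<^sub>R (\<beta> v * derivation u c)"
  using someI_ex[OF derivation_exists[of u]] unfolding derivation_def by blast+

definition lie_derivative :: "'a multivector \<Rightarrow> 'a chain_algebra \<Rightarrow> 'a chain_algebra" where
  "lie_derivative X c = (\<Sum>u\<in>UNIV. coord X u *\<^sub>R derivation u c)"

lemma lie_derivative_bas: "lie_derivative (bas u) c = derivation u c"
proof -
  have "lie_derivative (bas u) c = (\<Sum>v\<in>UNIV. if v = u then derivation v c else 0)"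
    unfolding lie_derivative_def by (rule sum.cong) auto
  then show ?thesis by simp
qed

lemma bilinear_lie_derivative: "bilinear lie_derivative"
  unfolding bilinear_def lie_derivative_def
  by (intro conjI allI linearI)
    (simp_all add: linear_add[OF linear_derivation] linear_scale[OF linear_derivation]
      algebra_simps sum.distrib scaleR_sum_right)

lemma sch_expand: "sch X Y = (\<Sum>u\<in>UNIV. \<Sum>v\<in>UNIV. (coord X u * coord Y v) *\<^sub>R sch (bas u) (bas v))"
proof -
  have "sch X Y = sch (\<Sum>u\<in>UNIV. coord X u *\<^sub>R bas u) (\<Sum>v\<in>UNIV. coord Y v *\<^sub>R bas v)"
    by (rule arg_cong2[OF multivector_expand multivector_expand])
  also have "\<dots> = (\<Sum>u\<in>UNIV. \<Sum>v\<in>UNIV. (coord X u * coord Y v) *\<^sub>R sch (bas u) (bas v))"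
    by (simp add: bilinear_sum[OF bilinear_sch] sum.cartesian_product bilinear_lmul[OF bilinear_sch]
        bilinear_rmul[OF bilinear_sch] mult.commute)
  finally show ?thesis .
qed

lemma lie_derivative_times:
  assumes X: "X \<in> grade x" and Y: "Y \<in> grade y"
  shows "lie_derivative X (chain_inc Y * c)
    = chain_inc (sch X Y) * c + (- 1) ^ (x * y) *\<^sub>R (chain_inc Y * lie_derivative X c)"
proof -
  have "lie_derivative X (chain_inc Y * c) = (\<Sum>u\<in>UNIV. \<Sum>v\<in>UNIV. (coord X u * coord Y v) *\<^sub>R derivation u (\<beta> v * c))"
    by (simp add: lie_derivative_def chain_inc_expand[of Y] sum_distrib_right linear_sum[OF linear_derivation]
        linear_scale[OF linear_derivation] scaleR_sum_right)
  also have "\<dots> = (\<Sum>u\<in>UNIV. \<Sum>v\<in>UNIV. (coord X u * coord Y v) *\<^sub>R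
      (bracket u v * c + (- 1) ^ (x * y) *\<^sub>R (\<beta> v * derivation u c)))"
  proof (intro sum.cong refl)
    fix u v
    show "(coord X u * coord Y v) *\<^sub>R derivation u (\<beta> v * c) = (coord X u * coord Y v) *\<^sub>R
      (bracket u v * c + (- 1) ^ (x * y) *\<^sub>R (\<beta> v * derivation u c))"
      using coord_grade[OF X, of u] coord_grade[OF Y, of v]
      by (cases "deg u = x \<and> deg v = y") (auto simp: derivation_\<beta>)
  qed
  also have "\<dots> = (\<Sum>u\<in>UNIV. \<Sum>v\<in>UNIV. (coord X u * coord Y v) *\<^sub>R (bracket u v * c))
      + (- 1) ^ (x * y) *\<^sub>R (\<Sum>u\<in>UNIV. \<Sum>v\<in>UNIV. (coord X u * coord Y v) *\<^sub>R (\<beta> v * derivation u c))"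
    by (simp add: scaleR_add_right sum.distrib scaleR_sum_right mult.commute mult.left_commute)
  also have "(\<Sum>u\<in>UNIV. \<Sum>v\<in>UNIV. (coord X u * coord Y v) *\<^sub>R (bracket u v * c)) = chain_inc (sch X Y) * c"
    by (subst sch_expand) (simp add: linear_sum[OF chain_inc_linear] linear_scale[OF chain_inc_linear] sum_distrib_right)
  also have "(\<Sum>u\<in>UNIV. \<Sum>v\<in>UNIV. (coord X u * coord Y v) *\<^sub>R (\<beta> v * derivation u c)) = chain_inc Y * lie_derivative X c"
    by (simp add: chain_inc_expand[of Y] lie_derivative_def sum_distrib_right sum_distrib_left scaleR_sum_right)
  finally show ?thesis .
qed

text \<open>The recursion \<open>\<partial>(v c) = L\<^sub>v c - v \<partial>c\<close> separates in the boundary formula the brackets with the first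
  factor from those among the other factors. It respects the relations because the Schouten bracket is
  graded antisymmetric.\<close>

lemma differential_exists:
  "\<exists>D. linear D \<and> D 1 = 0 \<and> (\<forall>v c. D (\<beta> v * c) = derivation v c + (- 1) *\<^sub>R (\<beta> v * D c))"
proof (rule twisted_operator_exists[OF linear_derivation])
  fix u v c
  have "bracket u v + (- 1) ^ (deg u * deg v) *\<^sub>R bracket v u = 0"
    by (subst sch_antisym[of u v])
      (simp add: linear_neg[OF chain_inc_linear] linear_scale[OF chain_inc_linear])
  then have "bracket u v * c + (- 1) ^ (deg u * deg v) *\<^sub>R (bracket v u * c) = 0"
    by (metis distrib_right mult_scaleR_left mult_zero_left)
  then show "derivation u (\<beta> v * c) + (- 1) *\<^sub>R (\<beta> u * derivation v c)
      + (- 1) ^ (deg u * deg v) *\<^sub>R (derivation v (\<beta> u * c) + (- 1) *\<^sub>R (\<beta> v * derivation u c)) = 0"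
    by (simp add: derivation_\<beta> scaleR_add_right scaleR_diff_right mult.commute[of "deg v"]
        algebra_simps flip: power_mult_distrib)
qed

definition differential :: "'a chain_algebra \<Rightarrow> 'a chain_algebra" where
  "differential = (SOME D. linear D \<and> D 1 = 0 \<and>
     (\<forall>v c. D (\<beta> v * c) = derivation v c + (- 1) *\<^sub>R (\<beta> v * D c)))"

lemma linear_differential: "linear differential"
  and differential_1: "differential 1 = 0"
  and differential_\<beta>: "differential (\<beta> v * c) = derivation v c - \<beta> v * differential c"
  using someI_ex[OF differential_exists] unfolding differential_def by auto

lemma differential_times: "differential (chain_inc Y * c) = lie_derivative Y c - chain_inc Y * differential c"
  by (simp add: chain_inc_expand[of Y] lie_derivative_def sum_distrib_right differential_\<beta>
      linear_sum[OF linear_differential] linear_scale[OF linear_differential]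
      scaleR_diff_right sum_subtractf)

text \<open>The graded commutator of two such derivations is again one, so it suffices to compare it with the
  derivation of the bracket on generators, where the equation is the graded Jacobi identity.\<close>

lemma derivation_commutator:
  "derivation u (derivation v c)
    = lie_derivative (sch (bas u) (bas v)) c + (- 1) ^ (deg u * deg v) *\<^sub>R derivation v (derivation u c)"
proof (rule chain_linear_eqI[of "\<lambda>c. derivation u (derivation v c)"
      "\<lambda>c. lie_derivative (sch (bas u) (bas v)) c + (- 1) ^ (deg u * deg v) *\<^sub>R derivation v (derivation u c)"])
  have c: "linear (\<lambda>p. derivation u (derivation v p))" for u v
    using linear_compose[OF linear_derivation linear_derivation] by (simp add: o_def)
  then show "linear (\<lambda>c. derivation u (derivation v c))" .
  show "linear (\<lambda>c. lie_derivative (sch (bas u) (bas v)) c + (- 1) ^ (deg u * deg v) *\<^sub>R derivation v (derivation u c))"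
    using bilinear_lie_derivative
    by (intro linear_compose_add linear_compose_scale_right c) (simp add: bilinear_def)
  show "derivation u (derivation v 1) = lie_derivative (sch (bas u) (bas v)) 1
    + (- 1) ^ (deg u * deg v) *\<^sub>R derivation v (derivation u 1)"
    by (simp add: derivation_1 lie_derivative_def linear_0[OF linear_derivation])
  fix w c
  let ?T = "\<lambda>u v. sch (bas u) (bas v)"
  assume IH: "derivation u (derivation v c) = lie_derivative (?T u v) c
    + (- 1) ^ (deg u * deg v) *\<^sub>R derivation v (derivation u c)"
  have der: "derivation x (bracket y z * c) = chain_inc (sch (bas x) (?T y z)) * c
      + (- 1) ^ (deg x * (deg y + deg z)) *\<^sub>R (bracket y z * derivation x c)" for x y z c
    using lie_derivative_times[OF bas_in_grade sch_in_grade] by (simp add: lie_derivative_bas)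
  have "derivation x (derivation y (\<beta> w * c)) = chain_inc (sch (bas x) (?T y w)) * c
      + (- 1) ^ (deg x * (deg y + deg w)) *\<^sub>R (bracket y w * derivation x c)
      + (- 1) ^ (deg y * deg w) *\<^sub>R (bracket x w * derivation y c)
      + (- 1) ^ (deg y * deg w + deg x * deg w) *\<^sub>R (\<beta> w * derivation x (derivation y c))" for x y
    by (simp add: derivation_\<beta> der linear_add[OF linear_derivation] linear_scale[OF linear_derivation]
        scaleR_add_right power_add)
  note two = this
  have "lie_derivative (?T u v) (\<beta> w * c) = chain_inc (sch (?T u v) (bas w)) * c
      + (- 1) ^ ((deg u + deg v) * deg w) *\<^sub>R (\<beta> w * lie_derivative (?T u v) c)"
    unfolding \<beta>_def by (rule lie_derivative_times[OF sch_in_grade bas_in_grade])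
  note one = this
  have "chain_inc (sch (bas u) (?T v w)) = chain_inc (sch (?T u v) (bas w))
      + (- 1) ^ (deg u * deg v) *\<^sub>R chain_inc (sch (bas v) (?T u w))"
    by (subst sch_jacobi) (simp add: linear_add[OF chain_inc_linear] linear_scale[OF chain_inc_linear])
  then have jac: "chain_inc (sch (bas u) (?T v w)) * c = chain_inc (sch (?T u v) (bas w)) * c
      + (- 1) ^ (deg u * deg v) *\<^sub>R (chain_inc (sch (bas v) (?T u w)) * c)"
    by (simp add: distrib_right)
  have "even (deg u) \<or> odd (deg u)" "even (deg v) \<or> odd (deg v)" "even (deg w) \<or> odd (deg w)" by auto
  then show "derivation u (derivation v (\<beta> w * c)) = lie_derivative (?T u v) (\<beta> w * c)
    + (- 1) ^ (deg u * deg v) *\<^sub>R derivation v (derivation u (\<beta> w * c))"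
    unfolding two one jac IH
    by (elim disjE) (simp_all add: distrib_left right_diff_distrib scaleR_add_right)
qed

text \<open>Induction over products, comparing \<open>\<partial> L\<^sub>u (v c)\<close> with \<open>L\<^sub>u \<partial> (v c)\<close> by the recursion for \<open>\<partial>\<close>; the terms
  without \<open>\<partial>\<close> match by \<open>derivation_commutator\<close>.\<close>

lemma differential_derivation: "differential (derivation u c) = derivation u (differential c)"
proof (rule chain_linear_eqI[of "\<lambda>c. differential (derivation u c)" "\<lambda>c. derivation u (differential c)"])
  show "linear (\<lambda>c. differential (derivation u c))" "linear (\<lambda>c. derivation u (differential c))"
    using linear_compose[OF linear_derivation linear_differential]
      linear_compose[OF linear_differential linear_derivation] by (simp_all add: o_def)
  show "differential (derivation u 1) = derivation u (differential 1)"
    by (simp add: derivation_1 differential_1 linear_0[OF linear_derivation] linear_0[OF linear_differential])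
  fix v c
  assume IH: "differential (derivation u c) = derivation u (differential c)"
  let ?s = "(- 1) ^ (deg u * deg v) :: real"
  have "differential (derivation u (\<beta> v * c)) = lie_derivative (sch (bas u) (bas v)) c
      + ?s *\<^sub>R derivation v (derivation u c) - (bracket u v * differential c
      + ?s *\<^sub>R (\<beta> v * derivation u (differential c)))"
    by (simp add: derivation_\<beta> linear_add[OF linear_differential] linear_scale[OF linear_differential]
        differential_times differential_\<beta> IH scaleR_diff_right)
  also have "\<dots> = derivation u (differential (\<beta> v * c))"
    unfolding derivation_commutator[of u v c, symmetric] derivation_\<beta>[symmetric]
    by (simp add: differential_\<beta> linear_diff[OF linear_derivation])
  finally show "differential (derivation u (\<beta> v * c)) = derivation u (differential (\<beta> v * c))" .
qed

text \<open>Applying the recursion twice, \<open>\<partial>\<partial>(v c) = \<partial> L\<^sub>v c - L\<^sub>v \<partial>c + v \<partial>\<partial>c\<close>.\<close>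

lemma differential_differential: "differential (differential c) = 0"
proof (rule chain_linear_eqI[of "\<lambda>c. differential (differential c)" "\<lambda>_. 0"])
  show "linear (\<lambda>c. differential (differential c))"
    using linear_compose[OF linear_differential linear_differential] by (simp add: o_def)
  show "linear (\<lambda>_ :: 'a chain_algebra. 0 :: 'a chain_algebra)" by (simp add: linear_iff)
  show "differential (differential 1) = 0"
    by (simp add: differential_1 linear_0[OF linear_differential])
  show "differential (differential (\<beta> v * c)) = 0" if "differential (differential c) = 0" for v c
    using that
    by (simp add: differential_\<beta> linear_diff[OF linear_differential] differential_derivation)
qed

lemma chain_prod_Cons: "chain_prod (Y # Ys) = chain_inc Y * chain_prod Ys"
  by (simp add: chain_prod_def)

lemma lie_derivative_chain_prod:
  assumes X: "X \<in> grade x"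
  shows "list_all2 (\<lambda>Y y. Y \<in> grade y) Ys ys \<Longrightarrow> lie_derivative X (chain_prod Ys)
    = (\<Sum>j<length Ys. (- 1) ^ (x * (\<Sum>s<j. ys ! s)) *\<^sub>R chain_prod (Ys[j := sch X (Ys ! j)]))"
proof (induction rule: list_all2_induct)
  case Nil
  show ?case by (simp add: chain_prod_def lie_derivative_def derivation_1)
next
  case (Cons Y Ys y ys)
  have "lie_derivative X (chain_prod (Y # Ys)) = chain_inc (sch X Y) * chain_prod Ys
      + (- 1) ^ (x * y) *\<^sub>R (chain_inc Y * lie_derivative X (chain_prod Ys))"
    using lie_derivative_times[OF X Cons(1)] by (simp add: chain_prod_Cons)
  also have "\<dots> = (\<Sum>j<length (Y # Ys). (- 1) ^ (x * (\<Sum>s<j. (y # ys) ! s)) *\<^sub>R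
      chain_prod ((Y # Ys)[j := sch X ((Y # Ys) ! j)]))"
    by (simp add: Cons(3) sum.lessThan_Suc_shift chain_prod_Cons sum_distrib_left scaleR_sum_right
        power_add distrib_left del: sum.lessThan_Suc)
  finally show ?case .
qed

text \<open>In the boundary formula the summands with \<open>i = 0\<close> make up the Lie derivative along the first
  factor; shifting the indices of the others yields the boundary of the remaining factors.\<close>

lemma differential_chain_prod:
  "list_all2 (\<lambda>Y y. Y \<in> grade y) Ys ys \<Longrightarrow> differential (chain_prod Ys) = boundary_sum br Ys ys"
proof (induction rule: list_all2_induct)
  case Nil
  show ?case by (simp add: chain_prod_def boundary_sum_def differential_1)
next
  case (Cons Y Ys y ys)
  have 0: "(\<Sum>s\<in>{0<..<Suc j}. (y # ys) ! s) = (\<Sum>s<j. ys ! s)" for j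
  proof -
    have "{0<..<Suc j} = Suc ` {..<j}"
      by (auto simp: image_iff gr0_conv_Suc)
    then show ?thesis by (simp add: sum.reindex)
  qed
  have Suc: "(\<Sum>s\<in>{Suc i<..<Suc j}. (y # ys) ! s) = (\<Sum>s\<in>{i<..<j}. ys ! s)" for i j
  proof -
    have "{Suc i<..<Suc j} = Suc ` {i<..<j}"
      by (auto simp: image_iff Suc_less_eq2)
    then show ?thesis by (simp add: sum.reindex)
  qed
  define t where "t j i = (- 1) ^ (i + (y # ys) ! i * (\<Sum>s\<in>{i<..<j}. (y # ys) ! s)) *\<^sub>R
      chain_prod (omit_nth i ((Y # Ys)[j := sch ((Y # Ys) ! i) ((Y # Ys) ! j)]))" for j i
  have t0: "t (Suc j) 0 = (- 1) ^ (y * (\<Sum>s<j. ys ! s)) *\<^sub>R chain_prod (Ys[j := sch Y (Ys ! j)])" for j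
    unfolding t_def 0 by (simp add: omit_nth_def)
  have tS: "t (Suc j) (Suc i) = - (chain_inc Y * ((- 1) ^ (i + ys ! i * (\<Sum>s\<in>{i<..<j}. ys ! s)) *\<^sub>R
      chain_prod (omit_nth i (Ys[j := sch (Ys ! i) (Ys ! j)]))))" for i j
    unfolding t_def Suc by (simp add: omit_nth_def chain_prod_Cons)
  have "boundary_sum br (Y # Ys) (y # ys) = (\<Sum>j<Suc (length Ys). \<Sum>i<j. t j i)"
    by (simp add: boundary_sum_def t_def schouten_eq)
  also have "\<dots> = (\<Sum>j<length Ys. t (Suc j) 0 + (\<Sum>i<j. t (Suc j) (Suc i)))"
    by (simp add: sum.lessThan_Suc_shift del: sum.lessThan_Suc)
  also have "\<dots> = (\<Sum>j<length Ys. (- 1) ^ (y * (\<Sum>s<j. ys ! s)) *\<^sub>R chain_prod (Ys[j := sch Y (Ys ! j)]))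
        - chain_inc Y * boundary_sum br Ys ys"
    by (simp only: t0 tS boundary_sum_def schouten_eq sum.distrib sum_distrib_left sum_negf)
      (simp only: diff_conv_add_uminus)
  also have "\<dots> = differential (chain_prod (Y # Ys))"
    using differential_times[of Y "chain_prod Ys"] lie_derivative_chain_prod[OF Cons(1,2)] Cons(3)
    by (simp only: chain_prod_Cons)
  finally show ?case ..
qed

lemma boundary_eq: "boundary br = differential"
  unfolding boundary_def
proof (rule the_equality)
  show "is_boundary br differential"
    using linear_differential differential_chain_prod by (auto simp: is_boundary_def)
  fix d assume d: "is_boundary br d"
  have "d c = differential c" for c
  proof (rule linear_eq_on_span[of d differential])
    show "linear d" using d by (simp add: is_boundary_def)
    show "linear differential" by (rule linear_differential)
    fix x assume "x \<in> range (\<lambda>us. prod_list (map \<beta> us))"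
    then obtain us where x: "x = chain_prod (map bas us)" by (auto simp: chain_prod_bas)
    show "d x = differential x"
      unfolding x using d list_all2_bas[of us] differential_chain_prod[OF list_all2_bas[of us]]
      by (simp add: is_boundary_def)
  qed (simp only: chain_algebra_generated UNIV_I)
  then show "d = differential" by blast
qed

end

section \<open>The contraction by \<open>h\<close>\<close>

text \<open>Eigenvalues of the generators under bracketing with \<open>h\<close>. This is not the weight of chains, which is
  the sum of the grades.\<close>

fun wt :: "gen \<Rightarrow> nat" where
  "wt H = 0" | "wt E = 1" | "wt F = 0" | "wt P = 1" | "wt Q = 1" | "wt R = 0" | "wt V = 1"

definition total_wt :: "(gen \<Rightarrow> nat) \<Rightarrow> nat" where
  "total_wt n = (\<Sum>v\<in>UNIV. n v * wt v)"

context basis3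
begin

lemma monomial_eq_0:
  assumes "\<not> admissible n"
  shows "monomial n = 0"
proof -
  obtain v where v: "even (deg v)" "\<not> n v \<le> 1"
    using assms by (auto simp: admissible_def)
  obtain us ws where gens: "[H, E, F, V, P, Q, R] = us @ v # ws"
    by (rule monomial_split)
  have "n v = 2 + (n v - 2)" using v(2) by simp
  then have "\<beta> v ^ n v = \<beta> v ^ (2 + (n v - 2))" by (rule arg_cong)
  also have "\<dots> = 0"
    by (simp only: power_add power2_eq_square \<beta>_square[OF v(1)] mult_zero_left)
  finally have "\<beta> v ^ n v = 0" .
  then show ?thesis unfolding monomial_def gens by simp
qed

lemma coef_monomial':
  "coef (monomial n) m = (if admissible n \<and> m = n then 1 else 0)"
  by (cases "admissible n") (simp_all add: coef_monomial monomial_eq_0 linear_0[OF linear_coef])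

lemma chain_eqI:
  assumes "\<And>n. coef c n = coef c' n"
  shows "c = c'"
proof -
  obtain K where "c - c' = (\<Sum>n\<in>K. coef (c - c') n *\<^sub>R monomial n)"
    using monomial_expand by blast
  moreover have "coef (c - c') n = 0" for n
    using assms by (simp add: linear_diff[OF linear_coef])
  ultimately show ?thesis by simp
qed

lemma span_monomial: "span (range monomial) = UNIV"
proof -
  have "c \<in> span (range monomial)" for c
  proof -
    obtain K where c: "c = (\<Sum>n\<in>K. coef c n *\<^sub>R monomial n)"
      using monomial_expand by blast
    show ?thesis by (subst c) (intro span_sum span_scale span_base rangeI)
  qed
  then show ?thesis by blast
qed

lemma linear_eq_on_monomials:
  assumes "linear s" "linear t" "\<And>n. s (monomial n) = t (monomial n)"
  shows "s c = t c"
proof (rule linear_eq_on_span[OF assms(1,2), of "range monomial"])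
  show "s x = t x" if "x \<in> range monomial" for x using that assms(3) by blast
  show "c \<in> span (range monomial)" by (simp only: span_monomial UNIV_I)
qed

text \<open>The pseudoinverse of the derivation \<open>L\<close> of \<open>h\<close>. Since \<open>inverse 0 = 0\<close>, it vanishes on the kernel of
  \<open>L\<close>.\<close>

definition inverse_wt :: "'a chain_algebra \<Rightarrow> 'a chain_algebra" where
  "inverse_wt c = linear_extension (\<lambda>n. inverse (real (total_wt n)) *\<^sub>R monomial n)
     (pbw_action c (Poly_Mapping.single (\<lambda>_. 0) 1))"

lemma linear_inverse_wt: "linear inverse_wt"
proof -
  have "linear (\<lambda>c. pbw_action c (Poly_Mapping.single (\<lambda>_. 0) 1))"
    using pbw_action(1) by (simp add: algebra_action_def bilinear_def)
  from linear_compose[OF this linear_linear_extension] show ?thesis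
    by (simp add: inverse_wt_def[abs_def] o_def)
qed

lemma coef_inverse_wt: "coef (inverse_wt c) n = inverse (real (total_wt n)) * coef c n"
proof -
  let ?p = "pbw_action c (Poly_Mapping.single (\<lambda>_. 0) 1)"
  obtain K where K: "finite K" "c = (\<Sum>m\<in>K. coef c m *\<^sub>R monomial m)" "\<forall>m. m \<notin> K \<longrightarrow> coef c m = 0"
    using monomial_expand by blast
  have 1: "inverse_wt c = (\<Sum>m\<in>K. coef c m *\<^sub>R (inverse (real (total_wt m)) *\<^sub>R monomial m))"
    unfolding inverse_wt_def coef_def
    by (rule linear_extension_superset) (use K in \<open>auto simp: coef_def in_keys_iff\<close>)
  have "coef (inverse_wt c) n = (\<Sum>m\<in>K. coef c m * (inverse (real (total_wt m)) * coef (monomial m) n))"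
    unfolding 1 by (simp add: linear_sum[OF linear_coef] linear_scale[OF linear_coef] mult.assoc)
  also have "\<dots> = inverse (real (total_wt n)) * (\<Sum>m\<in>K. coef c m * coef (monomial m) n)"
    unfolding sum_distrib_left by (rule sum.cong) (auto simp: coef_monomial')
  also have "(\<Sum>m\<in>K. coef c m * coef (monomial m) n) = coef (\<Sum>m\<in>K. coef c m *\<^sub>R monomial m) n"
    by (simp add: linear_sum[OF linear_coef] linear_scale[OF linear_coef])
  finally show ?thesis unfolding K(2)[symmetric] .
qed

lemma inverse_wt_monomial: "inverse_wt (monomial n) = inverse (real (total_wt n)) *\<^sub>R monomial n"
  by (rule chain_eqI) (simp add: coef_inverse_wt linear_scale[OF linear_coef] coef_monomial')

end

context affine_times_line
begin

lemma sch_H: "sch (bas H) (bas v) = real (wt v) *\<^sub>R bas v"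
  by (cases v) (simp_all add: sch_def)

lemma derivation_H_monomial: "derivation H (monomial n) = real (total_wt n) *\<^sub>R monomial n"
proof -
  have br: "bracket H v = real (wt v) *\<^sub>R \<beta> v" for v
    by (simp add: sch_H linear_scale[OF chain_inc_linear] \<beta>_def)
  have "derivation H (prod_list (map \<beta> us)) = real (\<Sum>v\<leftarrow>us. wt v) *\<^sub>R prod_list (map \<beta> us)" for us
    by (induction us)
      (simp_all add: derivation_1 derivation_\<beta> br scaleR_left_distrib)
  then show ?thesis by (simp add: monomial_word sum_word total_wt_def)
qed

text \<open>The Cartan formula; it is the recursion for the boundary at the generator \<open>h\<close>.\<close>

lemma homotopy: "differential (\<beta> H * c) + \<beta> H * differential c = derivation H c"
  by (simp add: differential_\<beta>)

text \<open>Such a monomial is a product of \<open>h, f, h\<and>f\<close>, all of whose brackets vanish.\<close>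

lemma differential_wt_0:
  assumes "total_wt n = 0"
  shows "differential (monomial n) = 0"
proof -
  have br: "bracket u v = 0" if "wt u = 0" "wt v = 0" for u v
    using that linear_0[OF chain_inc_linear] by (cases u; cases v) (simp_all add: sch_def)
  have der: "derivation u (prod_list (map \<beta> us)) = 0" if "wt u = 0" "\<forall>v\<in>set us. wt v = 0" for u us
    using that(2) by (induction us) (simp_all add: derivation_1 derivation_\<beta> br that(1))
  have "differential (prod_list (map \<beta> us)) = 0" if "\<forall>v\<in>set us. wt v = 0" for us
    using that by (induction us) (simp_all add: differential_1 differential_\<beta> der)
  moreover have "(\<Sum>v\<leftarrow>word n. wt v) = 0"
    using assms by (simp only: sum_word total_wt_def)
  ultimately show ?thesis
    by (simp add: monomial_word sum_list_eq_0_iff)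
qed

text \<open>The boundary commutes with \<open>L\<close>, hence preserves its eigenspaces.\<close>

lemma differential_inverse_wt: "differential (inverse_wt c) = inverse_wt (differential c)"
proof (rule linear_eq_on_monomials[of "\<lambda>c. differential (inverse_wt c)" "\<lambda>c. inverse_wt (differential c)"])
  show "linear (\<lambda>c. differential (inverse_wt c))" "linear (\<lambda>c. inverse_wt (differential c))"
    using linear_compose[OF linear_inverse_wt linear_differential]
      linear_compose[OF linear_differential linear_inverse_wt] by (simp_all add: o_def)
  fix m
  let ?d = "differential (monomial m)"
  have "real (total_wt n) * coef ?d n = real (total_wt m) * coef ?d n" for n
  proof -
    have "coef (derivation H c) n = real (total_wt n) * coef c n" for c
    proof (rule linear_eq_on_monomials[of "\<lambda>c. coef (derivation H c) n"])
      show "linear (\<lambda>c. coef (derivation H c) n)"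
        using linear_compose[OF linear_derivation linear_coef] by (simp add: o_def)
      show "linear (\<lambda>c. real (total_wt n) * coef c n)"
        using linear_compose_scale_right[OF linear_coef] by simp
    qed (auto simp: derivation_H_monomial linear_scale[OF linear_coef] coef_monomial')
    then have "real (total_wt n) * coef ?d n = coef (derivation H ?d) n" by simp
    also have "\<dots> = coef (differential (derivation H (monomial m))) n"
      by (simp only: differential_derivation)
    also have "\<dots> = real (total_wt m) * coef ?d n"
      by (simp add: derivation_H_monomial linear_scale[OF linear_differential] linear_scale[OF linear_coef])
    finally show ?thesis .
  qed
  then have eq: "coef ?d n = 0 \<or> total_wt n = total_wt m" for n by simp
  show "differential (inverse_wt (monomial m)) = inverse_wt ?d"
  proof (rule chain_eqI)
    show "coef (differential (inverse_wt (monomial m))) n = coef (inverse_wt ?d) n" for n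
      using eq[of n]
      by (auto simp: inverse_wt_monomial linear_scale[OF linear_differential]
          linear_scale[OF linear_coef] coef_inverse_wt)
  qed
qed

text \<open>The boundary kills the kernel of \<open>L\<close>, so \<open>\<partial>c\<close> equals \<open>\<partial> L L\<^sup>+ c = L L\<^sup>+ \<partial>c\<close> for the pseudoinverse
  \<open>L\<^sup>+\<close>; now expand \<open>L\<close> by the Cartan formula and use \<open>\<partial>\<partial> = 0\<close>.\<close>

lemma differential_inverse_homotopy:
  "differential c = differential (\<beta> H * inverse_wt (differential c))"
proof -
  have "differential c = differential (derivation H (inverse_wt c))"
  proof (rule linear_eq_on_monomials[OF linear_differential])
    show "linear (\<lambda>c. differential (derivation H (inverse_wt c)))"
      using linear_compose[OF linear_inverse_wt linear_compose[OF linear_derivation linear_differential]]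
      by (simp add: o_def)
    show "differential (monomial n) = differential (derivation H (inverse_wt (monomial n)))" for n
      by (cases "total_wt n = 0")
        (simp_all add: inverse_wt_monomial linear_scale[OF linear_derivation] derivation_H_monomial
          differential_wt_0 linear_0[OF linear_differential] linear_0[OF linear_derivation])
  qed
  also have "\<dots> = derivation H (inverse_wt (differential c))"
    by (simp only: differential_derivation differential_inverse_wt)
  also have "\<dots> = differential (\<beta> H * inverse_wt (differential c)) + \<beta> H * differential (inverse_wt (differential c))"
    by (simp only: homotopy)
  also have "differential (inverse_wt (differential c)) = 0"
    by (simp only: differential_inverse_wt differential_differential linear_0[OF linear_inverse_wt])
  also have "differential (\<beta> H * inverse_wt (differential c)) + \<beta> H * 0
      = differential (\<beta> H * inverse_wt (differential c))"
    by simp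
  finally show ?thesis .
qed

text \<open>The first summand is the projection of \<open>c\<close> to the kernel of \<open>L\<close>.\<close>

lemma cycle_decomposition:
  assumes "differential c = 0"
  shows "c = (c - derivation H (inverse_wt c)) + differential (\<beta> H * inverse_wt c)"
proof -
  have "derivation H (inverse_wt c) = differential (\<beta> H * inverse_wt c) + \<beta> H * differential (inverse_wt c)"
    by (simp only: homotopy)
  moreover have "differential (inverse_wt c) = 0"
    by (simp add: differential_inverse_wt assms linear_0[OF linear_inverse_wt])
  ultimately show ?thesis by simp
qed

text \<open>One family, indexed by exponents, that contains the basis of the cycles: \<open>harmonic\<close> indices give
  representatives of the homology classes, \<open>exact\<close> indices give boundaries.\<close>

definition cycle_gen :: "(gen \<Rightarrow> nat) \<Rightarrow> 'a chain_algebra" where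
  "cycle_gen n = (if total_wt n = 0 then monomial n else differential (\<beta> H * monomial n))"

definition harmonic :: "nat \<Rightarrow> nat \<Rightarrow> (gen \<Rightarrow> nat) set" where
  "harmonic m w = {n \<in> indices m w. total_wt n = 0}"

definition exact :: "nat \<Rightarrow> nat \<Rightarrow> (gen \<Rightarrow> nat) set" where
  "exact m w = {n \<in> indices m w. n H = 0 \<and> total_wt n \<noteq> 0}"

lemma harmonic_exact_disjoint: "harmonic m w \<inter> exact m w = {}"
  by (auto simp: harmonic_def exact_def)

lemma derivation_in_span_indices:
  "derivation u (prod_list (map \<beta> us)) \<in> span (monomial ` indices (length us) (sum_list (map deg us) + deg u))"
proof (induction us)
  case Nil
  show ?case by (simp add: derivation_1 span_zero)
next
  case (Cons v us)
  have "prod_list (map \<beta> us) \<in> span (monomial ` indices (length us) (sum_list (map deg us)))"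
    using chain_prod_in_span_indices[OF list_all2_bas[of us]] by (simp add: chain_prod_bas)
  from chain_inc_times_span_indices[OF sch_in_grade this, of u v] \<beta>_times_span_indices[OF Cons, of v]
  show ?case
    by (auto simp: derivation_\<beta> ac_simps intro!: span_add span_scale)
qed

lemma differential_in_span_indices:
  "differential (prod_list (map \<beta> us)) \<in> span (monomial ` indices (length us - 1) (sum_list (map deg us)))"
proof (induction us)
  case Nil
  show ?case by (simp add: differential_1 span_zero)
next
  case (Cons v us)
  have "\<beta> v * differential (prod_list (map \<beta> us)) \<in> span (monomial ` indices (length us) (sum_list (map deg us) + deg v))"
  proof (cases us)
    case Nil
    then show ?thesis by (simp add: differential_1 span_zero)
  next
    case (Cons u us')
    then show ?thesis using \<beta>_times_span_indices[OF Cons.IH, of v] by simp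
  qed
  then show ?case
    using derivation_in_span_indices[of v us] by (auto simp: differential_\<beta> add.commute intro!: span_diff)
qed

lemma differential_chains:
  assumes "c \<in> span (monomial ` indices m w)"
  shows "differential c \<in> span (monomial ` indices (m - 1) w)"
proof (rule linear_image_span_subset[OF linear_differential _ subspace_span assms])
  fix x assume "x \<in> monomial ` indices m w"
  then obtain n where n: "n \<in> indices m w" "x = monomial n" by blast
  have "length (word n) = m" "sum_list (map deg (word n)) = w"
    using n sum_word[of "\<lambda>_. 1" n] sum_word[of deg n] by (simp_all add: indices_def sum_list_triv)
  then show "differential x \<in> span (monomial ` indices (m - 1) w)"
    using differential_in_span_indices[of "word n"] by (simp add: n(2) monomial_word)
qed

lemma finite_indices: "finite (indices m w)"
proof (rule finite_subset)
  show "indices m w \<subseteq> {n. \<forall>v. n v \<in> {..m}}"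
  proof (clarsimp simp: indices_def)
    fix n :: "gen \<Rightarrow> nat" and v
    show "n v \<le> sum n UNIV" by (rule member_le_sum) auto
  qed
  have "finite (PiE UNIV (\<lambda>_ :: gen. {..m}))" by (rule finite_PiE) auto
  then show "finite {n :: gen \<Rightarrow> nat. \<forall>v. n v \<in> {..m}}"
    by (simp add: PiE_def Pi_def)
qed

lemma span_monomial_eq_sum:
  assumes "c \<in> span (monomial ` indices m w)"
  shows "c = (\<Sum>n\<in>indices m w. coef c n *\<^sub>R monomial n)"
proof (rule linear_eq_on_span[OF _ _ _ assms, of "\<lambda>c. c"
      "\<lambda>c. \<Sum>n\<in>indices m w. coef c n *\<^sub>R monomial n"])
  show "linear (\<lambda>c :: 'a chain_algebra. c)" by (simp add: linear_iff)
  show "linear (\<lambda>c. \<Sum>n\<in>indices m w. coef c n *\<^sub>R monomial n)"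
    by (rule linearI)
      (simp_all add: linear_add[OF linear_coef] linear_scale[OF linear_coef] scaleR_left_distrib
        sum.distrib scaleR_sum_right)
  fix x assume "x \<in> monomial ` indices m w"
  then obtain k where k: "k \<in> indices m w" "x = monomial k" by blast
  then have "(\<Sum>n\<in>indices m w. coef x n *\<^sub>R monomial n) = (\<Sum>n\<in>indices m w. if n = k then monomial n else 0)"
    by (intro sum.cong) (auto simp: coef_monomial' indices_def)
  also have "\<dots> = x" using k by (simp add: finite_indices)
  finally show "x = (\<Sum>n\<in>indices m w. coef x n *\<^sub>R monomial n)" ..
qed

lemma differential_homotopy_in_span:
  assumes "c \<in> span (monomial ` indices m w)"
  shows "differential (\<beta> H * inverse_wt c) \<in> span (cycle_gen ` exact m w)"
proof -
  have "differential (\<beta> H * inverse_wt c) = (\<Sum>n\<in>indices m w. coef c n *\<^sub>R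
      (inverse (real (total_wt n)) *\<^sub>R differential (\<beta> H * monomial n)))"
    by (subst span_monomial_eq_sum[OF assms])
      (simp add: linear_sum[OF linear_inverse_wt] linear_scale[OF linear_inverse_wt] inverse_wt_monomial
        sum_distrib_left linear_sum[OF linear_differential] linear_scale[OF linear_differential])
  also have "\<dots> \<in> span (cycle_gen ` exact m w)"
  proof (rule span_sum, rule span_scale)
    fix n assume n: "n \<in> indices m w"
    show "inverse (real (total_wt n)) *\<^sub>R differential (\<beta> H * monomial n) \<in> span (cycle_gen ` exact m w)"
    proof (cases "total_wt n = 0 \<or> n H \<noteq> 0")
      case True
      then show ?thesis
        by (auto simp: \<beta>_times_monomial blocked_def linear_0[OF linear_differential] span_zero)
    next
      case False
      then have "n \<in> exact m w" "cycle_gen n = differential (\<beta> H * monomial n)"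
        using n by (auto simp: exact_def cycle_gen_def)
      then show ?thesis by (intro span_scale span_base) (metis image_eqI)
    qed
  qed
  finally show ?thesis .
qed

lemma cycle_gen_cycle:
  assumes "n \<in> harmonic m w \<union> exact m w"
  shows "differential (cycle_gen n) = 0" "cycle_gen n \<in> span (monomial ` indices m w)"
proof -
  show "differential (cycle_gen n) = 0"
    by (simp add: cycle_gen_def differential_wt_0 differential_differential)
  have n: "monomial n \<in> span (monomial ` indices m w)"
    using assms by (auto simp: harmonic_def exact_def intro: span_base)
  have "differential (\<beta> H * monomial n) \<in> span (monomial ` indices m w)"
    using differential_chains[OF \<beta>_times_span_indices[OF n, of H]] by simp
  with n show "cycle_gen n \<in> span (monomial ` indices m w)" by (simp add: cycle_gen_def)
qed

lemma cycles_eq: "cycles br (int m) w = span (cycle_gen ` (harmonic m w \<union> exact m w))"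
proof (intro equalityI subsetI)
  fix c assume "c \<in> cycles br (int m) w"
  then have c: "c \<in> span (monomial ` indices m w)" "differential c = 0"
    by (simp_all add: cycles_def chain_space_eq boundary_eq)
  let ?S = "span (cycle_gen ` (harmonic m w \<union> exact m w))"
  have "c - derivation H (inverse_wt c) = (\<Sum>n\<in>indices m w. coef c n *\<^sub>R
      (monomial n - (inverse (real (total_wt n)) * real (total_wt n)) *\<^sub>R monomial n))"
    by (subst (1 2) span_monomial_eq_sum[OF c(1)])
      (simp add: linear_sum[OF linear_inverse_wt] linear_scale[OF linear_inverse_wt] inverse_wt_monomial
        linear_sum[OF linear_derivation] linear_scale[OF linear_derivation] derivation_H_monomial
        scaleR_diff_right sum_subtractf mult.assoc)
  also have "\<dots> \<in> ?S"
  proof (rule span_sum, rule span_scale)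
    fix n assume n: "n \<in> indices m w"
    show "monomial n - (inverse (real (total_wt n)) * real (total_wt n)) *\<^sub>R monomial n \<in> ?S"
    proof (cases "total_wt n = 0")
      case True
      then have "n \<in> harmonic m w" "cycle_gen n = monomial n"
        using n by (auto simp: harmonic_def cycle_gen_def)
      then show ?thesis using True by (auto intro!: span_base) (metis UnI1 image_eqI)
    qed (simp add: span_zero)
  qed
  finally have 1: "c - derivation H (inverse_wt c) \<in> ?S" .
  have "span (cycle_gen ` exact m w) \<subseteq> ?S"
    by (intro span_mono image_mono) auto
  with differential_homotopy_in_span[OF c(1)] have 2: "differential (\<beta> H * inverse_wt c) \<in> ?S" by blast
  show "c \<in> ?S"
    by (subst cycle_decomposition[OF c(2)]) (intro span_add 1 2)
next
  fix c assume c: "c \<in> span (cycle_gen ` (harmonic m w \<union> exact m w))"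
  have "c \<in> span (monomial ` indices m w)"
    using span_minimal[OF _ subspace_span] cycle_gen_cycle(2) c by blast
  moreover have "differential c = 0"
    by (rule linear_eq_0_on_span[OF linear_differential _ c]) (use cycle_gen_cycle(1) in blast)
  ultimately show "c \<in> cycles br (int m) w"
    by (simp add: cycles_def chain_space_eq boundary_eq)
qed

lemma boundaries_eq: "boundary br ` chain_space (int m + 1) w = span (cycle_gen ` exact m w)"
proof -
  have "int m + 1 = int (Suc m)" by simp
  then have "boundary br ` chain_space (int m + 1) w = differential ` span (monomial ` indices (Suc m) w)"
    by (simp only: boundary_eq chain_space_eq)
  also have "\<dots> = span (cycle_gen ` exact m w)"
  proof (intro equalityI image_subsetI)
    fix c assume "c \<in> span (monomial ` indices (Suc m) w)"
    from differential_homotopy_in_span[OF differential_chains[OF this]]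
    show "differential c \<in> span (cycle_gen ` exact m w)"
      by (subst differential_inverse_homotopy) simp
  next
    have "cycle_gen ` exact m w \<subseteq> differential ` span (monomial ` indices (Suc m) w)"
    proof (rule image_subsetI)
      fix n assume n: "n \<in> exact m w"
      then have "monomial n \<in> span (monomial ` indices m w)"
        by (auto simp: exact_def intro: span_base)
      from \<beta>_times_span_indices[OF this, of H]
      have "\<beta> H * monomial n \<in> span (monomial ` indices (Suc m) w)" by simp
      moreover have "cycle_gen n = differential (\<beta> H * monomial n)"
        using n by (simp add: exact_def cycle_gen_def)
      ultimately show "cycle_gen n \<in> differential ` span (monomial ` indices (Suc m) w)" by blast
    qed
    then show "span (cycle_gen ` exact m w) \<subseteq> differential ` span (monomial ` indices (Suc m) w)"
      by (rule span_minimal) (rule linear_subspace_image[OF linear_differential subspace_span])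
  qed
  finally show ?thesis .
qed

text \<open>Multiplication by \<open>h\<close> maps \<open>\<partial>(h n)\<close> to \<open>h L n\<close>, a nonzero multiple of the monomial \<open>h n\<close>, and maps the
  harmonic monomials to other monomials or zero. Comparing coefficients shows that first the
  coefficients of the exact indices vanish, and then those of the harmonic ones.\<close>

lemma cycle_gen_independent:
  assumes 0: "(\<Sum>n\<in>harmonic m w \<union> exact m w. a n *\<^sub>R cycle_gen n) = 0"
    and n: "n \<in> harmonic m w \<union> exact m w"
  shows "a n = 0"
proof -
  have fin: "finite (harmonic m w)" "finite (exact m w)"
    using finite_indices by (auto simp: harmonic_def exact_def)
  have H: "\<beta> H * monomial k = (if k H = 0 then monomial (increment H k) else 0)" for k
    by (simp add: \<beta>_times_monomial blocked_def swaps_def)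
  have HH: "\<beta> H * (\<beta> H * c) = 0" for c
    using \<beta>_square[of H] by (simp flip: mult.assoc)
  \<comment> \<open>By the Cartan formula for h n, because the product of h with itself is zero.\<close>
  have cg: "\<beta> H * cycle_gen k = real (total_wt k) *\<^sub>R monomial (increment H k)" if "k \<in> exact m w" for k
  proof -
    have k: "k H = 0" "total_wt k \<noteq> 0" using that by (auto simp: exact_def)
    have "\<beta> H * differential (\<beta> H * monomial k) = derivation H (\<beta> H * monomial k)"
      using homotopy[of "\<beta> H * monomial k"] by (simp add: HH linear_0[OF linear_differential])
    also have "\<dots> = real (total_wt (increment H k)) *\<^sub>R monomial (increment H k)"
      using k by (simp add: H derivation_H_monomial)
    also have "total_wt (increment H k) = total_wt k"
      by (simp add: total_wt_def sum_gen increment_def)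
    finally show ?thesis using k by (simp add: cycle_gen_def)
  qed
  have adm: "admissible (increment H k)" if "k \<in> exact m w" for k
    using increment_indices[of k m w H] that by (auto simp: exact_def indices_def blocked_def)
  have inj: "increment H k = increment H l \<longleftrightarrow> k = l" for k l
  proof
    assume "increment H k = increment H l"
    then have "increment H k v = increment H l v" for v by simp
    then have "k v = l v" for v
      by (metis fun_upd_apply increment_def old.nat.inject)
    then show "k = l" by blast
  qed simp
  have ex: "a k = 0" if k: "k \<in> exact m w" for k
  proof -
    let ?c = "\<lambda>c. coef (\<beta> H * c) (increment H k)"
    have lin: "linear ?c"
      using linear_compose[OF linear_mult_left linear_coef] by (simp add: o_def)
    have "?c (cycle_gen l) = (if l = k then real (total_wt k) else 0)" if l: "l \<in> harmonic m w \<union> exact m w" for l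
    proof (cases "l \<in> exact m w")
      case True
      then show ?thesis
        using adm[of l] by (auto simp: cg linear_scale[OF linear_coef] coef_monomial' inj)
    next
      case False
      then have "total_wt l = 0" "l \<noteq> k" using l k by (auto simp: harmonic_def)
      then show ?thesis
        by (simp add: cycle_gen_def H coef_monomial' inj linear_0[OF linear_coef])
    qed
    then have "?c (\<Sum>l\<in>harmonic m w \<union> exact m w. a l *\<^sub>R cycle_gen l)
        = (\<Sum>l\<in>harmonic m w \<union> exact m w. if l = k then a l * real (total_wt k) else 0)"
      unfolding linear_sum[OF lin] linear_scale[OF lin] by (intro sum.cong) auto
    also have "\<dots> = a k * real (total_wt k)" using k fin by simp
    finally have "a k * real (total_wt k) = 0" unfolding 0 using linear_0[OF lin] by simp
    then show ?thesis using k by (simp add: exact_def)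
  qed
  show ?thesis
  proof (cases "n \<in> exact m w")
    case True
    then show ?thesis by (rule ex)
  next
    case n_not_exact: False
    then have h: "n \<in> harmonic m w" using n by blast
    have "coef (\<Sum>l\<in>harmonic m w \<union> exact m w. a l *\<^sub>R cycle_gen l) n
        = (\<Sum>l\<in>harmonic m w \<union> exact m w. if l = n then a l else 0)"
      unfolding linear_sum[OF linear_coef] linear_scale[OF linear_coef]
    proof (rule sum.cong)
      fix l assume l: "l \<in> harmonic m w \<union> exact m w"
      show "a l *\<^sub>R coef (cycle_gen l) n = (if l = n then a l else 0)"
      proof (cases "l \<in> exact m w")
        case True
        then show ?thesis using ex[OF True] n_not_exact by auto
      next
        case False
        then have "l \<in> harmonic m w" using l by blast
        then show ?thesis by (auto simp: harmonic_def indices_def cycle_gen_def coef_monomial')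
      qed
    qed simp
    also have "\<dots> = a n" using h fin by simp
    finally show ?thesis unfolding 0 using linear_0[OF linear_coef] by simp
  qed
qed

end

section \<open>Dimensions\<close>

lemma independent_family:
  fixes z :: "'i \<Rightarrow> 'b::real_vector"
  assumes fin: "finite I" and ind: "\<And>a i. (\<Sum>i\<in>I. a i *\<^sub>R z i) = 0 \<Longrightarrow> i \<in> I \<Longrightarrow> a i = 0"
  shows "inj_on z I" "independent (z ` I)"
proof -
  show inj: "inj_on z I"
  proof (rule inj_onI, rule ccontr)
    fix i j assume ij: "i \<in> I" "j \<in> I" "z i = z j" "i \<noteq> j"
    let ?a = "\<lambda>k. if k = i then 1 else if k = j then - 1 else 0 :: real"
    have "(\<Sum>k\<in>I. ?a k *\<^sub>R z k) = (\<Sum>k\<in>I. (if k = i then z k else 0) - (if k = j then z k else 0))"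
      using ij by (intro sum.cong) auto
    also have "\<dots> = 0" using ij fin by (simp add: sum_subtractf)
    finally show False using ind[of ?a i] ij by simp
  qed
  show "independent (z ` I)"
  proof (rule independent_if_scalars_zero)
    show "finite (z ` I)" using fin by simp
    fix u x assume "(\<Sum>x\<in>z ` I. u x *\<^sub>R x) = 0" and x: "x \<in> z ` I"
    then have "(\<Sum>i\<in>I. u (z i) *\<^sub>R z i) = 0" by (simp add: sum.reindex[OF inj] o_def)
    then show "u x = 0" using ind[of "\<lambda>i. u (z i)"] x by blast
  qed
qed

lemma quotient_basis_diff:
  fixes T :: "'b::real_vector set"
  assumes T: "finite T" "independent T" and S: "S \<subseteq> T"
  shows "quotient_basis (span T) (span S) (T - S)"
  unfolding quotient_basis_def
proof (intro conjI allI impI ballI)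
  show "T - S \<subseteq> span T" using span_superset by blast
  have finS: "finite S" using S T(1) by (rule finite_subset)
  fix F c b assume F: "finite F" "F \<subseteq> T - S" and "(\<Sum>b\<in>F. c b *\<^sub>R b) \<in> span S" and b: "b \<in> F"
  then obtain r where r: "(\<Sum>b\<in>F. c b *\<^sub>R b) = (\<Sum>s\<in>S. r s *\<^sub>R s)"
    by (auto simp: span_finite[OF finS])
  let ?u = "\<lambda>t. if t \<in> S then - r t else c t"
  have "(\<Sum>t\<in>F \<union> S. ?u t *\<^sub>R t) = (\<Sum>t\<in>F. ?u t *\<^sub>R t) + (\<Sum>t\<in>S. ?u t *\<^sub>R t)"
    using F finS by (intro sum.union_disjoint) auto
  also have "(\<Sum>t\<in>F. ?u t *\<^sub>R t) = (\<Sum>t\<in>F. c t *\<^sub>R t)"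
    using F by (intro sum.cong) auto
  also have "(\<Sum>t\<in>S. ?u t *\<^sub>R t) = - (\<Sum>s\<in>S. r s *\<^sub>R s)"
    by (simp add: sum_negf)
  finally have "(\<Sum>t\<in>F \<union> S. ?u t *\<^sub>R t) = 0" by (simp add: r)
  moreover have "finite (F \<union> S)" "F \<union> S \<subseteq> T" "b \<in> F \<union> S" using F finS S b by auto
  ultimately have "?u b = 0" using independentD[OF T(2), of "F \<union> S" ?u b] by blast
  then show "c b = 0" using F b by auto
next
  fix v assume "v \<in> span T"
  then obtain u where u: "v = (\<Sum>t\<in>T. u t *\<^sub>R t)" by (auto simp: span_finite[OF T(1)])
  have "v = (\<Sum>t\<in>T - S. u t *\<^sub>R t) + (\<Sum>t\<in>S. u t *\<^sub>R t)"
    unfolding u by (rule sum.subset_diff[OF S T(1)])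
  then have "v - (\<Sum>t\<in>T - S. u t *\<^sub>R t) \<in> span S"
    by (auto intro: span_sum span_scale span_base)
  then show "\<exists>F c. finite F \<and> F \<subseteq> T - S \<and> v - (\<Sum>b\<in>F. c b *\<^sub>R b) \<in> span S"
    using T(1) by blast
qed

text \<open>A basis of the quotient together with a basis of the subspace is a basis of the whole space, so all
  bases of the quotient have the same cardinality, and the choice in \<open>quotient_dim\<close> does not matter.\<close>

lemma card_quotient_basis:
  fixes T :: "'b::real_vector set"
  assumes T: "finite T" "independent T" and S: "S \<subseteq> T" and B: "quotient_basis (span T) (span S) B"
  shows "card B = card (T - S)"
proof -
  have BT: "B \<subseteq> span T"
    and ind: "\<And>F c b. finite F \<Longrightarrow> F \<subseteq> B \<Longrightarrow> (\<Sum>b\<in>F. c b *\<^sub>R b) \<in> span S \<Longrightarrow> b \<in> F \<Longrightarrow> c b = 0"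
    and gen: "\<And>v. v \<in> span T \<Longrightarrow> \<exists>F c. finite F \<and> F \<subseteq> B \<and> v - (\<Sum>b\<in>F. c b *\<^sub>R b) \<in> span S"
    using B unfolding quotient_basis_def by blast+
  have finS: "finite S" using S T(1) by (rule finite_subset)
  have indS: "independent S" using T(2) S by (rule independent_mono)
  have "independent B"
    unfolding independent_explicit_finite_subsets
  proof (intro allI impI ballI)
    fix F u b assume "F \<subseteq> B" "finite F" "(\<Sum>v\<in>F. u v *\<^sub>R v) = 0" "b \<in> F"
    then show "u b = 0" using ind[of F u b] by (simp add: span_zero)
  qed
  then have finB: "finite B"
    using independent_span_bound[OF T(1) _ BT] by blast
  have disj: "B \<inter> S = {}"
  proof -
    have False if "b \<in> B" "b \<in> S" for b
      using ind[of "{b}" "\<lambda>_. 1" b] that by (simp add: span_base)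
    then show ?thesis by blast
  qed
  have "independent (B \<union> S)"
  proof (rule independent_if_scalars_zero)
    show "finite (B \<union> S)" using finB finS by simp
    fix u x assume 0: "(\<Sum>x\<in>B \<union> S. u x *\<^sub>R x) = 0" and x: "x \<in> B \<union> S"
    have sum: "(\<Sum>x\<in>B. u x *\<^sub>R x) + (\<Sum>x\<in>S. u x *\<^sub>R x) = 0"
      using 0 by (simp only: sum.union_disjoint[OF finB finS disj])
    then have "(\<Sum>x\<in>B. u x *\<^sub>R x) = - (\<Sum>x\<in>S. u x *\<^sub>R x)"
      by (simp only: eq_neg_iff_add_eq_0)
    also have "\<dots> \<in> span S" by (intro span_neg span_sum span_scale span_base)
    finally have uB: "u b = 0" if "b \<in> B" for b using ind[OF finB order_refl _ that] by blast
    with sum have "(\<Sum>x\<in>S. u x *\<^sub>R x) = 0" by simp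
    then have "u s = 0" if "s \<in> S" for s
      using independentD[OF indS finS order_refl _ that] by blast
    then show "u x = 0" using x uB by blast
  qed
  moreover have "span (B \<union> S) = span T"
  proof (rule span_subspace)
    show "B \<union> S \<subseteq> span T" using BT S span_superset by blast
    show "span T \<subseteq> span (B \<union> S)"
    proof
      fix v assume "v \<in> span T"
      from gen[OF this] obtain F c where F: "F \<subseteq> B" "v - (\<Sum>b\<in>F. c b *\<^sub>R b) \<in> span S" by blast
      have "(\<Sum>b\<in>F. c b *\<^sub>R b) \<in> span (B \<union> S)"
        using F(1) by (intro span_sum span_scale span_base) blast
      moreover have "v - (\<Sum>b\<in>F. c b *\<^sub>R b) \<in> span (B \<union> S)"
        using F(2) span_mono[of S "B \<union> S"] by blast
      ultimately have "(v - (\<Sum>b\<in>F. c b *\<^sub>R b)) + (\<Sum>b\<in>F. c b *\<^sub>R b) \<in> span (B \<union> S)"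
        by (intro span_add)
      then show "v \<in> span (B \<union> S)" by simp
    qed
  qed (rule subspace_span)
  ultimately have "card (B \<union> S) = card T"
    using dim_span_eq_card_independent[OF T(2)] dim_span_eq_card_independent[of "B \<union> S"] by simp
  then show ?thesis
    using card_Un_disjoint[OF finB finS disj] card_Diff_subset[OF finS S] by simp
qed

lemma quotient_dim_span:
  fixes T :: "'b::real_vector set"
  assumes "finite T" "independent T" "S \<subseteq> T"
  shows "quotient_dim (span T) (span S) = card (T - S)"
  unfolding quotient_dim_def
  using card_quotient_basis[OF assms someI[of "quotient_basis (span T) (span S)"]]
    quotient_basis_diff[OF assms] by blast

lemma quotient_dim_zero:
  assumes "0 \<in> U"
  shows "quotient_dim {0} U = 0"
proof -
  have "B = {}" if B: "quotient_basis {0} U B" for B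
  proof (rule ccontr)
    assume "B \<noteq> {}"
    then have "B = {0}" using B by (auto simp: quotient_basis_def)
    then have "\<forall>b\<in>{0}. (\<lambda>_. 1 :: real) b = 0"
      using B assms unfolding quotient_basis_def by (auto dest!: spec[of _ "{0}"])
    then show False by simp
  qed
  moreover have "quotient_basis {0} U {}"
    using assms by (simp add: quotient_basis_def)
  ultimately have "(SOME B. quotient_basis {0} U B) = {}"
    by (intro some_equality)
  then show ?thesis by (simp add: quotient_dim_def)
qed

lemma sum_Suc_diff_choose: "(\<Sum>i\<le>k. Suc (k - i)) = (k + 2) choose 2"
proof -
  have "(\<Sum>i\<le>k. Suc (k - i)) = (\<Sum>i\<le>k. Suc i)"
    by (rule sum.reindex_bij_witness[of _ "\<lambda>i. k - i" "\<lambda>i. k - i"]) auto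
  also have "\<dots> = (k + 2) choose 2"
    by (induction k) (simp_all add: numeral_2_eq_2)
  finally show ?thesis .
qed

definition slice :: "nat \<Rightarrow> nat \<Rightarrow> nat \<Rightarrow> nat \<Rightarrow> nat \<Rightarrow> (gen \<Rightarrow> nat) set" where
  "slice a b c g k = {n. n H = a \<and> n E = b \<and> n F = c \<and> n V = g \<and> n P + n Q + n R = k}"

fun exponents :: "nat \<Rightarrow> nat \<Rightarrow> nat \<Rightarrow> nat \<Rightarrow> nat \<Rightarrow> nat \<Rightarrow> nat \<Rightarrow> gen \<Rightarrow> nat" where
  "exponents a b c p q r g H = a" | "exponents a b c p q r g E = b" | "exponents a b c p q r g F = c"
| "exponents a b c p q r g P = p" | "exponents a b c p q r g Q = q" | "exponents a b c p q r g R = r"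
| "exponents a b c p q r g V = g"

lemma exponents_eq: "n = exponents (n H) (n E) (n F) (n P) (n Q) (n R) (n V)"
proof
  show "n v = exponents (n H) (n E) (n F) (n P) (n Q) (n R) (n V) v" for v by (cases v) simp_all
qed

lemma card_slice: "card (slice a b c g k) = (k + 2) choose 2"
proof -
  let ?\<phi> = "\<lambda>(i, j). exponents a b c i j (k - i - j) g"
  let ?D = "SIGMA i:{..k}. {..k - i}"
  have "bij_betw ?\<phi> ?D (slice a b c g k)"
    unfolding bij_betw_def
  proof
    show "inj_on ?\<phi> ?D"
      by (rule inj_onI) (auto dest: fun_cong[where x = P] fun_cong[where x = Q])
    show "?\<phi> ` ?D = slice a b c g k"
    proof (intro equalityI subsetI)
      fix n assume n: "n \<in> slice a b c g k"
      have "n = ?\<phi> (n P, n Q)"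
        using n by (subst exponents_eq[of n]) (auto simp: slice_def)
      moreover have "(n P, n Q) \<in> ?D" using n by (auto simp: slice_def)
      ultimately show "n \<in> ?\<phi> ` ?D" by blast
    qed (auto simp: slice_def)
  qed
  then have "card (slice a b c g k) = card ?D" by (simp add: bij_betw_same_card)
  also have "\<dots> = (\<Sum>i\<le>k. Suc (k - i))" by (simp add: card_SigmaI)
  finally show ?thesis by (simp only: sum_Suc_diff_choose)
qed

lemma card_fibers:
  assumes "finite A" "finite X" "\<And>n. n \<in> A \<Longrightarrow> s n \<in> X"
  shows "card A = (\<Sum>x\<in>X. card {n \<in> A. s n = x})"
  using sum.group[OF assms(1,2), of s "\<lambda>_. 1 :: nat"] assms(3) by (simp add: image_subset_iff)

definition bits :: "nat set" where "bits = {0, 1}"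

context basis3
begin

lemma admissible_iff: "admissible n \<longleftrightarrow> n H \<le> 1 \<and> n E \<le> 1 \<and> n F \<le> 1 \<and> n V \<le> 1"
proof
  assume r: "n H \<le> 1 \<and> n E \<le> 1 \<and> n F \<le> 1 \<and> n V \<le> 1"
  have "n v \<le> 1" if "even (deg v)" for v
    using that r by (cases v) simp_all
  then show "admissible n" by (simp add: admissible_def)
qed (simp add: admissible_def)

lemma indices_iff: "n \<in> indices m w \<longleftrightarrow> n H \<le> 1 \<and> n E \<le> 1 \<and> n F \<le> 1 \<and> n V \<le> 1 \<and>
    n H + n E + n F + n P + n Q + n R + n V = m \<and> n P + n Q + n R + 2 * n V = w"
  by (auto simp: indices_def admissible_iff sum_gen)

end

context affine_times_line
begin

text \<open>The exponents of the generators of even grade are 0 or 1, and they determine the total exponent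
  \<open>w - 2 * g\<close> of the generators of odd grade. For \<open>w < 2\<close> and \<open>g = 1\<close> no such monomial exists, and the
  binomial coefficient vanishes, too.\<close>

lemma card_indices_H:
  assumes "A \<subseteq> bits"
  shows "card {n \<in> indices m w. n H \<in> A} = (\<Sum>(a, b, c, g) \<in> A \<times> bits \<times> bits \<times> bits.
    if a + b + c + w = m + g then (w + 2 - 2 * g) choose 2 else 0)"
proof -
  let ?s = "\<lambda>n :: gen \<Rightarrow> nat. (n H, n E, n F, n V)"
  let ?A = "{n \<in> indices m w. n H \<in> A}"
  have "card ?A = (\<Sum>x \<in> A \<times> bits \<times> bits \<times> bits. card {n \<in> ?A. ?s n = x})"
  proof (rule card_fibers)
    show "finite ?A" using finite_indices by simp
    show "finite (A \<times> bits \<times> bits \<times> bits)" using assms by (auto simp: bits_def intro: finite_subset)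
    show "?s n \<in> A \<times> bits \<times> bits \<times> bits" if "n \<in> ?A" for n
      using that by (auto simp: indices_iff bits_def le_Suc_eq)
  qed
  also have "\<dots> = (\<Sum>(a, b, c, g) \<in> A \<times> bits \<times> bits \<times> bits.
    if a + b + c + w = m + g then (w + 2 - 2 * g) choose 2 else 0)"
  proof (rule sum.cong[OF refl], clarify)
    fix a b c g assume x: "a \<in> A" "b \<in> bits" "c \<in> bits" "g \<in> bits"
    then have le: "a \<le> 1" "b \<le> 1" "c \<le> 1" "g \<le> 1" using assms by (auto simp: bits_def)
    show "card {n \<in> ?A. ?s n = (a, b, c, g)}
      = (if a + b + c + w = m + g then (w + 2 - 2 * g) choose 2 else 0)"
    proof (cases "a + b + c + w = m + g \<and> 2 * g \<le> w")
      case True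
      then have "{n \<in> ?A. ?s n = (a, b, c, g)} = slice a b c g (w - 2 * g)"
        using x le by (auto simp: slice_def indices_iff)
      moreover have "w + 2 - 2 * g = w - 2 * g + 2" using True by linarith
      ultimately show ?thesis using True by (simp only: card_slice) simp
    next
      case False
      then have "{n \<in> ?A. ?s n = (a, b, c, g)} = {}"
        by (auto simp: indices_iff)
      moreover have "(w + 2 - 2 * g) choose 2 = 0" if "\<not> 2 * g \<le> w"
        using that le by (intro binomial_eq_0) auto
      ultimately show ?thesis using False by (simp only: card.empty) auto
    qed
  qed
  finally show ?thesis .
qed

lemma card_indices: "card (indices m w) = (\<Sum>(a, b, c, g) \<in> bits \<times> bits \<times> bits \<times> bits.
    if a + b + c + w = m + g then (w + 2 - 2 * g) choose 2 else 0)"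
proof -
  have "indices m w = {n \<in> indices m w. n H \<in> bits}"
    by (auto simp: indices_iff bits_def le_Suc_eq)
  then show ?thesis using card_indices_H[of bits m w] by simp
qed

text \<open>Eigenvalue 0 leaves only the exponents of \<open>h\<close>, \<open>f\<close> and \<open>h\<and>f\<close>, and the last one equals the weight.\<close>

lemma card_harmonic_H:
  assumes "A \<subseteq> bits"
  shows "card {n \<in> harmonic m w. n H \<in> A} = (\<Sum>(a, c) \<in> A \<times> bits. if a + c + w = m then 1 else 0)"
proof -
  let ?D = "{x \<in> A \<times> bits. fst x + snd x + w = m}"
  let ?\<phi> = "\<lambda>(a, c). exponents a 0 c 0 0 w 0"
  have "bij_betw ?\<phi> ?D {n \<in> harmonic m w. n H \<in> A}"
    unfolding bij_betw_def
  proof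
    show "inj_on ?\<phi> ?D"
      by (rule inj_onI) (auto dest: fun_cong[where x = H] fun_cong[where x = F])
    show "?\<phi> ` ?D = {n \<in> harmonic m w. n H \<in> A}"
    proof (intro equalityI subsetI)
      fix n assume n: "n \<in> {n \<in> harmonic m w. n H \<in> A}"
      have "n = ?\<phi> (n H, n F)"
        using n by (subst exponents_eq[of n]) (auto simp: harmonic_def indices_iff total_wt_def sum_gen)
      moreover have "(n H, n F) \<in> ?D"
        using n by (auto simp: harmonic_def indices_iff total_wt_def sum_gen bits_def le_Suc_eq)
      ultimately show "n \<in> ?\<phi> ` ?D" by blast
    qed (use assms in \<open>auto simp: harmonic_def indices_iff total_wt_def sum_gen bits_def\<close>)
  qed
  then have "card {n \<in> harmonic m w. n H \<in> A} = card ?D" by (simp add: bij_betw_same_card)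
  also have "finite (A \<times> bits)" using assms by (auto simp: bits_def intro: finite_subset)
  then have "card ?D = (\<Sum>x \<in> A \<times> bits. if fst x + snd x + w = m then 1 else 0)"
    by (simp add: sum.If_cases Int_def)
  finally show ?thesis by (simp add: case_prod_beta)
qed

lemma card_harmonic: "card (harmonic m w) = (\<Sum>(a, c) \<in> bits \<times> bits. if a + c + w = m then 1 else 0)"
proof -
  have "harmonic m w = {n \<in> harmonic m w. n H \<in> bits}"
    by (auto simp: harmonic_def indices_iff bits_def le_Suc_eq)
  then show ?thesis using card_harmonic_H[of bits m w] by simp
qed

lemma card_exact: "card (exact m w) = card {n \<in> indices m w. n H \<in> {0}} - card {n \<in> harmonic m w. n H \<in> {0}}"
proof -
  have "exact m w = {n \<in> indices m w. n H \<in> {0}} - {n \<in> harmonic m w. n H \<in> {0}}"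
    by (auto simp: exact_def harmonic_def)
  moreover have "finite {n \<in> harmonic m w. n H \<in> {0}}"
    using finite_indices by (simp add: harmonic_def)
  ultimately show ?thesis by (simp add: card_Diff_subset) (simp add: harmonic_def card_Diff_subset Collect_mono)
qed

lemma dim_chain_space: "dim (chain_space (int m) w :: 'a chain_algebra set) = card (indices m w)"
proof -
  have z: "a n = 0" if 0: "(\<Sum>n\<in>indices m w. a n *\<^sub>R monomial n) = 0" and n: "n \<in> indices m w" for a n
  proof -
    have "coef (\<Sum>k\<in>indices m w. a k *\<^sub>R monomial k) n = (\<Sum>k\<in>indices m w. if k = n then a k else 0)"
      unfolding linear_sum[OF linear_coef] linear_scale[OF linear_coef]
      by (intro sum.cong) (auto simp: coef_monomial' indices_def)
    also have "\<dots> = a n" using n by (simp add: finite_indices)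
    finally show ?thesis unfolding 0 using linear_0[OF linear_coef] by simp
  qed
  have fam: "inj_on monomial (indices m w)" "independent (monomial ` indices m w)"
    using independent_family[OF finite_indices[of m w], of monomial] z by blast+
  show ?thesis
    by (simp only: chain_space_eq dim_span_eq_card_independent[OF fam(2)] card_image[OF fam(1)])
qed

lemma dim_cycles: "dim (cycles br (int m) w) = card (harmonic m w) + card (exact m w)"
  and betti_eq: "betti br (int m) w = card (harmonic m w)"
proof -
  let ?I = "harmonic m w \<union> exact m w"
  have fin: "finite (harmonic m w)" "finite (exact m w)"
    using finite_indices by (auto simp: harmonic_def exact_def)
  then have finI: "finite ?I" by simp
  have fam: "inj_on cycle_gen ?I" "independent (cycle_gen ` ?I)"
    using independent_family[OF finI, of cycle_gen] cycle_gen_independent by blast+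
  show "dim (cycles br (int m) w) = card (harmonic m w) + card (exact m w)"
    by (simp only: cycles_eq dim_span_eq_card_independent[OF fam(2)] card_image[OF fam(1)]
        card_Un_disjoint[OF fin harmonic_exact_disjoint])
  have "betti br (int m) w = card (cycle_gen ` ?I - cycle_gen ` exact m w)"
    unfolding betti_def cycles_eq boundaries_eq
    by (rule quotient_dim_span) (use finI fam(2) in auto)
  also have "cycle_gen ` ?I - cycle_gen ` exact m w = cycle_gen ` (?I - exact m w)"
    by (rule inj_on_image_set_diff[OF fam(1), symmetric]) auto
  also have "?I - exact m w = harmonic m w"
    using harmonic_exact_disjoint[of m w] by blast
  also have "card (cycle_gen ` harmonic m w) = card (harmonic m w)"
    by (rule card_image) (rule inj_on_subset[OF fam(1)], auto)
  finally show "betti br (int m) w = card (harmonic m w)" .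
qed

end

text \<open>Let \<open>e\<close> span the derived algebra. A vector that does not commute with \<open>e\<close> has a multiple
  \<open>h\<close> with \<open>[h, e] = e\<close>. Any third vector of a basis becomes central after adding suitable multiples of \<open>e\<close>
  and \<open>h\<close>.\<close>

lemma adapted_basis:
  fixes br :: "'a::real_vector \<Rightarrow> 'a \<Rightarrow> 'a"
  assumes lie: "lie_bracket br" and dim3: "dim (UNIV :: 'a set) = 3"
    and dim1: "dim (derived_algebra br) = 1" and noncentral: "\<not> derived_algebra br \<subseteq> lie_center br"
  obtains h e f ch ce cf where "affine_times_line h e f ch ce cf br"
proof -
  have bil: "bilinear br" and alt: "br z z = 0" for z
    using lie by (auto simp: lie_bracket_def)
  note lin = bilinear_ladd[OF bil] bilinear_radd[OF bil] bilinear_lmul[OF bil] bilinear_rmul[OF bil]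
    bilinear_lsub[OF bil] bilinear_rsub[OF bil]
  have anti: "br x y = - br y x" for x y
  proof -
    have "br (x + y) (x + y) = br x y + br y x"
      unfolding lin by (simp add: alt)
    then have "br x y + br y x = 0" by (simp only: alt)
    then show ?thesis by (simp only: eq_neg_iff_add_eq_0)
  qed
  obtain B where B: "derived_algebra br \<subseteq> span B" "card B = 1"
  proof -
    obtain B where "derived_algebra br \<subseteq> span B" "card B = dim (derived_algebra br)"
      by (rule basis_exists)
    then show thesis using dim1 by (intro that[of B]) simp_all
  qed
  obtain e where "B = {e}" using B(2) by (rule card_1_singletonE)
  with B(1) have De: "derived_algebra br \<subseteq> span {e}" by simp
  have ex: "\<exists>t. br x y = t *\<^sub>R e" for x y
  proof -
    have "br x y \<in> derived_algebra br"
      unfolding derived_algebra_def by (rule span_base) auto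
    then have "br x y \<in> span {e}" by (rule subsetD[OF De])
    then show ?thesis unfolding span_singleton by (rule imageE) (rule exI)
  qed
  obtain z x where z: "z \<in> derived_algebra br" and zx: "br z x \<noteq> 0"
    using noncentral unfolding lie_center_def by blast
  have "z \<in> span {e}" using z De by blast
  then obtain c where "z = c *\<^sub>R e" unfolding span_singleton by blast
  with zx have "br e x \<noteq> 0" by (auto simp: lin)
  moreover obtain t where t: "br e x = t *\<^sub>R e" using ex by blast
  ultimately have "t \<noteq> 0" "e \<noteq> 0" by auto
  define h where "h = (- 1 / t) *\<^sub>R x"
  have he: "br h e = e"
    using \<open>t \<noteq> 0\<close> by (simp add: h_def lin bilinear_lneg[OF bil] anti[of x e] t)
  have eh: "br e h = - e" using anti[of e h] he by simp
  have h_e: "h \<notin> span {e}"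
  proof
    assume "h \<in> span {e}"
    then obtain s where "h = s *\<^sub>R e" unfolding span_singleton by blast
    then have "br h e = 0" by (simp add: lin alt)
    with he \<open>e \<noteq> 0\<close> show False by simp
  qed
  have ind2: "independent {h, e}"
    using h_e \<open>e \<noteq> 0\<close> by (intro independent_insertI) (auto simp: independent_empty)
  obtain T :: "'a set" where "UNIV \<subseteq> span T" and T: "card T = 3"
  proof -
    obtain B where "(UNIV :: 'a set) \<subseteq> span B" "card B = dim (UNIV :: 'a set)"
      by (rule basis_exists)
    then show thesis using dim3 by (intro that[of B]) simp_all
  qed
  then have T1: "span T = UNIV" by blast
  have finT: "finite T" by (rule card_ge_0_finite) (simp add: T)
  have "span {h, e} \<noteq> UNIV"
  proof
    assume "span {h, e} = UNIV"
    then have "dim (UNIV :: 'a set) \<le> card {h, e}"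
      by (intro dim_le_card) auto
    also have "\<dots> \<le> 2" by (simp add: card_insert_if)
    finally show False using dim3 by simp
  qed
  then obtain v where v: "v \<notin> span {h, e}" by blast
  obtain s where s: "br h v = s *\<^sub>R e" using ex by blast
  obtain r where r: "br e (v - s *\<^sub>R e) = r *\<^sub>R e" using ex by blast
  \<comment> \<open>The multiple of e makes f commute with h, the multiple of h makes it commute with e.\<close>
  define f where "f = v - s *\<^sub>R e + r *\<^sub>R h"
  have hf: "br h f = 0" by (simp add: f_def lin s he alt)
  have ef: "br e f = 0"
    unfolding f_def bilinear_radd[OF bil] r by (simp add: lin eh)
  have f: "f \<notin> span {h, e}"
  proof
    assume "f \<in> span {h, e}"
    moreover have "s *\<^sub>R e - r *\<^sub>R h \<in> span {h, e}"
      by (intro span_diff span_scale span_base) auto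
    ultimately have "f + (s *\<^sub>R e - r *\<^sub>R h) \<in> span {h, e}" by (rule span_add)
    then show False using v by (simp add: f_def)
  qed
  then have ind3: "independent {f, h, e}"
    using ind2 by (rule independent_insertI)
  have "f \<noteq> h" "f \<noteq> e" "h \<noteq> e" using f h_e by (auto intro: span_base)
  then have card3: "card {f, h, e} = 3" by simp
  have "x \<in> span {f, h, e}" for x
  proof (rule ccontr)
    assume x: "x \<notin> span {f, h, e}"
    then have "independent (insert x {f, h, e})" using ind3 by (rule independent_insertI)
    then have "card (insert x {f, h, e}) \<le> card T"
      using independent_span_bound[OF finT] T1 by blast
    moreover have "x \<notin> {f, h, e}" using x by (auto intro: span_base)
    then have "card (insert x {f, h, e}) = Suc (card {f, h, e})"
      by (intro card_insert_disjoint) simp_all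
    ultimately show False using card3 T by simp
  qed
  then have span3: "x \<in> span {f, h, e}" for x .
  have coord: "\<exists>g :: 'a \<Rightarrow> real. linear g \<and> (\<forall>x\<in>{f, h, e}. g x = (if x = b then 1 else 0))" for b
    by (rule linear_independent_extend[OF ind3])
  obtain ch :: "'a \<Rightarrow> real" where ch: "linear ch" "\<forall>x\<in>{f, h, e}. ch x = (if x = h then 1 else 0)"
    using coord by blast
  obtain ce :: "'a \<Rightarrow> real" where ce: "linear ce" "\<forall>x\<in>{f, h, e}. ce x = (if x = e then 1 else 0)"
    using coord by blast
  obtain cf :: "'a \<Rightarrow> real" where cf: "linear cf" "\<forall>x\<in>{f, h, e}. cf x = (if x = f then 1 else 0)"
    using coord by blast
  note ne = \<open>f \<noteq> h\<close> \<open>f \<noteq> e\<close> \<open>h \<noteq> e\<close>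
  have expand: "x = ch x *\<^sub>R h + ce x *\<^sub>R e + cf x *\<^sub>R f" for x
  proof (rule linear_eq_on_span[of "\<lambda>x. x" "\<lambda>x. ch x *\<^sub>R h + ce x *\<^sub>R e + cf x *\<^sub>R f" "{f, h, e}"])
    show "linear (\<lambda>x :: 'a. x)" by (simp add: linear_iff)
    show "linear (\<lambda>x. ch x *\<^sub>R h + ce x *\<^sub>R e + cf x *\<^sub>R f)"
      using ch(1) ce(1) cf(1) by (simp add: linear_iff algebra_simps)
    show "x = ch x *\<^sub>R h + ce x *\<^sub>R e + cf x *\<^sub>R f" if "x \<in> {f, h, e}" for x
      using that ch(2) ce(2) cf(2) ne by auto
  qed (rule span3)
  have "basis3 h e f ch ce cf"
  proof (rule basis3.intro)
    show "linear ch" "linear ce" "linear cf" by (rule ch(1) ce(1) cf(1))+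
    fix y show "y = ch y *\<^sub>R h + ce y *\<^sub>R e + cf y *\<^sub>R f" by (rule expand)
  qed (use ch(2) ce(2) cf(2) ne in auto)
  then have "affine_times_line h e f ch ce cf br"
    by (simp add: affine_times_line_def affine_times_line_axioms_def lie he hf ef)
  then show thesis by (rule that)
qed

context affine_times_line
begin

lemma dim_chain_space_negative: "m < 0 \<Longrightarrow> dim (chain_space m w :: 'a chain_algebra set) = 0"
  using dim_span_eq_card_independent[OF independent_empty] by (simp add: chain_space_negative)

lemma cycles_negative: "m < 0 \<Longrightarrow> cycles br m w = {0}"
  using linear_0[OF linear_differential] by (auto simp: cycles_def chain_space_negative boundary_eq)

lemma dim_cycles_negative: "m < 0 \<Longrightarrow> dim (cycles br m w) = 0"
  using dim_span_eq_card_independent[OF independent_empty] by (simp add: cycles_negative)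

lemma betti_negative:
  assumes "m < 0"
  shows "betti br m w = 0"
  unfolding betti_def cycles_negative[OF assms]
proof (rule quotient_dim_zero)
  have "0 = boundary br 0" using linear_0[OF linear_differential] by (simp add: boundary_eq)
  moreover have "0 \<in> chain_space (m + 1) w" by (simp add: chain_space_def span_zero)
  ultimately show "0 \<in> boundary br ` chain_space (m + 1) w" by (rule image_eqI)
qed

lemma chain_space_finite:
  "\<exists>B. finite B \<and> (chain_space m w :: 'a chain_algebra set) \<subseteq> span B"
proof (cases "m < 0")
  case True
  then show ?thesis by (intro exI[of _ "{}"]) (simp add: chain_space_negative)
next
  case False
  then obtain k where "m = int k" by (metis int_nat_eq not_less)
  then show ?thesis
    using finite_indices[of k w] by (intro exI[of _ "monomial ` indices k w"]) (simp add: chain_space_eq)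
qed

end

theorem theorem6p2:
  fixes br :: "'a::real_vector \<Rightarrow> 'a \<Rightarrow> 'a" and w :: nat
  assumes "lie_bracket br"
    and "dim (UNIV :: 'a set) = 3"
    and "dim (derived_algebra br) = 1"
    and "\<not> derived_algebra br \<subseteq> lie_center br"
  shows "(\<forall>m\<in>{int w - 1..int w + 3}. \<exists>B. finite B \<and> (chain_space m w :: 'a chain_algebra set) \<subseteq> span B) \<and>
    (dim (chain_space (int w - 1) w :: 'a chain_algebra set) = w choose 2 \<and>
     dim (cycles br (int w - 1) w) = w choose 2 \<and>
     betti br (int w - 1) w = 0) \<and>
    (dim (chain_space (int w) w :: 'a chain_algebra set) = 3 * (w choose 2) + (w + 2 choose 2) \<and>
     dim (cycles br (int w) w) = 2 * (w choose 2) + (w + 2 choose 2) \<and>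
     betti br (int w) w = 1) \<and>
    (dim (chain_space (int w + 1) w :: 'a chain_algebra set) = 3 * (w choose 2) + 3 * (w + 2 choose 2) \<and>
     dim (cycles br (int w + 1) w) = 1 + (w choose 2) + 2 * (w + 2 choose 2) \<and>
     betti br (int w + 1) w = 2) \<and>
    (dim (chain_space (int w + 2) w :: 'a chain_algebra set) = (w choose 2) + 3 * (w + 2 choose 2) \<and>
     dim (cycles br (int w + 2) w) = 1 + (w + 2 choose 2) \<and>
     betti br (int w + 2) w = 1) \<and>
    (dim (chain_space (int w + 3) w :: 'a chain_algebra set) = w + 2 choose 2 \<and>
     dim (cycles br (int w + 3) w) = 0 \<and>
     betti br (int w + 3) w = 0)"
proof -
  obtain h e f ch ce cf where "affine_times_line h e f ch ce cf br"
    using adapted_basis[OF assms] .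
  then interpret affine_times_line h e f ch ce cf br .
  have "{0} \<subseteq> bits" by (simp add: bits_def)
  note counts = dim_chain_space dim_cycles betti_eq card_indices card_exact card_harmonic
    card_indices_H[OF this] card_harmonic_H[OF this] bits_def
  have neg: "dim (chain_space (int w - 1) w :: 'a chain_algebra set) = w choose 2 \<and>
      dim (cycles br (int w - 1) w) = w choose 2 \<and> betti br (int w - 1) w = 0"
  \<comment> \<open>For weight 0 the first row of the table concerns degree - 1.\<close>
  proof (cases w)
    case 0
    then show ?thesis
      using dim_chain_space_negative[of "- 1" 0] dim_cycles_negative[of "- 1" 0] betti_negative[of "- 1" 0]
      by simp
  next
    case (Suc k)
    have k: "int w - 1 = int k" using Suc by simp
    show ?thesis unfolding k counts by (simp add: Suc)
  qed
  have w0: "dim (chain_space (int w) w :: 'a chain_algebra set) = 3 * (w choose 2) + (w + 2 choose 2) \<and>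
      dim (cycles br (int w) w) = 2 * (w choose 2) + (w + 2 choose 2) \<and> betti br (int w) w = 1"
    unfolding counts by simp
  have m: "int w + 1 = int (w + 1)" "int w + 2 = int (w + 2)" "int w + 3 = int (w + 3)" by simp_all
  have w1: "dim (chain_space (int w + 1) w :: 'a chain_algebra set) = 3 * (w choose 2) + 3 * (w + 2 choose 2) \<and>
      dim (cycles br (int w + 1) w) = 1 + (w choose 2) + 2 * (w + 2 choose 2) \<and> betti br (int w + 1) w = 2"
    unfolding m counts by simp
  have w2: "dim (chain_space (int w + 2) w :: 'a chain_algebra set) = (w choose 2) + 3 * (w + 2 choose 2) \<and>
      dim (cycles br (int w + 2) w) = 1 + (w + 2 choose 2) \<and> betti br (int w + 2) w = 1"
    unfolding m counts by simp
  have w3: "dim (chain_space (int w + 3) w :: 'a chain_algebra set) = w + 2 choose 2 \<and>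
      dim (cycles br (int w + 3) w) = 0 \<and> betti br (int w + 3) w = 0"
    unfolding m counts by simp
  have fin: "\<forall>m\<in>{int w - 1..int w + 3}. \<exists>B. finite B \<and> (chain_space m w :: 'a chain_algebra set) \<subseteq> span B"
    by (intro ballI chain_space_finite)
  show ?thesis by (intro conjI[OF fin] conjI[OF neg] conjI[OF w0] conjI[OF w1] conjI[OF w2] w3)
qed

end
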